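(* Let $F$ be a field with a valuation $v:F^\times\to\Gamma$ ($\Gamma$ a totally ordered abelian group) and residue field $k$. There is a surjective $R_F$-module homomorphism $$S_v:\mathcal{RP}(F)\to\mathrm{Ind}^F_k\,\widetilde{\mathcal{RP}}(k)$$ given, for $a\in F^\times$, by $$[a]\mapsto\begin{cases}1\otimes[\bar a],&v(a)=0,\\ 1\otimes C_k,&v(a)>0,\\ -(1\otimes C_k),&v(a)<0.\end{cases}$$
   Context: For a field $F$, $R_F=\mathbb Z[F^\times/(F^\times)^2]$; $\langle x\rangle\in R_F$ is the square class of $x\in F^\times$; $\langle\!\langle x\rangle\!\rangle=\langle x\rangle-1$. If $F$ has at least $4$ elements, $\mathcal{RP}(F)$ is the $R_F$-module with generators $[x]$, $x\in F^\times$, and relations $[1]=0$ and, for all $x,y\in F^\times\setminus\{1\}$, $$0=[x]-[y]+\langle x\rangle\left[\tfrac yx\right]-\langle x^{-1}-1\rangle\left[\tfrac{1-x^{-1}}{1-y^{-1}}\right]+\langle 1-x\rangle\left[\tfrac{1-x}{1-y}\right].$$ Put $\psi_1(x)=[x]+\langle-1\rangle[x^{-1}]$ and let $\mathcal K^{(1)}_F$ be the $R_F$-submodule generated by all $\psi_1(x)$, $x\in F^\times$. The element $C_F=[x]+\langle-1\rangle[1-x]+\langle\!\langle1-x\rangle\!\rangle\psi_1(x)$ ($x\ne0,1$) is independent of $x$ and $6C_F=0$. Small fields: $\mathcal{RP}(\mathbb F_2)$ is a group of order $3$ with distinguished generator $C_{\mathbb F_2}$ (with $[1]=0$ and $\mathcal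 K^{(1)}_{\mathbb F_2}=0$). $\mathcal{RP}(\mathbb F_3)$ is the cyclic $R_{\mathbb F_3}$-module generated by $[-1]$ with the single relation $2([-1]+\langle-1\rangle[-1])=0$ (and $[1]=0$), and $C_{\mathbb F_3}=\psi_1(-1)=(1+\langle-1\rangle)[-1]$. For every field, $\widetilde{\mathcal{RP}}(F)=\mathcal{RP}(F)/\mathcal K^{(1)}_F$, and $[x]$, $C_F$ also denote the images in this quotient. A valuation $v:F^\times\to\Gamma$ is a (surjective) group homomorphism with $v(a+b)\ge\min\{v(a),v(b)\}$ whenever $a,b,a+b\in F^\times$. $U=\{a\in F^\times: v(a)=0\}$, $a\mapsto\bar a$ is reduction from the valuation ring to the residue field $k$; it induces $U/U^2\to k^\times/(k^\times)^2$, so any $R_k$-module $M$ is a $\mathbb Z[U/U^2]$-module, and $\mathrm{Ind}^F_kM:=R_F\otimes_{\mathbb Z[U/U^2]}M$. *)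

theory Defs
  imports "HOL-Algebra.Module" "HOL-Algebra.QuotRing" "HOL-Algebra.Free_Abelian_Groups"
begin

section \<open>Modules over a commutative ring\<close>

text \<open>The module records below leave the fields \<open>mult\<close> and \<open>one\<close>, which play no role for
  modules, unspecified.\<close>

definition mod_hom ::
  "('r, 'm) ring_scheme \<Rightarrow> ('r, 'a, 'n) module_scheme \<Rightarrow> ('r, 'b, 'k) module_scheme \<Rightarrow> ('a \<Rightarrow> 'b) set"
  where "mod_hom R M N = {h \<in> hom (add_monoid M) (add_monoid N).
    \<forall>r\<in>carrier R. \<forall>x\<in>carrier M. h (r \<odot>\<^bsub>M\<^esub> x) = r \<odot>\<^bsub>N\<^esub> h x}"

definition gen_submodule ::
  "('r, 'm) ring_scheme \<Rightarrow> ('r, 'a, 'n) module_scheme \<Rightarrow> 'a set \<Rightarrow> 'a set"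
  where "gen_submodule R M S = \<Inter>{N. submodule N R M \<and> S \<subseteq> N}"

definition quot_module :: "('r, 'a, 'n) module_scheme \<Rightarrow> 'a set \<Rightarrow> ('r, 'a set) module"
  where "quot_module M N =
    \<lparr>carrier = a_rcosets\<^bsub>M\<^esub> N, monoid.mult = undefined, monoid.one = undefined,
     ring.zero = N, ring.add = set_add M,
     smult = (\<lambda>r X. \<Union>x\<in>X. N +>\<^bsub>M\<^esub> (r \<odot>\<^bsub>M\<^esub> x))\<rparr>"

definition free_module :: "('r, 'm) ring_scheme \<Rightarrow> 'x set \<Rightarrow> ('r, 'x \<Rightarrow> 'r) module"
  where "free_module R X =
    \<lparr>carrier = {f \<in> X \<rightarrow>\<^sub>E carrier R. finite {x\<in>X. f x \<noteq> \<zero>\<^bsub>R\<^esub>}},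
     monoid.mult = undefined, monoid.one = undefined,
     ring.zero = (\<lambda>x\<in>X. \<zero>\<^bsub>R\<^esub>),
     ring.add = (\<lambda>f g. \<lambda>x\<in>X. f x \<oplus>\<^bsub>R\<^esub> g x),
     smult = (\<lambda>r f. \<lambda>x\<in>X. r \<otimes>\<^bsub>R\<^esub> f x)\<rparr>"

definition free_gen :: "('r, 'm) ring_scheme \<Rightarrow> 'x set \<Rightarrow> 'x \<Rightarrow> 'x \<Rightarrow> 'r"
  where "free_gen R X y = (\<lambda>x\<in>X. if x = y then \<one>\<^bsub>R\<^esub> else \<zero>\<^bsub>R\<^esub>)"

definition restrict_scalars ::
  "('s \<Rightarrow> 'r) \<Rightarrow> ('r, 'a, 'n) module_scheme \<Rightarrow> ('s, 'a) module"
  where "restrict_scalars \<phi> M =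
    \<lparr>carrier = carrier M, monoid.mult = monoid.mult M, monoid.one = monoid.one M,
     ring.zero = ring.zero M, ring.add = ring.add M,
     smult = (\<lambda>s x. \<phi> s \<odot>\<^bsub>M\<^esub> x)\<rparr>"

text \<open>For a ring homomorphism \<open>\<phi>\<close> from \<open>A\<close> to \<open>B\<close> and an \<open>A\<close>-module \<open>M\<close>, the tensor product of
  \<open>B\<close> and \<open>M\<close> over \<open>A\<close> is the free abelian group on pairs, modulo the subgroup generated by
  biadditivity and balancedness, with \<open>B\<close> acting through the first factor.\<close>

definition tensor_rels ::
  "('s, 'm) ring_scheme \<Rightarrow> ('s \<Rightarrow> 'r) \<Rightarrow> ('r, 'k) ring_scheme \<Rightarrow> ('s, 'a, 'n) module_scheme
    \<Rightarrow> ('r \<times> 'a \<Rightarrow>\<^sub>0 int) set"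
  where "tensor_rels A \<phi> B M = generate (free_Abelian_group (carrier B \<times> carrier M))
    ({frag_of (b \<oplus>\<^bsub>B\<^esub> b', m) - frag_of (b, m) - frag_of (b', m) | b b' m.
        b \<in> carrier B \<and> b' \<in> carrier B \<and> m \<in> carrier M}
   \<union> {frag_of (b, m \<oplus>\<^bsub>M\<^esub> m') - frag_of (b, m) - frag_of (b, m') | b m m'.
        b \<in> carrier B \<and> m \<in> carrier M \<and> m' \<in> carrier M}
   \<union> {frag_of (b \<otimes>\<^bsub>B\<^esub> \<phi> a, m) - frag_of (b, a \<odot>\<^bsub>M\<^esub> m) | a b m.
        a \<in> carrier A \<and> b \<in> carrier B \<and> m \<in> carrier M})"

definition tensor_group ::
  "('s, 'm) ring_scheme \<Rightarrow> ('s \<Rightarrow> 'r) \<Rightarrow> ('r, 'k) ring_scheme \<Rightarrow> ('s, 'a, 'n) module_scheme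
    \<Rightarrow> ('r \<times> 'a \<Rightarrow>\<^sub>0 int) set monoid"
  where "tensor_group A \<phi> B M =
    free_Abelian_group (carrier B \<times> carrier M) Mod tensor_rels A \<phi> B M"

definition tensor ::
  "('s, 'm) ring_scheme \<Rightarrow> ('s \<Rightarrow> 'r) \<Rightarrow> ('r, 'k) ring_scheme \<Rightarrow> ('s, 'a, 'n) module_scheme
    \<Rightarrow> 'r \<Rightarrow> 'a \<Rightarrow> ('r \<times> 'a \<Rightarrow>\<^sub>0 int) set"
  where "tensor A \<phi> B M b m =
    tensor_rels A \<phi> B M #>\<^bsub>free_Abelian_group (carrier B \<times> carrier M)\<^esub> frag_of (b, m)"

definition ext_scalars ::
  "('s, 'm) ring_scheme \<Rightarrow> ('s \<Rightarrow> 'r) \<Rightarrow> ('r, 'k) ring_scheme \<Rightarrow> ('s, 'a, 'n) module_scheme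
    \<Rightarrow> ('r, ('r \<times> 'a \<Rightarrow>\<^sub>0 int) set) module"
  where "ext_scalars A \<phi> B M =
    \<lparr>carrier = carrier (tensor_group A \<phi> B M), monoid.mult = undefined, monoid.one = undefined,
     ring.zero = \<one>\<^bsub>tensor_group A \<phi> B M\<^esub>, ring.add = monoid.mult (tensor_group A \<phi> B M),
     smult = (\<lambda>b X. \<Union>x\<in>X. tensor_rels A \<phi> B M
       #>\<^bsub>free_Abelian_group (carrier B \<times> carrier M)\<^esub>
         frag_extend (\<lambda>(c, m). frag_of (b \<otimes>\<^bsub>B\<^esub> c, m)) x)\<rparr>"


section \<open>Square classes and their group rings\<close>

definition squares :: "('a, 'm) monoid_scheme \<Rightarrow> 'a set"
  where "squares G = (\<lambda>x. x \<otimes>\<^bsub>G\<^esub> x) ` carrier G"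

definition sq_group :: "('a, 'm) monoid_scheme \<Rightarrow> 'a set monoid"
  where "sq_group G = G Mod squares G"

definition sq_class :: "('a, 'm) monoid_scheme \<Rightarrow> 'a \<Rightarrow> 'a set"
  where "sq_class G x = squares G #>\<^bsub>G\<^esub> x"

text \<open>The map on square classes induced by a homomorphism \<open>h\<close> from \<open>G\<close> to \<open>H\<close>.\<close>

definition sq_map :: "('b, 'm) monoid_scheme \<Rightarrow> ('a \<Rightarrow> 'b) \<Rightarrow> 'a set \<Rightarrow> 'b set"
  where "sq_map H h X = the_elem ((\<lambda>x. sq_class H (h x)) ` X)"

definition group_ring :: "('a, 'm) monoid_scheme \<Rightarrow> ('a \<Rightarrow>\<^sub>0 int) ring"
  where "group_ring G =
    \<lparr>carrier = {f. Poly_Mapping.keys f \<subseteq> carrier G},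
     monoid.mult = (\<lambda>f g. frag_extend (\<lambda>x. frag_extend (\<lambda>y. frag_of (x \<otimes>\<^bsub>G\<^esub> y)) g) f),
     monoid.one = frag_of \<one>\<^bsub>G\<^esub>, ring.zero = 0, ring.add = (+)\<rparr>"

definition group_ring_map :: "('a \<Rightarrow> 'b) \<Rightarrow> ('a \<Rightarrow>\<^sub>0 int) \<Rightarrow> ('b \<Rightarrow>\<^sub>0 int)"
  where "group_ring_map h = frag_extend (frag_of \<circ> h)"

definition RF :: "('a, 'm) ring_scheme \<Rightarrow> ('a set \<Rightarrow>\<^sub>0 int) ring"
  where "RF F = group_ring (sq_group (units_of F))"

definition sq_elt :: "('a, 'm) ring_scheme \<Rightarrow> 'a \<Rightarrow> ('a set \<Rightarrow>\<^sub>0 int)"  (\<open>\<langle>_\<rangle>\<index>\<close>)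
  where "\<langle>x\<rangle>\<^bsub>F\<^esub> = frag_of (sq_class (units_of F) x)"

definition pfister_elt :: "('a, 'm) ring_scheme \<Rightarrow> 'a \<Rightarrow> ('a set \<Rightarrow>\<^sub>0 int)"
  where "pfister_elt F x = \<langle>x\<rangle>\<^bsub>F\<^esub> \<ominus>\<^bsub>RF F\<^esub> \<one>\<^bsub>RF F\<^esub>"


section \<open>The refined pre-Bloch module\<close>

text \<open>The generator \<open>Some x\<close> stands for the symbol of the unit \<open>x\<close>.  The generator \<open>None\<close> is used
  only for the field with two elements, where it stands for the distinguished constant.\<close>

definition rp_gens :: "('a, 'm) ring_scheme \<Rightarrow> 'a option set"
  where "rp_gens F = (if order F = 2 then insert None (Some ` Units F) else Some ` Units F)"

abbreviation rp_free :: "('a, 'm) ring_scheme \<Rightarrow>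
    ('a set \<Rightarrow>\<^sub>0 int, 'a option \<Rightarrow> ('a set \<Rightarrow>\<^sub>0 int)) module"
  where "rp_free F \<equiv> free_module (RF F) (rp_gens F)"

abbreviation rp_gen :: "('a, 'm) ring_scheme \<Rightarrow> 'a option \<Rightarrow> 'a option \<Rightarrow> ('a set \<Rightarrow>\<^sub>0 int)"
  where "rp_gen F \<equiv> free_gen (RF F) (rp_gens F)"

definition five_term ::
  "('a, 'm) ring_scheme \<Rightarrow> 'a \<Rightarrow> 'a \<Rightarrow> 'a option \<Rightarrow> ('a set \<Rightarrow>\<^sub>0 int)"
  where "five_term F x y =
    (let M = rp_free F; e = (\<lambda>a. rp_gen F (Some a)) in
      e x \<ominus>\<^bsub>M\<^esub> e y
      \<oplus>\<^bsub>M\<^esub> \<langle>x\<rangle>\<^bsub>F\<^esub> \<odot>\<^bsub>M\<^esub> e (y \<otimes>\<^bsub>F\<^esub> inv\<^bsub>F\<^esub> x)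
      \<ominus>\<^bsub>M\<^esub> \<langle>inv\<^bsub>F\<^esub> x \<ominus>\<^bsub>F\<^esub> \<one>\<^bsub>F\<^esub>\<rangle>\<^bsub>F\<^esub> \<odot>\<^bsub>M\<^esub>
            e ((\<one>\<^bsub>F\<^esub> \<ominus>\<^bsub>F\<^esub> inv\<^bsub>F\<^esub> x) \<otimes>\<^bsub>F\<^esub> inv\<^bsub>F\<^esub> (\<one>\<^bsub>F\<^esub> \<ominus>\<^bsub>F\<^esub> inv\<^bsub>F\<^esub> y))
      \<oplus>\<^bsub>M\<^esub> \<langle>\<one>\<^bsub>F\<^esub> \<ominus>\<^bsub>F\<^esub> x\<rangle>\<^bsub>F\<^esub> \<odot>\<^bsub>M\<^esub>
            e ((\<one>\<^bsub>F\<^esub> \<ominus>\<^bsub>F\<^esub> x) \<otimes>\<^bsub>F\<^esub> inv\<^bsub>F\<^esub> (\<one>\<^bsub>F\<^esub> \<ominus>\<^bsub>F\<^esub> y)))"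

text \<open>\<open>order\<close> is \<open>0\<close> for infinite fields, which therefore fall into the last case.  For two
  elements the relations leave a group of order 3 generated by \<open>None\<close>.\<close>

definition rp_rels :: "('a, 'm) ring_scheme \<Rightarrow> ('a option \<Rightarrow> ('a set \<Rightarrow>\<^sub>0 int)) set"
  where "rp_rels F =
    insert (rp_gen F (Some \<one>\<^bsub>F\<^esub>))
     (if order F = 2 then {[(3::nat)] \<cdot>\<^bsub>rp_free F\<^esub> rp_gen F None}
      else if order F = 3 then
        {[(2::nat)] \<cdot>\<^bsub>rp_free F\<^esub> (rp_gen F (Some (\<ominus>\<^bsub>F\<^esub> \<one>\<^bsub>F\<^esub>))
           \<oplus>\<^bsub>rp_free F\<^esub> \<langle>\<ominus>\<^bsub>F\<^esub> \<one>\<^bsub>F\<^esub>\<rangle>\<^bsub>F\<^esub> \<odot>\<^bsub>rp_free F\<^esub> rp_gen F (Some (\<ominus>\<^bsub>F\<^esub> \<one>\<^bsub>F\<^esub>)))}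
      else {five_term F x y | x y. x \<in> Units F - {\<one>\<^bsub>F\<^esub>} \<and> y \<in> Units F - {\<one>\<^bsub>F\<^esub>}})"

abbreviation rp_relmod :: "('a, 'm) ring_scheme \<Rightarrow> ('a option \<Rightarrow> ('a set \<Rightarrow>\<^sub>0 int)) set"
  where "rp_relmod F \<equiv> gen_submodule (RF F) (rp_free F) (rp_rels F)"

definition RP :: "('a, 'm) ring_scheme \<Rightarrow>
    ('a set \<Rightarrow>\<^sub>0 int, ('a option \<Rightarrow> ('a set \<Rightarrow>\<^sub>0 int)) set) module"
  where "RP F = quot_module (rp_free F) (rp_relmod F)"

definition rp_sym :: "('a, 'm) ring_scheme \<Rightarrow> 'a \<Rightarrow> ('a option \<Rightarrow> ('a set \<Rightarrow>\<^sub>0 int)) set"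
  where "rp_sym F x = rp_relmod F +>\<^bsub>rp_free F\<^esub> rp_gen F (Some x)"

definition psi1 :: "('a, 'm) ring_scheme \<Rightarrow> 'a \<Rightarrow> ('a option \<Rightarrow> ('a set \<Rightarrow>\<^sub>0 int)) set"
  where "psi1 F x =
    rp_sym F x \<oplus>\<^bsub>RP F\<^esub> \<langle>\<ominus>\<^bsub>F\<^esub> \<one>\<^bsub>F\<^esub>\<rangle>\<^bsub>F\<^esub> \<odot>\<^bsub>RP F\<^esub> rp_sym F (inv\<^bsub>F\<^esub> x)"

text \<open>For at least four elements the constant is defined by a formula in \<open>x\<close> whose value does not
  depend on \<open>x\<close>; any \<open>x\<close> is chosen.\<close>

definition rp_const :: "('a, 'm) ring_scheme \<Rightarrow> ('a option \<Rightarrow> ('a set \<Rightarrow>\<^sub>0 int)) set"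
  where "rp_const F =
    (if order F = 2 then rp_relmod F +>\<^bsub>rp_free F\<^esub> rp_gen F None
     else if order F = 3 then psi1 F (\<ominus>\<^bsub>F\<^esub> \<one>\<^bsub>F\<^esub>)
     else let x = (SOME x. x \<in> Units F - {\<one>\<^bsub>F\<^esub>}) in
       rp_sym F x
       \<oplus>\<^bsub>RP F\<^esub> \<langle>\<ominus>\<^bsub>F\<^esub> \<one>\<^bsub>F\<^esub>\<rangle>\<^bsub>F\<^esub> \<odot>\<^bsub>RP F\<^esub> rp_sym F (\<one>\<^bsub>F\<^esub> \<ominus>\<^bsub>F\<^esub> x)
       \<oplus>\<^bsub>RP F\<^esub> pfister_elt F (\<one>\<^bsub>F\<^esub> \<ominus>\<^bsub>F\<^esub> x) \<odot>\<^bsub>RP F\<^esub> psi1 F x)"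

definition K1 :: "('a, 'm) ring_scheme \<Rightarrow> ('a option \<Rightarrow> ('a set \<Rightarrow>\<^sub>0 int)) set set"
  where "K1 F = gen_submodule (RF F) (RP F) (psi1 F ` Units F)"

definition RPt :: "('a, 'm) ring_scheme \<Rightarrow>
    ('a set \<Rightarrow>\<^sub>0 int, ('a option \<Rightarrow> ('a set \<Rightarrow>\<^sub>0 int)) set set) module"
  where "RPt F = quot_module (RP F) (K1 F)"

definition rpt_sym :: "('a, 'm) ring_scheme \<Rightarrow> 'a \<Rightarrow> ('a option \<Rightarrow> ('a set \<Rightarrow>\<^sub>0 int)) set set"
  where "rpt_sym F x = K1 F +>\<^bsub>RP F\<^esub> rp_sym F x"

definition rpt_const :: "('a, 'm) ring_scheme \<Rightarrow> ('a option \<Rightarrow> ('a set \<Rightarrow>\<^sub>0 int)) set set"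
  where "rpt_const F = K1 F +>\<^bsub>RP F\<^esub> rp_const F"


section \<open>Valued fields and induced modules\<close>

text \<open>Only the values of \<open>v\<close> on nonzero elements matter.\<close>

definition valuation :: "('a, 'm) ring_scheme \<Rightarrow> ('a \<Rightarrow> 'g::linordered_ab_group_add) \<Rightarrow> bool"
  where "valuation F v \<longleftrightarrow>
    (\<forall>a\<in>Units F. \<forall>b\<in>Units F. v (a \<otimes>\<^bsub>F\<^esub> b) = v a + v b) \<and>
    v ` Units F = UNIV \<and>
    (\<forall>a\<in>Units F. \<forall>b\<in>Units F. a \<oplus>\<^bsub>F\<^esub> b \<in> Units F \<longrightarrow> min (v a) (v b) \<le> v (a \<oplus>\<^bsub>F\<^esub> b))"

definition val_ring :: "('a, 'm) ring_scheme \<Rightarrow> ('a \<Rightarrow> 'g::linordered_ab_group_add)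
    \<Rightarrow> ('a, 'm) ring_scheme"
  where "val_ring F v = F\<lparr>carrier := insert \<zero>\<^bsub>F\<^esub> {a \<in> Units F. 0 \<le> v a}\<rparr>"

definition val_ideal :: "('a, 'm) ring_scheme \<Rightarrow> ('a \<Rightarrow> 'g::linordered_ab_group_add) \<Rightarrow> 'a set"
  where "val_ideal F v = insert \<zero>\<^bsub>F\<^esub> {a \<in> Units F. 0 < v a}"

definition res_field :: "('a, 'm) ring_scheme \<Rightarrow> ('a \<Rightarrow> 'g::linordered_ab_group_add) \<Rightarrow> 'a set ring"
  where "res_field F v = val_ring F v Quot val_ideal F v"

definition reduction :: "('a, 'm) ring_scheme \<Rightarrow> ('a \<Rightarrow> 'g::linordered_ab_group_add) \<Rightarrow> 'a \<Rightarrow> 'a set"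
  where "reduction F v a = val_ideal F v +>\<^bsub>val_ring F v\<^esub> a"

definition val_units :: "('a, 'm) ring_scheme \<Rightarrow> ('a \<Rightarrow> 'g::linordered_ab_group_add) \<Rightarrow> 'a monoid"
  where "val_units F v = (units_of F)\<lparr>carrier := {a \<in> Units F. v a = 0}\<rparr>"

definition RU :: "('a, 'm) ring_scheme \<Rightarrow> ('a \<Rightarrow> 'g::linordered_ab_group_add) \<Rightarrow> ('a set \<Rightarrow>\<^sub>0 int) ring"
  where "RU F v = group_ring (sq_group (val_units F v))"

text \<open>The maps on group rings induced by the inclusion of the valuation units and by reduction.\<close>

definition RU_incl :: "('a, 'm) ring_scheme \<Rightarrow> ('a set \<Rightarrow>\<^sub>0 int) \<Rightarrow> ('a set \<Rightarrow>\<^sub>0 int)"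
  where "RU_incl F = group_ring_map (sq_map (units_of F) (\<lambda>u. u))"

definition RU_red :: "('a, 'm) ring_scheme \<Rightarrow> ('a \<Rightarrow> 'g::linordered_ab_group_add)
    \<Rightarrow> ('a set \<Rightarrow>\<^sub>0 int) \<Rightarrow> ('a set set \<Rightarrow>\<^sub>0 int)"
  where "RU_red F v = group_ring_map (sq_map (units_of (res_field F v)) (reduction F v))"

definition Ind :: "('a, 'm) ring_scheme \<Rightarrow> ('a \<Rightarrow> 'g::linordered_ab_group_add)
    \<Rightarrow> ('a set set \<Rightarrow>\<^sub>0 int, 'b, 'n) module_scheme
    \<Rightarrow> ('a set \<Rightarrow>\<^sub>0 int, (('a set \<Rightarrow>\<^sub>0 int) \<times> 'b \<Rightarrow>\<^sub>0 int) set) module"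
  where "Ind F v M = ext_scalars (RU F v) (RU_incl F) (RF F) (restrict_scalars (RU_red F v) M)"

definition ind_tensor :: "('a, 'm) ring_scheme \<Rightarrow> ('a \<Rightarrow> 'g::linordered_ab_group_add)
    \<Rightarrow> ('a set set \<Rightarrow>\<^sub>0 int, 'b, 'n) module_scheme \<Rightarrow> ('a set \<Rightarrow>\<^sub>0 int) \<Rightarrow> 'b
    \<Rightarrow> (('a set \<Rightarrow>\<^sub>0 int) \<times> 'b \<Rightarrow>\<^sub>0 int) set"
  where "ind_tensor F v M = tensor (RU F v) (RU_incl F) (RF F) (restrict_scalars (RU_red F v) M)"

end

theory Submission
  imports Defs
begin

text \<open>
  Let \<open>s a\<close> be the prescribed image of the symbol of \<open>a\<close>, and let \<open>D = 1 \<otimes> C\<close>.  It satisfies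
  \<open>s (1/a) = - <-1> s a\<close> and \<open>s x + <-1> s (1 - x) = D\<close>, and these two identities alone
  imply that the five-term expressions of \<open>s\<close> at \<open>(x, y)\<close> and at \<open>(1/(1 - x), 1/(1 - y))\<close> agree.
  The substitution \<open>x \<mapsto> 1/(1 - x)\<close> permutes the residue points 0, 1, \<open>\<infinity>\<close> cyclically, so one may
  assume that \<open>x\<close> reduces to 0, or that \<open>x\<close> reduces to a point other than these three while
  \<open>y\<close> reduces to another such point or to 0.  In the first case the third and fourth terms cancel
  and the others cancel by the identities above.  In the second case the expression is the image
  of the five-term relation over the residue field, or it vanishes by the relation
  \<open>[x] - <-x>[x] = <1 - x>(1 - <x>) C\<close>.
\<close>

section \<open>Modules\<close>

text \<open>Over the residue field the inversion identity holds because \<open>K1\<close> is divided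
  out; the formula for the constant then loses its last summand and becomes the complement identity.
  Over \<open>F\<close> the obstacle is an \<open>x\<close> of negative value: \<open>x\<close> and
  \<open>1 - x\<close> both go to \<open>- D\<close>, so the complement identity asks for
  \<open>- 2 D = D\<close>. This is \<open>3 C = 0\<close>, which results from adding the complement
  identities of the three complementary pairs in the orbit of \<open>x\<close> under
  \<open>x \<mapsto> 1 - x\<close> and \<open>x \<mapsto> 1/x\<close>. The relation between
  \<open>[x] - <-x>[x]\<close> and \<open>C\<close> comes from two five-term relations and requires
  an element other than 0, 1 and \<open>x\<close>. Residue fields with two or three elements are
  therefore treated separately. With two, no units satisfy \<open>x + p = 1\<close>, and
  \<open>3 C = 0\<close> is a defining relation; with three, \<open>C\<close> is \<open>psi1\<close>
  of -1 and dies in the quotient. Complements are carried as variables \<open>p\<close>,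
  \<open>q\<close> with \<open>x + p = 1\<close>, \<open>y + q = 1\<close>, so that complementing
  and rotating act on pairs of units. Surjectivity is delicate only when the residue field has two
  elements, since \<open>C\<close> is then not a combination of symbols.\<close>

lemma mod_homD:
  assumes "h \<in> mod_hom R M N"
  shows mod_hom_closed: "x \<in> carrier M \<Longrightarrow> h x \<in> carrier N"
    and mod_hom_add: "\<lbrakk>x \<in> carrier M; y \<in> carrier M\<rbrakk> \<Longrightarrow> h (x \<oplus>\<^bsub>M\<^esub> y) = h x \<oplus>\<^bsub>N\<^esub> h y"
    and mod_hom_smult: "\<lbrakk>r \<in> carrier R; x \<in> carrier M\<rbrakk> \<Longrightarrow> h (r \<odot>\<^bsub>M\<^esub> x) = r \<odot>\<^bsub>N\<^esub> h x"
  using assms by (auto simp: mod_hom_def hom_def)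

lemma mod_homI:
  assumes "\<And>x. x \<in> carrier M \<Longrightarrow> h x \<in> carrier N"
    and "\<And>x y. \<lbrakk>x \<in> carrier M; y \<in> carrier M\<rbrakk> \<Longrightarrow> h (x \<oplus>\<^bsub>M\<^esub> y) = h x \<oplus>\<^bsub>N\<^esub> h y"
    and "\<And>r x. \<lbrakk>r \<in> carrier R; x \<in> carrier M\<rbrakk> \<Longrightarrow> h (r \<odot>\<^bsub>M\<^esub> x) = r \<odot>\<^bsub>N\<^esub> h x"
  shows "h \<in> mod_hom R M N"
  using assms by (auto simp: mod_hom_def hom_def)

lemma mod_hom_group_hom:
  assumes "h \<in> mod_hom R M N" "abelian_group M" "abelian_group N"
  shows "abelian_group_hom M N h"
  by (intro abelian_group_homI group_hom.intro group_hom_axioms.intro assms abelian_group.a_group)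
    (use assms(1) in \<open>simp add: mod_hom_def\<close>)

lemma mod_hom_zero:
  assumes "h \<in> mod_hom R M N" "abelian_group M" "abelian_group N"
  shows "h \<zero>\<^bsub>M\<^esub> = \<zero>\<^bsub>N\<^esub>"
  using abelian_group_hom.hom_zero[OF mod_hom_group_hom[OF assms]] .

lemma mod_hom_minus:
  assumes "h \<in> mod_hom R M N" "abelian_group M" "abelian_group N" "x \<in> carrier M"
  shows "h (\<ominus>\<^bsub>M\<^esub> x) = \<ominus>\<^bsub>N\<^esub> h x"
  using abelian_group_hom.hom_a_inv[OF mod_hom_group_hom[OF assms(1-3)] assms(4)] .

lemma mod_hom_diff:
  assumes "h \<in> mod_hom R M N" "abelian_group M" "abelian_group N" "x \<in> carrier M" "y \<in> carrier M"
  shows "h (x \<ominus>\<^bsub>M\<^esub> y) = h x \<ominus>\<^bsub>N\<^esub> h y"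
  using assms by (simp add: a_minus_def mod_hom_add[OF assms(1)] mod_hom_minus
      abelian_group.a_inv_closed)

lemma mod_hom_comp:
  assumes "g \<in> mod_hom R M N" "h \<in> mod_hom R N P"
  shows "(\<lambda>x. h (g x)) \<in> mod_hom R M P"
  by (rule mod_homI) (simp_all add: mod_homD[OF assms(1)] mod_homD[OF assms(2)])

lemma mod_hom_kernel_submodule:
  assumes "module R M" "module R N" "h \<in> mod_hom R M N"
  shows "submodule {x \<in> carrier M. h x = \<zero>\<^bsub>N\<^esub>} R M"
proof -
  interpret M: module R M by fact
  interpret N: module R N by fact
  note ab = M.abelian_group_axioms N.abelian_group_axioms
  show ?thesis
    by (rule M.submoduleI)
      (use assms(3) in \<open>auto simp: mod_homD[OF assms(3)] mod_hom_zero[OF _ ab] mod_hom_minus[OF _ ab]\<close>)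
qed

lemma mod_hom_image_submodule:
  assumes "module R M" "module R N" "h \<in> mod_hom R M N"
  shows "submodule (h ` carrier M) R N"
proof -
  interpret M: module R M by fact
  interpret N: module R N by fact
  note ab = M.abelian_group_axioms N.abelian_group_axioms
  show ?thesis
  proof (rule N.submoduleI)
    show "\<zero>\<^bsub>N\<^esub> \<in> h ` carrier M"
      by (rule image_eqI[where x = "\<zero>\<^bsub>M\<^esub>"]) (simp_all add: mod_hom_zero[OF assms(3) ab])
  next
    fix a assume "a \<in> h ` carrier M"
    then show "\<ominus>\<^bsub>N\<^esub> a \<in> h ` carrier M"
      by (auto simp flip: mod_hom_minus[OF assms(3) ab])
  next
    fix a b assume "a \<in> h ` carrier M" "b \<in> h ` carrier M"
    then show "a \<oplus>\<^bsub>N\<^esub> b \<in> h ` carrier M"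
      by (auto simp flip: mod_hom_add[OF assms(3)])
  next
    fix a b assume "a \<in> carrier R" "b \<in> h ` carrier M"
    then show "a \<odot>\<^bsub>N\<^esub> b \<in> h ` carrier M"
      by (auto simp flip: mod_hom_smult[OF assms(3)])
  next
    show "h ` carrier M \<subseteq> carrier N"
      using mod_hom_closed[OF assms(3)] by (rule image_subsetI)
  qed
qed

context module
begin

lemma gen_submodule_submodule:
  assumes "S \<subseteq> carrier M"
  shows "submodule (gen_submodule R M S) R M"
proof -
  have "gen_submodule R M S \<subseteq> carrier M"
    using carrier_is_submodule assms by (auto simp: gen_submodule_def)
  then show ?thesis
  proof (rule submoduleI)
    show "\<zero>\<^bsub>M\<^esub> \<in> gen_submodule R M S"
      using subgroup.one_closed[OF submodule.axioms(1)] by (fastforce simp: gen_submodule_def)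
  qed (simp_all add: gen_submodule_def submoduleE(3,4,5))
qed

lemma gen_submodule_superset: "S \<subseteq> gen_submodule R M S"
  by (auto simp: gen_submodule_def)

lemma gen_submodule_least: "submodule N R M \<Longrightarrow> S \<subseteq> N \<Longrightarrow> gen_submodule R M S \<subseteq> N"
  by (auto simp: gen_submodule_def)

end

section \<open>Quotient modules and their universal property\<close>

locale submod = module R M + N: submodule N R M for N and R (structure) and M (structure)
begin

abbreviation "Q \<equiv> quot_module M N"
abbreviation "pr x \<equiv> N +>\<^bsub>M\<^esub> x"

lemma sub: "N \<subseteq> carrier M" using N.subset by simp

lemma carrier_Q: "carrier Q = pr ` carrier M"
  by (auto simp: quot_module_def A_RCOSETS_def')

lemma pr_closed [simp]: "x \<in> carrier M \<Longrightarrow> pr x \<in> carrier Q"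
  by (auto simp: carrier_Q)

lemma zero_Q: "\<zero>\<^bsub>Q\<^esub> = N"
  by (simp add: quot_module_def)

lemma mem_pr: "x \<in> carrier M \<Longrightarrow> x \<in> pr x"
  using group.rcos_self[OF M.a_group _ N.subgroup_axioms] by (simp add: a_r_coset_def)

lemma pr_eq_zero_iff:
  assumes "x \<in> carrier M"
  shows "pr x = \<zero>\<^bsub>Q\<^esub> \<longleftrightarrow> x \<in> N"
proof
  assume "pr x = \<zero>\<^bsub>Q\<^esub>"
  then show "x \<in> N" using mem_pr[OF assms] by (simp add: zero_Q)
next
  assume "x \<in> N"
  then show "pr x = \<zero>\<^bsub>Q\<^esub>" using subgroup.rcos_const[OF N.subgroup_axioms M.a_group] by (simp add: zero_Q a_r_coset_def)
qed

lemma normal: "N \<lhd> add_monoid M"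
  using comm_group.subgroup_imp_normal[OF a_comm_group N.subgroup_axioms] .

lemma pr_add:
  assumes "x \<in> carrier M" "y \<in> carrier M"
  shows "pr (x \<oplus>\<^bsub>M\<^esub> y) = pr x \<oplus>\<^bsub>Q\<^esub> pr y"
  using normal.rcos_sum[OF normal, of x y] assms
  by (simp add: quot_module_def set_add_def a_r_coset_def)

lemma Q_abelian_group: "abelian_group Q"
proof (rule abelian_groupI)
  have z: "pr \<zero>\<^bsub>M\<^esub> = \<zero>\<^bsub>Q\<^esub>"
    using pr_eq_zero_iff[OF M.zero_closed] N.one_closed by simp
  show "\<zero>\<^bsub>Q\<^esub> \<in> carrier Q"
    using pr_closed[OF M.zero_closed] unfolding z .
  fix x assume "x \<in> carrier Q"
  then obtain x' where x': "x' \<in> carrier M" "x = pr x'" by (auto simp: carrier_Q)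
  show "\<zero>\<^bsub>Q\<^esub> \<oplus>\<^bsub>Q\<^esub> x = x"
    using pr_add[OF M.zero_closed x'(1)] x' unfolding z by simp
  show "\<exists>y\<in>carrier Q. y \<oplus>\<^bsub>Q\<^esub> x = \<zero>\<^bsub>Q\<^esub>"
  proof
    show "pr (\<ominus>\<^bsub>M\<^esub> x') \<oplus>\<^bsub>Q\<^esub> x = \<zero>\<^bsub>Q\<^esub>"
      using pr_add[OF M.a_inv_closed[OF x'(1)] x'(1)] x' by (simp add: z M.l_neg)
  qed (use x' in simp)
next
  fix x y assume "x \<in> carrier Q" "y \<in> carrier Q"
  then obtain x' y' where xy: "x' \<in> carrier M" "x = pr x'" "y' \<in> carrier M" "y = pr y'"
    by (auto simp: carrier_Q)
  then show "x \<oplus>\<^bsub>Q\<^esub> y \<in> carrier Q" by (simp flip: pr_add)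
  show "x \<oplus>\<^bsub>Q\<^esub> y = y \<oplus>\<^bsub>Q\<^esub> x"
    using xy by (simp add: M.a_comm[of x' y'] flip: pr_add)
  fix z assume "z \<in> carrier Q"
  then obtain z' where "z' \<in> carrier M" "z = pr z'" by (auto simp: carrier_Q)
  then show "x \<oplus>\<^bsub>Q\<^esub> y \<oplus>\<^bsub>Q\<^esub> z = x \<oplus>\<^bsub>Q\<^esub> (y \<oplus>\<^bsub>Q\<^esub> z)"
    using xy by (simp add: M.a_assoc flip: pr_add)
qed

text \<open>\<open>quot_module\<close> defines the scalar multiple of a coset as a union over all
  representatives. They all give the same coset because \<open>N\<close> is stable under scalars,
  and a coset is nonempty, so the union is that single coset.\<close>

lemma pr_smult:
  assumes "r \<in> carrier R" "x \<in> carrier M"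
  shows "r \<odot>\<^bsub>Q\<^esub> pr x = pr (r \<odot>\<^bsub>M\<^esub> x)"
proof -
  have "pr (r \<odot>\<^bsub>M\<^esub> y) = pr (r \<odot>\<^bsub>M\<^esub> x)" if y: "y \<in> pr x" for y
  proof -
    from y obtain n where n: "n \<in> N" "y = n \<oplus>\<^bsub>M\<^esub> x" by (auto simp: a_r_coset_def')
    have "n \<in> carrier M" using n sub by auto
    then have "r \<odot>\<^bsub>M\<^esub> y = r \<odot>\<^bsub>M\<^esub> n \<oplus>\<^bsub>M\<^esub> r \<odot>\<^bsub>M\<^esub> x"
      using n assms by (simp add: smult_r_distr)
    moreover have "r \<odot>\<^bsub>M\<^esub> n \<in> N" using n assms by auto
    then have "pr (r \<odot>\<^bsub>M\<^esub> n) = N"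
      using subgroup.rcos_const[OF N.subgroup_axioms M.a_group] unfolding a_r_coset_def by blast
    moreover have "pr (r \<odot>\<^bsub>M\<^esub> n \<oplus>\<^bsub>M\<^esub> r \<odot>\<^bsub>M\<^esub> x) = pr (r \<odot>\<^bsub>M\<^esub> n) +>\<^bsub>M\<^esub> (r \<odot>\<^bsub>M\<^esub> x)"
      using assms \<open>n \<in> carrier M\<close> M.a_coset_add_assoc[OF sub] by simp
    ultimately show ?thesis by simp
  qed
  then have "(\<Union>y\<in>pr x. pr (r \<odot>\<^bsub>M\<^esub> y)) = (\<Union>y\<in>pr x. pr (r \<odot>\<^bsub>M\<^esub> x))"
    by (rule SUP_cong[OF refl])
  moreover have "pr x \<noteq> {}"
    using assms mem_pr by blast
  ultimately show ?thesis
    by (simp add: quot_module_def)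
qed

lemma Q_module: "module R Q"
proof (rule moduleI[OF is_cring Q_abelian_group])
  interpret Q: abelian_group Q by (rule Q_abelian_group)
  fix r x assume r: "r \<in> carrier R" and x: "x \<in> carrier Q"
  then obtain x' where x': "x' \<in> carrier M" "x = pr x'" by (auto simp: carrier_Q)
  then show "r \<odot>\<^bsub>Q\<^esub> x \<in> carrier Q" using r by (simp add: pr_smult)
  fix y assume "y \<in> carrier Q"
  then obtain y' where y': "y' \<in> carrier M" "y = pr y'" by (auto simp: carrier_Q)
  show "r \<odot>\<^bsub>Q\<^esub> (x \<oplus>\<^bsub>Q\<^esub> y) = r \<odot>\<^bsub>Q\<^esub> x \<oplus>\<^bsub>Q\<^esub> r \<odot>\<^bsub>Q\<^esub> y"
    using r x' y' by (simp add: pr_smult smult_r_distr flip: pr_add)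
next
  fix r s x assume rs: "r \<in> carrier R" "s \<in> carrier R" and "x \<in> carrier Q"
  then obtain x' where x': "x' \<in> carrier M" "x = pr x'" by (auto simp: carrier_Q)
  show "(r \<oplus> s) \<odot>\<^bsub>Q\<^esub> x = r \<odot>\<^bsub>Q\<^esub> x \<oplus>\<^bsub>Q\<^esub> s \<odot>\<^bsub>Q\<^esub> x"
    using rs x' by (simp add: pr_smult smult_l_distr flip: pr_add)
  show "(r \<otimes> s) \<odot>\<^bsub>Q\<^esub> x = r \<odot>\<^bsub>Q\<^esub> (s \<odot>\<^bsub>Q\<^esub> x)"
    using rs x' by (simp add: pr_smult smult_assoc1)
next
  fix x assume "x \<in> carrier Q"
  then obtain x' where x': "x' \<in> carrier M" "x = pr x'" by (auto simp: carrier_Q)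
  then show "\<one> \<odot>\<^bsub>Q\<^esub> x = x" by (simp add: pr_smult)
qed

lemma pr_mod_hom: "pr \<in> mod_hom R M Q"
  by (rule mod_homI) (simp_all add: pr_add pr_smult)

lemma quot_lift:
  assumes N': "module R N'" and h: "h \<in> mod_hom R M N'" and "\<And>x. x \<in> N \<Longrightarrow> h x = \<zero>\<^bsub>N'\<^esub>"
  obtains h' where "h' \<in> mod_hom R Q N'" "\<And>x. x \<in> carrier M \<Longrightarrow> h' (pr x) = h x"
proof
  interpret N': module R N' by fact
  \<comment> \<open>Any representative will do: two of them differ by an element of
    \<open>N\<close>, which \<open>h\<close> kills.\<close>
  define h' where "h' X = h (SOME x. x \<in> X)" for X
  show h': "h' (pr x) = h x" if x: "x \<in> carrier M" for x
  proof -
    have "(SOME y. y \<in> pr x) \<in> pr x"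
      using mem_pr[OF x] by (rule someI)
    then obtain n where n: "n \<in> N" "(SOME y. y \<in> pr x) = n \<oplus>\<^bsub>M\<^esub> x"
      by (auto simp: a_r_coset_def')
    moreover have "n \<in> carrier M" using n sub by auto
    ultimately show ?thesis
      using assms(3) x by (simp add: h'_def mod_homD[OF h])
  qed
  show "h' \<in> mod_hom R Q N'"
    by (rule mod_homI) (auto simp: carrier_Q h' pr_smult mod_homD[OF h] simp flip: pr_add)
qed

end

section \<open>Free modules and their universal property\<close>

lemma free_module_sel [simp]:
  "carrier (free_module R X) = {f \<in> X \<rightarrow>\<^sub>E carrier R. finite {x\<in>X. f x \<noteq> \<zero>\<^bsub>R\<^esub>}}"
  "\<zero>\<^bsub>free_module R X\<^esub> = (\<lambda>x\<in>X. \<zero>\<^bsub>R\<^esub>)"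
  "f \<oplus>\<^bsub>free_module R X\<^esub> g = (\<lambda>x\<in>X. f x \<oplus>\<^bsub>R\<^esub> g x)"
  "r \<odot>\<^bsub>free_module R X\<^esub> f = (\<lambda>x\<in>X. r \<otimes>\<^bsub>R\<^esub> f x)"
  by (simp_all add: free_module_def)

context cring
begin

lemma free_module_module: "module R (free_module R X)"
proof (rule moduleI[OF is_cring])
  show "abelian_group (free_module R X)"
  proof (rule abelian_groupI)
    fix f assume f: "f \<in> carrier (free_module R X)"
    show "\<exists>g\<in>carrier (free_module R X). g \<oplus>\<^bsub>free_module R X\<^esub> f = \<zero>\<^bsub>free_module R X\<^esub>"
    proof (rule bexI[where x = "\<lambda>x\<in>X. \<ominus> f x"])
      show "(\<lambda>x\<in>X. \<ominus> f x) \<in> carrier (free_module R X)"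
        using f by (auto intro: rev_finite_subset simp: PiE_iff)
    qed (use f in \<open>auto simp: l_neg PiE_iff\<close>)
  next
    fix f g assume f: "f \<in> carrier (free_module R X)" and g: "g \<in> carrier (free_module R X)"
    have "finite {x \<in> X. f x \<oplus> g x \<noteq> \<zero>}"
      by (rule finite_subset[of _ "{x \<in> X. f x \<noteq> \<zero>} \<union> {x \<in> X. g x \<noteq> \<zero>}"]) (use f g in auto)
    moreover have "{x \<in> X. (f \<oplus>\<^bsub>free_module R X\<^esub> g) x \<noteq> \<zero>} = {x \<in> X. f x \<oplus> g x \<noteq> \<zero>}"
      by auto
    ultimately show "f \<oplus>\<^bsub>free_module R X\<^esub> g \<in> carrier (free_module R X)"
      using f g by (auto simp: PiE_iff)
  qed (auto simp: PiE_iff a_ac extensional_def fun_eq_iff)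
next
  fix r f assume "r \<in> carrier R" "f \<in> carrier (free_module R X)"
  then show "r \<odot>\<^bsub>free_module R X\<^esub> f \<in> carrier (free_module R X)"
    by (auto intro: rev_finite_subset simp: PiE_iff)
qed (auto simp: l_distr r_distr m_assoc PiE_iff fun_eq_iff extensional_def)

lemma free_gen_closed [simp]: "free_gen R X y \<in> carrier (free_module R X)"
  by (auto simp: free_gen_def intro: finite_subset[of _ "{y}"])

text \<open>Induction on a finite set \<open>A\<close> containing the support: clearing the
  coefficient at one point of \<open>A\<close> changes the function by a multiple of a
  generator.\<close>

lemma free_module_spanned:
  assumes H: "submodule H R (free_module R X)" and gens: "\<And>x. x \<in> X \<Longrightarrow> free_gen R X x \<in> H"
  shows "H = carrier (free_module R X)"
proof -
  interpret M: module R "free_module R X" by (rule free_module_module)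
  interpret H: submodule H R "free_module R X" by fact
  have claim: "f \<in> H" if "finite A" "f \<in> carrier (free_module R X)" "{x\<in>X. f x \<noteq> \<zero>} \<subseteq> A" for f A
    using that
  proof (induction A arbitrary: f rule: finite_induct)
    case empty
    then have "f = \<zero>\<^bsub>free_module R X\<^esub>" by (auto simp: PiE_iff extensional_def fun_eq_iff)
    then show ?case using H.one_closed by (simp del: free_module_sel)
  next
    case (insert a A)
    show ?case
    proof (cases "a \<in> X")
      case True
      define g where "g = f(a := \<zero>)"
      have "g \<in> H"
        using insert True by (intro insert.IH) (auto simp: g_def PiE_iff extensional_def intro: rev_finite_subset)
      moreover have "f a \<odot>\<^bsub>free_module R X\<^esub> free_gen R X a \<in> H"
        using True insert by (intro H.smult_closed gens) (auto simp: PiE_iff)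
      ultimately have "g \<oplus>\<^bsub>free_module R X\<^esub> (f a \<odot>\<^bsub>free_module R X\<^esub> free_gen R X a) \<in> H"
        using H.m_closed by (simp del: free_module_sel)
      also have "g \<oplus>\<^bsub>free_module R X\<^esub> (f a \<odot>\<^bsub>free_module R X\<^esub> free_gen R X a) = f"
        using insert.prems True by (auto simp: g_def free_gen_def fun_eq_iff PiE_iff extensional_def)
      finally show ?thesis .
    next
      case False
      then show ?thesis using insert by (intro insert.IH) auto
    qed
  qed
  have "f \<in> H" if "f \<in> carrier (free_module R X)" for f
    by (rule claim[of "{x \<in> X. f x \<noteq> \<zero>}"]) (use that in auto)
  moreover have "H \<subseteq> carrier (free_module R X)"
    using H.subset by (simp del: free_module_sel)
  ultimately show ?thesis by (intro subset_antisym subsetI) (auto simp del: free_module_sel)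
qed

lemma free_module_lift:
  assumes N: "module R N" and \<phi>: "\<And>x. x \<in> X \<Longrightarrow> \<phi> x \<in> carrier N"
  obtains h where "h \<in> mod_hom R (free_module R X) N" "\<And>x. x \<in> X \<Longrightarrow> h (free_gen R X x) = \<phi> x"
proof
  interpret N: module R N by fact
  define supp where "supp f = {x\<in>X. f x \<noteq> \<zero>}" for f :: "_ \<Rightarrow> 'a"
  define h where "h f = (\<Oplus>\<^bsub>N\<^esub>x\<in>supp f. f x \<odot>\<^bsub>N\<^esub> \<phi> x)" for f
  \<comment> \<open>The support varies with \<open>f\<close>; summing over any finite set that
    contains it lets two functions be compared over one index set.\<close>
  have h: "h f = (\<Oplus>\<^bsub>N\<^esub>x\<in>A. f x \<odot>\<^bsub>N\<^esub> \<phi> x)"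
    if "finite A" "supp f \<subseteq> A" "A \<subseteq> X" "\<And>x. x \<in> X \<Longrightarrow> f x \<in> carrier R" for f A
    unfolding h_def
    by (rule N.add.finprod_mono_neutral_cong_left) (use that \<phi> in \<open>auto simp: supp_def\<close>)
  show "h \<in> mod_hom R (free_module R X) N"
  proof (rule mod_homI)
    fix f assume f: "f \<in> carrier (free_module R X)"
    then show "h f \<in> carrier N"
      unfolding h_def using \<phi> by (intro N.finsum_closed) (auto simp: supp_def PiE_iff)
    fix g assume g: "g \<in> carrier (free_module R X)"
    define A where "A = supp f \<union> supp g"
    have A: "finite A" "supp f \<subseteq> A" "supp g \<subseteq> A" "A \<subseteq> X" "supp (f \<oplus>\<^bsub>free_module R X\<^esub> g) \<subseteq> A"
      using f g by (auto simp: A_def supp_def PiE_iff)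
    have *: "f x \<in> carrier R" "g x \<in> carrier R" if "x \<in> X" for x using f g that by auto
    show "h (f \<oplus>\<^bsub>free_module R X\<^esub> g) = h f \<oplus>\<^bsub>N\<^esub> h g"
    proof -
      have "h (f \<oplus>\<^bsub>free_module R X\<^esub> g) = (\<Oplus>\<^bsub>N\<^esub>x\<in>A. f x \<odot>\<^bsub>N\<^esub> \<phi> x \<oplus>\<^bsub>N\<^esub> g x \<odot>\<^bsub>N\<^esub> \<phi> x)"
      proof (subst h[OF A(1,5,4)])
        show "(f \<oplus>\<^bsub>free_module R X\<^esub> g) x \<in> carrier R" if "x \<in> X" for x
          using * that by simp
      qed (rule N.finsum_cong', use A * \<phi> in \<open>auto simp: N.smult_l_distr subset_iff\<close>)
      also have "\<dots> = h f \<oplus>\<^bsub>N\<^esub> h g"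
        using A * \<phi> by (subst (1 2) h[OF A(1)]) (auto intro!: N.finsum_addf)
      finally show ?thesis .
    qed
  next
    fix r f assume r: "r \<in> carrier R" and f: "f \<in> carrier (free_module R X)"
    define A where "A = supp f"
    have A: "finite A" "supp f \<subseteq> A" "A \<subseteq> X" "supp (r \<odot>\<^bsub>free_module R X\<^esub> f) \<subseteq> A"
      using f r by (auto simp: A_def supp_def PiE_iff)
    have *: "f x \<in> carrier R" if "x \<in> X" for x using f that by auto
    have "h (r \<odot>\<^bsub>free_module R X\<^esub> f) = (\<Oplus>\<^bsub>N\<^esub>x\<in>A. r \<odot>\<^bsub>N\<^esub> (f x \<odot>\<^bsub>N\<^esub> \<phi> x))"
      using A * \<phi> r
      by (subst h[OF A(1,4)]) (auto intro!: N.finsum_cong' simp: N.smult_assoc1 subset_iff)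
    also have "\<dots> = r \<odot>\<^bsub>N\<^esub> h f"
      using A * \<phi> r by (subst h[OF A(1)]) (auto simp: N.finsum_smult_ldistr subset_iff)
    finally show "h (r \<odot>\<^bsub>free_module R X\<^esub> f) = r \<odot>\<^bsub>N\<^esub> h f" .
  qed
  show "h (free_gen R X x) = \<phi> x" if x: "x \<in> X" for x
    using x \<phi> by (subst h[of "{x}"]) (auto simp: free_gen_def supp_def)
qed

end

section \<open>Group rings and extension of scalars\<close>

lemma group_ring_sel [simp]:
  "carrier (group_ring G) = {f. Poly_Mapping.keys f \<subseteq> carrier G}"
  "f \<otimes>\<^bsub>group_ring G\<^esub> g = frag_extend (\<lambda>x. frag_extend (\<lambda>y. frag_of (x \<otimes>\<^bsub>G\<^esub> y)) g) f"
  "\<one>\<^bsub>group_ring G\<^esub> = frag_of \<one>\<^bsub>G\<^esub>"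
  "\<zero>\<^bsub>group_ring G\<^esub> = 0"
  "f \<oplus>\<^bsub>group_ring G\<^esub> g = f + g"
  by (simp_all add: group_ring_def)

lemma keys_frag_extend_subset:
  assumes "Poly_Mapping.keys c \<subseteq> S" "\<And>x. x \<in> S \<Longrightarrow> Poly_Mapping.keys (f x) \<subseteq> T"
  shows "Poly_Mapping.keys (frag_extend f c) \<subseteq> T"
  using keys_frag_extend[of f c] assms by blast

text \<open>Yields linearity of the group ring product in its second factor, which sits inside the
  function being extended.\<close>

lemma frag_extend_fun_diff: "frag_extend (\<lambda>x. f x - g x) c = frag_extend f c - frag_extend g c"
  by (induction c rule: frag_induction[OF subset_UNIV])
    (simp_all add: frag_extend_diff)

lemma group_ring_map_closed:
  assumes "h \<in> carrier G \<rightarrow> carrier H" "f \<in> carrier (group_ring G)"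
  shows "group_ring_map h f \<in> carrier (group_ring H)"
  using keys_frag_extend_subset[of f "carrier G" "frag_of \<circ> h" "carrier H"] assms
  by (auto simp: group_ring_map_def Pi_iff)

lemma group_ring_map_of [simp]: "group_ring_map h (frag_of x) = frag_of (h x)"
  by (simp add: group_ring_map_def)

context comm_group
begin

text \<open>The laws of multiplication are additive in each factor, so \<open>frag_induction\<close>
  reduces them to group elements, where they are the laws of the commutative group.\<close>

lemma group_ring_cring: "cring (group_ring G)"
proof (rule cringI)
  show "abelian_group (group_ring G)"
  proof (rule abelian_groupI)
    fix x assume "x \<in> carrier (group_ring G)"
    then show "\<exists>y\<in>carrier (group_ring G). y \<oplus>\<^bsub>group_ring G\<^esub> x = \<zero>\<^bsub>group_ring G\<^esub>"
      by (intro bexI[of _ "- x"]) auto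
  qed (auto simp: algebra_simps dest: subsetD[OF keys_add])
  let ?m = "\<lambda>f g. f \<otimes>\<^bsub>group_ring G\<^esub> g"
  show "comm_monoid (group_ring G)"
  proof (rule comm_monoidI)
    fix f g assume f: "f \<in> carrier (group_ring G)" and g: "g \<in> carrier (group_ring G)"
    show "?m f g \<in> carrier (group_ring G)"
      using f g by (simp, intro keys_frag_extend_subset) auto
    show "?m f g = ?m g f"
    proof -
      have "Poly_Mapping.keys f \<subseteq> carrier G" using f by simp
      then show ?thesis
      proof (induction f rule: frag_induction)
        case (one x)
        have "Poly_Mapping.keys g \<subseteq> carrier G" using g by simp
        then show ?case
          by (induction g rule: frag_induction) (use one in \<open>simp_all add: m_comm frag_extend_diff\<close>)
      qed (simp_all add: frag_extend_diff frag_extend_fun_diff frag_extend_eq_0)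
    qed
    fix h assume h: "h \<in> carrier (group_ring G)"
    show "?m (?m f g) h = ?m f (?m g h)"
    proof -
      have "Poly_Mapping.keys f \<subseteq> carrier G" using f by simp
      then show ?thesis
      proof (induction f rule: frag_induction)
        case (one x)
        have "Poly_Mapping.keys g \<subseteq> carrier G" using g by simp
        then show ?case
        proof (induction g rule: frag_induction)
          case y: (one y)
          have "Poly_Mapping.keys h \<subseteq> carrier G" using h by simp
          then show ?case
            by (induction h rule: frag_induction) (use one y in \<open>simp_all add: m_assoc frag_extend_diff\<close>)
        qed (simp_all add: frag_extend_diff frag_extend_fun_diff frag_extend_eq_0)
      qed (simp_all add: frag_extend_diff frag_extend_fun_diff frag_extend_eq_0)
    qed
  next
    fix f assume f: "f \<in> carrier (group_ring G)"
    then have "Poly_Mapping.keys f \<subseteq> carrier G" by simp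
    then show "?m \<one>\<^bsub>group_ring G\<^esub> f = f"
      by (induction f rule: frag_induction) (simp_all add: frag_extend_diff)
  qed simp
qed (simp add: frag_extend_add)

text \<open>Every ring element is an integral combination of group elements. The lemma is meant for
  preimages under \<open>\<iota>\<close>, whose compatibility with scalars is known for single
  square classes.\<close>

lemma module_group_ring_closed:
  assumes N: "module (group_ring G) N" and H: "subgroup H (add_monoid N)"
    and act: "\<And>g m. \<lbrakk>g \<in> carrier G; m \<in> H\<rbrakk> \<Longrightarrow> frag_of g \<odot>\<^bsub>N\<^esub> m \<in> H"
  shows "submodule H (group_ring G) N"
proof -
  interpret N: module "group_ring G" N by fact
  interpret H: subgroup H "add_monoid N" by fact
  have sub: "H \<subseteq> carrier N" using H.subset by simp
  have "r \<odot>\<^bsub>N\<^esub> m \<in> H" if r: "r \<in> carrier (group_ring G)" and m: "m \<in> H" for r m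
  proof -
    have mN: "m \<in> carrier N" using m sub by auto
    have "Poly_Mapping.keys r \<subseteq> carrier G" using r by simp
    then have "r \<in> carrier (group_ring G) \<and> r \<odot>\<^bsub>N\<^esub> m \<in> H"
    proof (induction r rule: frag_induction)
      case zero
      show ?case using N.smult_l_null[OF mN] H.one_closed by simp
    next
      case (one x)
      then show ?case using act m by simp
    next
      case (diff a b)
      \<comment> \<open>\<open>frag_induction\<close> produces pointwise differences, whereas the
        module laws speak of the negative of the ring record.\<close>
      have eq: "a - b = a \<oplus>\<^bsub>group_ring G\<^esub> (\<ominus>\<^bsub>group_ring G\<^esub> b)"
      proof -
        have "\<ominus>\<^bsub>group_ring G\<^esub> b = - b"
          using diff by (intro N.R.minus_equality) auto
        then show ?thesis by simp
      qed
      have "(a - b) \<odot>\<^bsub>N\<^esub> m = a \<odot>\<^bsub>N\<^esub> m \<oplus>\<^bsub>N\<^esub> (\<ominus>\<^bsub>N\<^esub> (b \<odot>\<^bsub>N\<^esub> m))"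
        unfolding eq using diff mN
        by (subst N.smult_l_distr) (simp_all add: N.smult_l_minus del: group_ring_sel(1))
      moreover have "a \<odot>\<^bsub>N\<^esub> m \<oplus>\<^bsub>N\<^esub> (\<ominus>\<^bsub>N\<^esub> (b \<odot>\<^bsub>N\<^esub> m)) \<in> H"
        using diff H.m_closed[of "a \<odot>\<^bsub>N\<^esub> m" "\<ominus>\<^bsub>N\<^esub> (b \<odot>\<^bsub>N\<^esub> m)"] H.m_inv_closed[of "b \<odot>\<^bsub>N\<^esub> m"]
        by (simp add: a_inv_def)
      moreover have "a - b \<in> carrier (group_ring G)"
        using diff keys_diff[of a b] by auto
      ultimately show ?case by simp
    qed
    then show ?thesis by simp
  qed
  then show ?thesis
    by (intro submodule.intro H submodule_axioms.intro)
qed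

end

section \<open>Extension of scalars\<close>

lemma abelian_group_transfer:
  assumes "comm_group T" "carrier N = carrier T" "ring.add N = monoid.mult T" "ring.zero N = \<one>\<^bsub>T\<^esub>"
  shows "abelian_group N"
proof -
  interpret comm_group T by fact
  show ?thesis
    by (rule abelian_groupI) (auto simp: assms m_ac intro: l_inv_ex)
qed

text \<open>The closure conditions place the relations inside the free abelian group
  \<open>P\<close>; the \<open>B\<close>-module structure of \<open>E\<close> is then obtained from
  the ring \<open>B\<close> and the quotient.\<close>

locale scalar_extension = B: cring B for A :: "('s, 'm) ring_scheme" and \<phi> :: "'s \<Rightarrow> 'r"
  and B :: "('r, 'k) ring_scheme" and M :: "('s, 'a, 'n) module_scheme" +
  assumes hom_closed: "a \<in> carrier A \<Longrightarrow> \<phi> a \<in> carrier B"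
    and add_closed: "\<lbrakk>m \<in> carrier M; m' \<in> carrier M\<rbrakk> \<Longrightarrow> m \<oplus>\<^bsub>M\<^esub> m' \<in> carrier M"
    and smult_closed: "\<lbrakk>a \<in> carrier A; m \<in> carrier M\<rbrakk> \<Longrightarrow> a \<odot>\<^bsub>M\<^esub> m \<in> carrier M"
begin

abbreviation "P \<equiv> free_Abelian_group (carrier B \<times> carrier M)"
abbreviation "K \<equiv> tensor_rels A \<phi> B M"
abbreviation "E \<equiv> ext_scalars A \<phi> B M"
abbreviation "tens \<equiv> tensor A \<phi> B M"
abbreviation "cl f \<equiv> K #>\<^bsub>P\<^esub> f"
abbreviation "act b \<equiv> frag_extend (\<lambda>(c, m). frag_of (b \<otimes>\<^bsub>B\<^esub> c, m))"

definition "K_gens = {frag_of (b \<oplus>\<^bsub>B\<^esub> b', m) - frag_of (b, m) - frag_of (b', m) | b b' m.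
        b \<in> carrier B \<and> b' \<in> carrier B \<and> m \<in> carrier M}
   \<union> {frag_of (b, m \<oplus>\<^bsub>M\<^esub> m') - frag_of (b, m) - frag_of (b, m') | b m m'.
        b \<in> carrier B \<and> m \<in> carrier M \<and> m' \<in> carrier M}
   \<union> {frag_of (b \<otimes>\<^bsub>B\<^esub> \<phi> a, m) - frag_of (b, a \<odot>\<^bsub>M\<^esub> m) | a b m.
        a \<in> carrier A \<and> b \<in> carrier B \<and> m \<in> carrier M}"

lemma K_gens_cases [consumes 1, case_names left right balance]:
  assumes "f \<in> K_gens"
  obtains b b' m where "f = frag_of (b \<oplus>\<^bsub>B\<^esub> b', m) - frag_of (b, m) - frag_of (b', m)"
      "b \<in> carrier B" "b' \<in> carrier B" "m \<in> carrier M"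
    | b m m' where "f = frag_of (b, m \<oplus>\<^bsub>M\<^esub> m') - frag_of (b, m) - frag_of (b, m')"
      "b \<in> carrier B" "m \<in> carrier M" "m' \<in> carrier M"
    | a b m where "f = frag_of (b \<otimes>\<^bsub>B\<^esub> \<phi> a, m) - frag_of (b, a \<odot>\<^bsub>M\<^esub> m)"
      "a \<in> carrier A" "b \<in> carrier B" "m \<in> carrier M"
  using assms unfolding K_gens_def by blast

lemma K_eq: "K = generate P K_gens"
  by (simp only: tensor_rels_def K_gens_def)

lemma K_gens_closed: "K_gens \<subseteq> carrier P"
proof
  fix f assume "f \<in> K_gens"
  then show "f \<in> carrier P"
    by (cases rule: K_gens_cases)
      (auto dest!: subsetD[OF keys_diff] simp: hom_closed add_closed smult_closed)
qed

lemma K_subgroup: "subgroup K P"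
  unfolding K_eq using K_gens_closed by (intro group.generate_is_subgroup) auto

lemma K_sub: "f \<in> K \<Longrightarrow> Poly_Mapping.keys f \<subseteq> carrier B \<times> carrier M"
  using subgroup.mem_carrier[OF K_subgroup, of f] by simp

lemma K_zero: "0 \<in> K" using subgroup.one_closed[OF K_subgroup] by simp
lemma K_add: "\<lbrakk>f \<in> K; g \<in> K\<rbrakk> \<Longrightarrow> f + g \<in> K" using subgroup.m_closed[OF K_subgroup] by simp
lemma K_minus: "f \<in> K \<Longrightarrow> - f \<in> K" using subgroup.m_inv_closed[OF K_subgroup] K_sub by fastforce
lemma K_diff: "\<lbrakk>f \<in> K; g \<in> K\<rbrakk> \<Longrightarrow> f - g \<in> K" using K_add[of f "- g"] K_minus by simp
lemma K_gen: "f \<in> K_gens \<Longrightarrow> f \<in> K" unfolding K_eq by (rule generate.incl)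

lemma K_left:
  assumes "b \<in> carrier B" "b' \<in> carrier B" "m \<in> carrier M"
  shows "frag_of (b \<oplus>\<^bsub>B\<^esub> b', m) - frag_of (b, m) - frag_of (b', m) \<in> K"
  by (rule K_gen) (unfold K_gens_def, use assms in blast)

lemma K_right:
  assumes "b \<in> carrier B" "m \<in> carrier M" "m' \<in> carrier M"
  shows "frag_of (b, m \<oplus>\<^bsub>M\<^esub> m') - frag_of (b, m) - frag_of (b, m') \<in> K"
  by (rule K_gen) (unfold K_gens_def, use assms in blast)

lemma K_balance:
  assumes "a \<in> carrier A" "b \<in> carrier B" "m \<in> carrier M"
  shows "frag_of (b \<otimes>\<^bsub>B\<^esub> \<phi> a, m) - frag_of (b, a \<odot>\<^bsub>M\<^esub> m) \<in> K"
  by (rule K_gen) (unfold K_gens_def, use assms in blast)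

lemma act_closed:
  assumes "b \<in> carrier B" "Poly_Mapping.keys f \<subseteq> carrier B \<times> carrier M"
  shows "Poly_Mapping.keys (act b f) \<subseteq> carrier B \<times> carrier M"
  using assms by (intro keys_frag_extend_subset[OF assms(2)]) auto

text \<open>Multiplying first factors by \<open>b\<close> turns each generating relation into one of
  the same kind, by distributivity and associativity in \<open>B\<close>. Hence \<open>B\<close>
  acts on the quotient.\<close>

lemma act_K:
  assumes b: "b \<in> carrier B" and f: "f \<in> K"
  shows "act b f \<in> K"
proof -
  have gen: "act b f \<in> K" if "f \<in> K_gens" for f
    using that
  proof (cases rule: K_gens_cases)
    case (left c c' m)
    then show ?thesis using b K_left[of "b \<otimes>\<^bsub>B\<^esub> c" "b \<otimes>\<^bsub>B\<^esub> c'" m]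
      by (simp add: frag_extend_diff B.r_distr)
  next
    case (right c m m')
    then show ?thesis using b K_right[of "b \<otimes>\<^bsub>B\<^esub> c" m m'] by (simp add: frag_extend_diff)
  next
    case (balance a c m)
    then show ?thesis using b K_balance[of a "b \<otimes>\<^bsub>B\<^esub> c" m]
      by (simp add: frag_extend_diff hom_closed B.m_assoc)
  qed
  from f have "f \<in> generate P K_gens" by (simp only: K_eq)
  then show ?thesis
  proof (induction rule: generate.induct)
    case one then show ?case using K_zero by simp
  next
    case (incl h) then show ?case by (rule gen)
  next
    case (inv h)
    then have "inv\<^bsub>P\<^esub> h = - h" using K_gens_closed by auto
    then show ?case using K_minus[OF gen[OF inv]] by (simp only: frag_extend_minus)
  next
    case (eng f g) then show ?case by (simp add: frag_extend_add K_add)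
  qed
qed

lemma cl_eqI:
  assumes "f - g \<in> K"
  shows "cl f = cl g"
proof -
  have *: "cl f \<subseteq> cl g" if "f - g \<in> K" for f g
  proof
    fix x assume "x \<in> cl f"
    then obtain k where "k \<in> K" "x = k + f" by (auto simp: r_coset_def)
    then have "k + (f - g) \<in> K" "x = (k + (f - g)) + g" using that K_add by auto
    then show "x \<in> cl g" unfolding r_coset_def by force
  qed
  show ?thesis using *[OF assms] *[of g f] K_minus[OF assms] by auto
qed

lemma E_carrier: "carrier E = cl ` {f. Poly_Mapping.keys f \<subseteq> carrier B \<times> carrier M}"
  by (auto simp: ext_scalars_def tensor_group_def FactGroup_def RCOSETS_def)

lemma cl_closed: "Poly_Mapping.keys f \<subseteq> carrier B \<times> carrier M \<Longrightarrow> cl f \<in> carrier E"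
  unfolding E_carrier by (rule imageI) simp

lemma P_comm: "comm_group P" by (rule abelian_free_Abelian_group)

lemma E_abelian_group: "abelian_group E"
proof (rule abelian_group_transfer)
  show "comm_group (tensor_group A \<phi> B M)"
    unfolding tensor_group_def by (rule comm_group.abelian_FactGroup[OF P_comm K_subgroup])
qed (simp_all add: ext_scalars_def)

lemma cl_add:
  assumes "Poly_Mapping.keys f \<subseteq> carrier B \<times> carrier M" "Poly_Mapping.keys g \<subseteq> carrier B \<times> carrier M"
  shows "cl f \<oplus>\<^bsub>E\<^esub> cl g = cl (f + g)"
  using normal.rcos_sum[OF comm_group.subgroup_imp_normal[OF P_comm K_subgroup], of f g] assms
  by (simp add: ext_scalars_def tensor_group_def FactGroup_def)

lemma cl_smult:
  assumes "b \<in> carrier B" "Poly_Mapping.keys f \<subseteq> carrier B \<times> carrier M"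
  shows "b \<odot>\<^bsub>E\<^esub> cl f = cl (act b f)"
proof -
  have "cl (act b g) = cl (act b f)" if g: "g \<in> cl f" for g
  proof -
    from g obtain k where k: "k \<in> K" "g = k + f" by (auto simp: r_coset_def)
    then show ?thesis
      using act_K[OF assms(1) k(1)] by (intro cl_eqI) (simp add: frag_extend_add)
  qed
  then have "(\<Union>g\<in>cl f. cl (act b g)) = (\<Union>g\<in>cl f. cl (act b f))"
    by (rule SUP_cong[OF refl])
  also have "0 + f \<in> cl f" unfolding r_coset_def using K_zero by force
  then have "(\<Union>g\<in>cl f. cl (act b f)) = cl (act b f)"
    by (intro UN_constant_eq) auto
  finally show ?thesis
    by (simp only: ext_scalars_def module.simps)
qed

lemma act_one:
  assumes "Poly_Mapping.keys f \<subseteq> carrier B \<times> carrier M"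
  shows "act \<one>\<^bsub>B\<^esub> f = f"
  using assms by (induction f rule: frag_induction) (auto simp: frag_extend_diff)

lemma act_mult:
  assumes "Poly_Mapping.keys f \<subseteq> carrier B \<times> carrier M" "b \<in> carrier B" "c \<in> carrier B"
  shows "act (b \<otimes>\<^bsub>B\<^esub> c) f = act b (act c f)"
  using assms(1) by (induction f rule: frag_induction) (use assms in \<open>auto simp: frag_extend_diff B.m_assoc\<close>)

text \<open>Unlike \<open>act_one\<close> and \<open>act_mult\<close>, additivity in the scalar
  holds only modulo \<open>K\<close>: it is the left additivity relation.\<close>

lemma act_add:
  assumes "Poly_Mapping.keys f \<subseteq> carrier B \<times> carrier M" "b \<in> carrier B" "c \<in> carrier B"
  shows "act (b \<oplus>\<^bsub>B\<^esub> c) f - (act b f + act c f) \<in> K"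
  using assms(1)
proof (induction f rule: frag_induction)
  case zero show ?case using K_zero by simp
next
  case (one x)
  obtain d m where x: "x = (d, m)" by (cases x)
  then show ?case using one assms K_left[of "b \<otimes>\<^bsub>B\<^esub> d" "c \<otimes>\<^bsub>B\<^esub> d" m]
    by (simp add: B.l_distr diff_diff_eq)
next
  case (diff f g)
  then show ?case using K_diff[OF diff] by (simp add: frag_extend_diff algebra_simps)
qed

lemma E_module: "module B E"
proof (rule moduleI[OF B.is_cring E_abelian_group])
  fix b x assume b: "b \<in> carrier B" and x: "x \<in> carrier E"
  then obtain f where f: "Poly_Mapping.keys f \<subseteq> carrier B \<times> carrier M" "x = cl f"
    by (auto simp: E_carrier)
  then show "b \<odot>\<^bsub>E\<^esub> x \<in> carrier E" using b by (simp add: cl_smult cl_closed act_closed)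
  fix y assume "y \<in> carrier E"
  then obtain g where g: "Poly_Mapping.keys g \<subseteq> carrier B \<times> carrier M" "y = cl g"
    by (auto simp: E_carrier)
  have fg: "Poly_Mapping.keys (f + g) \<subseteq> carrier B \<times> carrier M"
    using f g by (intro subset_trans[OF keys_add] Un_least)
  show "b \<odot>\<^bsub>E\<^esub> (x \<oplus>\<^bsub>E\<^esub> y) = b \<odot>\<^bsub>E\<^esub> x \<oplus>\<^bsub>E\<^esub> b \<odot>\<^bsub>E\<^esub> y"
    using f g fg b by (simp add: cl_smult cl_add act_closed frag_extend_add)
next
  fix b c x assume bc: "b \<in> carrier B" "c \<in> carrier B" and x: "x \<in> carrier E"
  then obtain f where f: "Poly_Mapping.keys f \<subseteq> carrier B \<times> carrier M" "x = cl f"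
    by (auto simp: E_carrier)
  show "(b \<oplus>\<^bsub>B\<^esub> c) \<odot>\<^bsub>E\<^esub> x = b \<odot>\<^bsub>E\<^esub> x \<oplus>\<^bsub>E\<^esub> c \<odot>\<^bsub>E\<^esub> x"
    using f bc cl_eqI[OF act_add[OF f(1) bc]] by (simp add: cl_smult cl_add act_closed)
  show "(b \<otimes>\<^bsub>B\<^esub> c) \<odot>\<^bsub>E\<^esub> x = b \<odot>\<^bsub>E\<^esub> (c \<odot>\<^bsub>E\<^esub> x)"
    using f bc act_mult[OF f(1) bc] by (simp add: cl_smult act_closed)
next
  fix x assume x: "x \<in> carrier E"
  then obtain f where f: "Poly_Mapping.keys f \<subseteq> carrier B \<times> carrier M" "x = cl f"
    by (auto simp: E_carrier)
  then show "\<one>\<^bsub>B\<^esub> \<odot>\<^bsub>E\<^esub> x = x" by (simp add: cl_smult act_one)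
qed

lemma tens_closed: "\<lbrakk>b \<in> carrier B; m \<in> carrier M\<rbrakk> \<Longrightarrow> tens b m \<in> carrier E"
  unfolding tensor_def by (rule cl_closed) simp

lemma tens_add_right:
  assumes "b \<in> carrier B" "m \<in> carrier M" "m' \<in> carrier M"
  shows "tens b (m \<oplus>\<^bsub>M\<^esub> m') = tens b m \<oplus>\<^bsub>E\<^esub> tens b m'"
proof -
  have "frag_of (b, m \<oplus>\<^bsub>M\<^esub> m') - (frag_of (b, m) + frag_of (b, m')) \<in> K"
    using K_right[OF assms] by (simp add: diff_diff_eq)
  from cl_eqI[OF this] show ?thesis
    using assms unfolding tensor_def by (simp add: cl_add)
qed

lemma tens_balanced:
  assumes "b \<in> carrier B" "a \<in> carrier A" "m \<in> carrier M"
  shows "tens (b \<otimes>\<^bsub>B\<^esub> \<phi> a) m = tens b (a \<odot>\<^bsub>M\<^esub> m)"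
  unfolding tensor_def using K_balance[of a b m] assms by (intro cl_eqI)

lemma tens_smult:
  assumes "b \<in> carrier B" "c \<in> carrier B" "m \<in> carrier M"
  shows "b \<odot>\<^bsub>E\<^esub> tens c m = tens (b \<otimes>\<^bsub>B\<^esub> c) m"
  using assms unfolding tensor_def by (simp add: cl_smult)

text \<open>The scalar \<open>b\<close> carries \<open>1 \<otimes> m\<close> to
  \<open>b \<otimes> m\<close>, and the classes of such pairs generate the group.\<close>

lemma E_spanned:
  assumes H: "submodule H B E" and tens: "\<And>m. m \<in> carrier M \<Longrightarrow> tens \<one>\<^bsub>B\<^esub> m \<in> H"
  shows "H = carrier E"
proof
  interpret E: module B E by (rule E_module)
  show "H \<subseteq> carrier E" using E.submoduleE(1)[OF H] .
  show "carrier E \<subseteq> H"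
  proof
    fix x assume "x \<in> carrier E"
    then obtain f where f: "Poly_Mapping.keys f \<subseteq> carrier B \<times> carrier M" "x = cl f"
      by (auto simp: E_carrier)
    from f(1) have "Poly_Mapping.keys f \<subseteq> carrier B \<times> carrier M \<and> cl f \<in> H"
    proof (induction f rule: frag_induction)
      case zero
      \<comment> \<open>The class of 0 is idempotent, hence neutral.\<close>
      have "cl 0 \<oplus>\<^bsub>E\<^esub> cl 0 = cl 0" by (simp add: cl_add)
      then have "cl 0 = \<zero>\<^bsub>E\<^esub>" using cl_closed[of 0] E.add.l_cancel_one[of "cl 0" "cl 0"] by simp
      then show ?case using subgroup.one_closed[OF submodule.axioms(1)[OF H]] by simp
    next
      case (one x)
      then obtain b m where x: "x = (b, m)" "b \<in> carrier B" "m \<in> carrier M" by auto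
      then have "b \<odot>\<^bsub>E\<^esub> tens \<one>\<^bsub>B\<^esub> m \<in> H" using H tens E.submoduleE(4) by blast
      then show ?case using x tens_smult[of b "\<one>\<^bsub>B\<^esub>" m] by (simp add: tensor_def)
    next
      case (diff f g)
      then have k: "Poly_Mapping.keys (f - g) \<subseteq> carrier B \<times> carrier M"
        by (intro subset_trans[OF keys_diff] Un_least) simp_all
      have "cl (f - g) \<oplus>\<^bsub>E\<^esub> cl g = cl f" using k diff by (simp add: cl_add)
      then have "cl f \<ominus>\<^bsub>E\<^esub> cl g = cl (f - g) \<oplus>\<^bsub>E\<^esub> cl g \<ominus>\<^bsub>E\<^esub> cl g" by simp
      also have "\<dots> = cl (f - g)"
        using cl_closed[OF k] cl_closed[of g] diff by (simp add: E.minus_eq E.a_assoc E.r_neg)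
      finally have "cl (f - g) = cl f \<ominus>\<^bsub>E\<^esub> cl g" ..
      also have "\<dots> \<in> H" using diff E.submoduleE(3,5)[OF H] by (simp add: E.minus_eq)
      finally show ?case using k by simp
    qed
    then show "x \<in> H" using f by simp
  qed
qed

end

section \<open>Symbols over a field\<close>

context abelian_group
begin

text \<open>Together with the next lemmas these rules bring every expression to the form (sum of
  positive terms) minus (sum of negative terms) and move the latter across equations, so that
  \<open>group_simps\<close> only has to compare two sums up to order.\<close>

lemma minus_simps:
  assumes "x \<in> carrier G" "y \<in> carrier G" "z \<in> carrier G"
  shows "x \<ominus> y \<oplus> z = (x \<oplus> z) \<ominus> y"
    "x \<oplus> (y \<ominus> z) = (x \<oplus> y) \<ominus> z"
    "x \<ominus> y \<ominus> z = x \<ominus> (y \<oplus> z)"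
    "x \<ominus> (y \<ominus> z) = (x \<oplus> z) \<ominus> y"
  using assms by (simp_all add: minus_eq minus_add a_ac)

lemma minus_simps':
  assumes "x \<in> carrier G" "y \<in> carrier G"
  shows "\<ominus> (x \<ominus> y) = y \<ominus> x"
    "x \<oplus> (\<ominus> y) = x \<ominus> y"
    "(\<ominus> x) \<oplus> y = y \<ominus> x"
    "x \<ominus> (\<ominus> y) = x \<oplus> y"
    "(\<ominus> x) \<ominus> y = \<ominus> (x \<oplus> y)"
  using assms by (simp_all add: minus_eq minus_add a_ac)

lemma diff_eq_iff:
  assumes "x \<in> carrier G" "y \<in> carrier G" "z \<in> carrier G"
  shows "x \<ominus> y = z \<longleftrightarrow> x = z \<oplus> y" "z = x \<ominus> y \<longleftrightarrow> z \<oplus> y = x"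
  using assms by (auto simp: minus_eq a_assoc l_neg r_neg)

lemma neg_eq_iff:
  assumes "x \<in> carrier G" "y \<in> carrier G"
  shows "\<ominus> x = y \<longleftrightarrow> \<zero> = y \<oplus> x" "y = \<ominus> x \<longleftrightarrow> y \<oplus> x = \<zero>"
  using assms minus_equality[of y x] by (auto simp: l_neg)

lemmas group_simps = minus_simps minus_simps' diff_eq_iff neg_eq_iff a_ac

end

section \<open>Square classes and the maps induced on them\<close>

context comm_group
begin

lemma squares_subgroup: "subgroup (squares G) G"
proof (rule subgroupI)
  show "squares G \<noteq> {}" by (auto simp: squares_def)
next
  fix a assume "a \<in> squares G"
  then obtain x where "x \<in> carrier G" "a = x \<otimes> x" by (auto simp: squares_def)
  then show "inv a \<in> squares G" by (auto simp: squares_def inv_mult_group)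
next
  fix a b assume "a \<in> squares G" "b \<in> squares G"
  then obtain x y where "x \<in> carrier G" "a = x \<otimes> x" "y \<in> carrier G" "b = y \<otimes> y"
    by (auto simp: squares_def)
  then have "a \<otimes> b = (x \<otimes> y) \<otimes> (x \<otimes> y)" "x \<otimes> y \<in> carrier G" by (simp_all add: m_ac)
  then show "a \<otimes> b \<in> squares G" unfolding squares_def by blast
qed (auto simp: squares_def)

lemma sq_group_comm_group: "comm_group (sq_group G)"
  unfolding sq_group_def by (rule abelian_FactGroup[OF squares_subgroup])

lemma sq_group_carrier: "carrier (sq_group G) = sq_class G ` carrier G"
  by (auto simp: sq_group_def FactGroup_def RCOSETS_def sq_class_def)

lemma sq_class_mult:
  "\<lbrakk>x \<in> carrier G; y \<in> carrier G\<rbrakk> \<Longrightarrow> sq_class G x \<otimes>\<^bsub>sq_group G\<^esub> sq_class G y = sq_class G (x \<otimes> y)"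
  using normal.rcos_sum[OF subgroup_imp_normal[OF squares_subgroup]]
  by (simp add: sq_group_def sq_class_def FactGroup_def)

lemma sq_class_square:
  assumes "x \<in> carrier G"
  shows "sq_class G (x \<otimes> x) = \<one>\<^bsub>sq_group G\<^esub>"
  using assms subgroup.rcos_const[OF squares_subgroup is_group, of "x \<otimes> x"]
  by (simp add: sq_group_def sq_class_def FactGroup_def squares_def)

end

text \<open>\<open>sq_map\<close> picks the only element of an image set. The set is a singleton
  because \<open>h\<close> sends squares to squares, so all representatives of a class yield the
  same class.\<close>

lemma sq_map_class:
  assumes G: "comm_group G" and H: "comm_group H" and h: "h \<in> hom G H" and x: "x \<in> carrier G"
  shows "sq_map H h (sq_class G x) = sq_class H (h x)"
proof -
  interpret G: comm_group G by fact
  interpret H: comm_group H by fact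
  interpret h: group_hom G H h by unfold_locales (rule h)
  have *: "sq_class H (h y) = sq_class H (h x)" if "y \<in> sq_class G x" for y
  proof -
    from that obtain t where t: "t \<in> carrier G" "y = t \<otimes>\<^bsub>G\<^esub> t \<otimes>\<^bsub>G\<^esub> x"
      by (auto simp: sq_class_def r_coset_def squares_def)
    then have "sq_class H (h y) = \<one>\<^bsub>sq_group H\<^esub> \<otimes>\<^bsub>sq_group H\<^esub> sq_class H (h x)"
      using x by (simp add: H.sq_class_square flip: H.sq_class_mult)
    interpret Q: comm_group "sq_group H" by (rule H.sq_group_comm_group)
    show ?thesis
      using Q.l_one[of "sq_class H (h x)"] x \<open>sq_class H (h y) = _\<close> by (simp add: H.sq_group_carrier)
  qed
  have "x \<in> sq_class G x"
    unfolding sq_class_def by (rule G.rcos_self[OF x G.squares_subgroup])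
  moreover have "(\<lambda>x. sq_class H (h x)) ` sq_class G x = (\<lambda>_. sq_class H (h x)) ` sq_class G x"
    by (rule image_cong[OF refl *])
  ultimately have "(\<lambda>x. sq_class H (h x)) ` sq_class G x = {sq_class H (h x)}"
    by (simp add: image_constant)
  then show ?thesis by (simp add: sq_map_def)
qed

lemma sq_map_closed:
  assumes G: "comm_group G" and H: "comm_group H" and h: "h \<in> hom G H"
  shows "sq_map H h \<in> carrier (sq_group G) \<rightarrow> carrier (sq_group H)"
  using sq_map_class[OF assms] h
  by (auto simp: comm_group.sq_group_carrier[OF G] comm_group.sq_group_carrier[OF H] hom_def)

text \<open>Division gets its own symbol so that \<open>frac_simps\<close> can collect a product
  into one fraction and cross-multiply equations. It is used both in the valued field and in its
  residue field.\<close>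

definition fdiv :: "('a, 'm) monoid_scheme \<Rightarrow> 'a \<Rightarrow> 'a \<Rightarrow> 'a" (infixl \<open>\<oslash>\<index>\<close> 70)
  where "a \<oslash>\<^bsub>G\<^esub> b = a \<otimes>\<^bsub>G\<^esub> inv\<^bsub>G\<^esub> b"

context cring
begin

lemma Units_inv_mult:
  assumes "a \<in> Units R" "b \<in> Units R"
  shows "inv (a \<otimes> b) = inv a \<otimes> inv b"
proof (rule comm_inv_char)
  have "(a \<otimes> b) \<otimes> (inv a \<otimes> inv b) = (a \<otimes> inv a) \<otimes> (b \<otimes> inv b)"
    using assms by (simp only: m_ac Units_closed Units_inv_closed m_closed)
  then show "(a \<otimes> b) \<otimes> (inv a \<otimes> inv b) = \<one>" using assms by simp
qed (use assms in \<open>auto simp: Units_closed\<close>)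

lemma fdiv_closed [simp]: "\<lbrakk>a \<in> carrier R; b \<in> Units R\<rbrakk> \<Longrightarrow> a \<oslash> b \<in> carrier R"
  by (simp add: fdiv_def)

lemma fdiv_Units [simp]: "\<lbrakk>a \<in> Units R; b \<in> Units R\<rbrakk> \<Longrightarrow> a \<oslash> b \<in> Units R"
  by (simp add: fdiv_def)

lemma fdiv_mult_cancel:
  assumes "a \<in> carrier R" "b \<in> Units R"
  shows "(a \<oslash> b) \<otimes> b = a" "(a \<otimes> b) \<oslash> b = a"
  using assms by (simp_all add: fdiv_def m_assoc Units_closed)

lemma fdiv_eq_iff:
  assumes "a \<in> carrier R" "b \<in> Units R" "c \<in> carrier R"
  shows "a \<oslash> b = c \<longleftrightarrow> a = c \<otimes> b" "c = a \<oslash> b \<longleftrightarrow> c \<otimes> b = a"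
  using assms fdiv_mult_cancel by auto

lemma fdiv_simps:
  assumes "a \<in> carrier R" "b \<in> Units R" "c \<in> carrier R"
  shows "(a \<oslash> b) \<otimes> c = (a \<otimes> c) \<oslash> b" "c \<otimes> (a \<oslash> b) = (c \<otimes> a) \<oslash> b"
    "(a \<oslash> b) \<oplus> c = (a \<oplus> c \<otimes> b) \<oslash> b" "c \<oplus> (a \<oslash> b) = (c \<otimes> b \<oplus> a) \<oslash> b"
    "c \<ominus> (a \<oslash> b) = (c \<otimes> b \<ominus> a) \<oslash> b" "(a \<oslash> b) \<ominus> c = (a \<ominus> c \<otimes> b) \<oslash> b"
proof -
  show "(a \<oslash> b) \<otimes> c = (a \<otimes> c) \<oslash> b" "c \<otimes> (a \<oslash> b) = (c \<otimes> a) \<oslash> b"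
    using assms by (simp_all add: fdiv_def m_ac Units_closed)
  have c: "c = c \<otimes> b \<otimes> inv b" using assms by (simp add: m_assoc Units_closed)
  show "(a \<oslash> b) \<oplus> c = (a \<oplus> c \<otimes> b) \<oslash> b" "c \<oplus> (a \<oslash> b) = (c \<otimes> b \<oplus> a) \<oslash> b"
    "c \<ominus> (a \<oslash> b) = (c \<otimes> b \<ominus> a) \<oslash> b" "(a \<oslash> b) \<ominus> c = (a \<ominus> c \<otimes> b) \<oslash> b"
    using assms by (subst c, simp add: fdiv_def l_distr minus_eq l_minus Units_closed)+
qed

lemma fdiv_fdiv:
  assumes "a \<in> carrier R" "b \<in> Units R" "c \<in> Units R"
  shows "(a \<oslash> b) \<oslash> c = a \<oslash> (b \<otimes> c)"
  using assms by (simp add: fdiv_def m_ac Units_closed Units_inv_mult)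

lemma fdiv_fdiv_right:
  assumes "a \<in> carrier R" "b \<in> Units R" "c \<in> Units R"
  shows "a \<oslash> (b \<oslash> c) = (a \<otimes> c) \<oslash> b"
  using assms by (simp add: fdiv_def m_ac Units_closed Units_inv_mult)

lemma fdiv_add:
  assumes "a \<in> carrier R" "b \<in> carrier R" "c \<in> Units R"
  shows "a \<oslash> c \<oplus> b \<oslash> c = (a \<oplus> b) \<oslash> c"
  using assms by (simp add: fdiv_def l_distr)

lemma fdiv_self [simp]: "a \<in> Units R \<Longrightarrow> a \<oslash> a = \<one>"
  by (simp add: fdiv_def)

lemma inv_fdiv: "a \<in> Units R \<Longrightarrow> inv a = \<one> \<oslash> a"
  by (simp add: fdiv_def)

lemma inv_fdiv_fdiv: "\<lbrakk>a \<in> Units R; b \<in> Units R\<rbrakk> \<Longrightarrow> inv (a \<oslash> b) = b \<oslash> a"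
  by (simp add: fdiv_def Units_inv_mult m_comm Units_closed)

lemmas frac_simps = fdiv_simps fdiv_fdiv fdiv_fdiv_right inv_fdiv_fdiv fdiv_eq_iff Units_closed m_ac

lemma neg_Units [simp]: "a \<in> Units R \<Longrightarrow> \<ominus> a \<in> Units R"
proof -
  assume a: "a \<in> Units R"
  have "(\<ominus> a) \<otimes> (\<ominus> (inv a)) = \<one>" using a by (simp add: l_minus r_minus Units_closed)
  moreover have "(\<ominus> (inv a)) \<otimes> (\<ominus> a) = \<one>" using a by (simp add: l_minus r_minus Units_closed)
  ultimately have "\<exists>b\<in>carrier R. b \<otimes> (\<ominus> a) = \<one> \<and> (\<ominus> a) \<otimes> b = \<one>"
    using a by (intro bexI[of _ "\<ominus> (inv a)"]) auto
  then show ?thesis using a by (simp add: Units_def)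
qed

end

section \<open>The action of square classes on a module\<close>

context cring
begin

lemma RF_cring: "cring (RF R)"
  unfolding RF_def
  by (intro comm_group.group_ring_cring comm_group.sq_group_comm_group units_comm_group)

lemma sq_elt_closed [simp]: "a \<in> Units R \<Longrightarrow> \<langle>a\<rangle> \<in> carrier (RF R)"
  by (simp add: RF_def sq_elt_def comm_group.sq_group_carrier[OF units_comm_group] units_of_carrier)

lemma sq_elt_mult:
  "\<lbrakk>a \<in> Units R; b \<in> Units R\<rbrakk> \<Longrightarrow> \<langle>a\<rangle> \<otimes>\<^bsub>RF R\<^esub> \<langle>b\<rangle> = \<langle>a \<otimes> b\<rangle>"
  using comm_group.sq_class_mult[OF units_comm_group, of a b]
  by (simp add: RF_def sq_elt_def units_of_carrier units_of_mult)

lemma sq_elt_square: "a \<in> Units R \<Longrightarrow> \<langle>a \<otimes> a\<rangle> = \<one>\<^bsub>RF R\<^esub>"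
  using comm_group.sq_class_square[OF units_comm_group, of a]
  by (simp add: RF_def sq_elt_def units_of_carrier units_of_mult)

end

locale sq_module = cring F + N: module "RF F" N
  for F :: "('a, 'm) ring_scheme" (structure) and N :: "('a set \<Rightarrow>\<^sub>0 int, 'b, 'n) module_scheme"
begin

definition act :: "'a \<Rightarrow> 'b \<Rightarrow> 'b" where "act a m = \<langle>a\<rangle> \<odot>\<^bsub>N\<^esub> m"

lemma act_closed [simp]: "\<lbrakk>a \<in> Units F; m \<in> carrier N\<rbrakk> \<Longrightarrow> act a m \<in> carrier N"
  by (simp add: act_def)

lemma act_add: "\<lbrakk>a \<in> Units F; m \<in> carrier N; m' \<in> carrier N\<rbrakk>
    \<Longrightarrow> act a (m \<oplus>\<^bsub>N\<^esub> m') = act a m \<oplus>\<^bsub>N\<^esub> act a m'"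
  by (simp add: act_def N.smult_r_distr)

lemma act_minus: "\<lbrakk>a \<in> Units F; m \<in> carrier N\<rbrakk> \<Longrightarrow> act a (\<ominus>\<^bsub>N\<^esub> m) = \<ominus>\<^bsub>N\<^esub> act a m"
  by (simp add: act_def N.smult_r_minus)

lemma act_diff: "\<lbrakk>a \<in> Units F; m \<in> carrier N; m' \<in> carrier N\<rbrakk>
    \<Longrightarrow> act a (m \<ominus>\<^bsub>N\<^esub> m') = act a m \<ominus>\<^bsub>N\<^esub> act a m'"
  by (simp add: N.M.minus_eq act_add act_minus)

lemma act_zero [simp]: "a \<in> Units F \<Longrightarrow> act a \<zero>\<^bsub>N\<^esub> = \<zero>\<^bsub>N\<^esub>"
  by (simp add: act_def)

lemma act_act: "\<lbrakk>a \<in> Units F; b \<in> Units F; m \<in> carrier N\<rbrakk> \<Longrightarrow> act a (act b m) = act (a \<otimes> b) m"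
  by (simp add: act_def sq_elt_mult flip: N.smult_assoc1)

lemma act_square: "\<lbrakk>a \<in> Units F; m \<in> carrier N\<rbrakk> \<Longrightarrow> act (a \<otimes> a) m = m"
  by (simp add: act_def sq_elt_square)

lemma act_one [simp]: "m \<in> carrier N \<Longrightarrow> act \<one> m = m"
  using act_square[of \<one> m] by simp

lemma act_square_mult:
  assumes "a \<in> Units F" "b \<in> Units F" "m \<in> carrier N"
  shows "act (a \<otimes> (a \<otimes> b)) m = act b m"
proof -
  have "act (a \<otimes> (a \<otimes> b)) m = act (a \<otimes> a) (act b m)"
    using assms by (simp add: act_act m_assoc Units_closed)
  then show ?thesis using assms by (simp add: act_square)
qed

text \<open>\<open>a / b\<close> is \<open>a b\<close> divided by the square of \<open>b\<close>,
  and squares act trivially.\<close>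

lemma act_fdiv:
  assumes "a \<in> Units F" "b \<in> Units F" "m \<in> carrier N"
  shows "act (a \<oslash> b) m = act (a \<otimes> b) m"
proof -
  have "act (a \<otimes> b) m = act (b \<otimes> (b \<otimes> (a \<oslash> b))) m"
    using assms fdiv_mult_cancel(1)[of a b] by (simp add: m_comm Units_closed)
  then show ?thesis using assms by (simp add: act_square_mult)
qed

lemma act_inv: "\<lbrakk>a \<in> Units F; m \<in> carrier N\<rbrakk> \<Longrightarrow> act (inv a) m = act a m"
  using act_fdiv[of \<one> a m] by (simp add: inv_fdiv Units_closed)

lemma act_inv_mult_cancel:
  assumes "a \<in> Units F" "b \<in> Units F" "m \<in> carrier N"
  shows "act (inv a \<otimes> (b \<oslash> a)) m = act b m"
proof -
  have "act (inv a \<otimes> (b \<oslash> a)) m = act a (act (b \<otimes> a) m)"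
    using assms by (simp add: act_inv act_fdiv flip: act_act)
  also have "\<dots> = act (a \<otimes> (a \<otimes> b)) m"
    using assms by (simp add: act_act m_ac Units_closed)
  finally show ?thesis using assms by (simp add: act_square_mult)
qed

lemmas act_simps = act_add act_minus act_diff act_act act_square act_square_mult act_fdiv act_inv

text \<open>With \<open>p = 1 - x\<close> and \<open>q = 1 - y\<close>, this is the five-term expression of the symbol \<open>s\<close>.\<close>

definition five :: "('a \<Rightarrow> 'b) \<Rightarrow> 'a \<Rightarrow> 'a \<Rightarrow> 'a \<Rightarrow> 'a \<Rightarrow> 'b" where
  "five s x p y q = s x \<ominus>\<^bsub>N\<^esub> s y \<oplus>\<^bsub>N\<^esub> act x (s (y \<oslash> x))
     \<ominus>\<^bsub>N\<^esub> act (x \<otimes> p) (s ((y \<otimes> p) \<oslash> (x \<otimes> q))) \<oplus>\<^bsub>N\<^esub> act p (s (p \<oslash> q))"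

end

text \<open>\<open>s_inv\<close> expresses that \<open>psi1\<close> vanishes. The symbols in the
  quotient \<open>RPt\<close> and the prescribed images in the induced module are both instances, so
  every identity below serves over the residue field as well as over the valued field.\<close>

locale symbol = sq_module + fixes s :: "'a \<Rightarrow> 'c"
  assumes s_closed [simp]: "a \<in> Units F \<Longrightarrow> s a \<in> carrier N"
    and s_inv: "a \<in> Units F \<Longrightarrow> s (inv a) = \<ominus>\<^bsub>N\<^esub> act (\<ominus> \<one>) (s a)"
begin

abbreviation "n \<equiv> \<ominus> \<one>"

lemma n_sq: "n \<otimes> n = \<one>" by (simp add: l_minus r_minus)

lemma act_n_n: "m \<in> carrier N \<Longrightarrow> act n (act n m) = m"
  by (simp add: act_act n_sq)

lemma s_fdiv: "\<lbrakk>a \<in> Units F; b \<in> Units F\<rbrakk> \<Longrightarrow> s (a \<oslash> b) = \<ominus>\<^bsub>N\<^esub> act n (s (b \<oslash> a))"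
  using s_inv[of "b \<oslash> a"] by (simp add: inv_fdiv_fdiv)

text \<open>Complementing both variables inverts the arguments of the last three terms and exchanges
  the third with the fifth. By \<open>s_inv\<close> these terms cancel under <-1>. If both five-term
  expressions vanish, \<open>s x + <-1> s p\<close> is therefore independent of
  \<open>x\<close>.\<close>

lemma five_compl:
  assumes U: "x \<in> Units F" "p \<in> Units F" "y \<in> Units F" "q \<in> Units F"
  shows "five s x p y q \<oplus>\<^bsub>N\<^esub> act n (five s p x q y)
    = (s x \<oplus>\<^bsub>N\<^esub> act n (s p)) \<ominus>\<^bsub>N\<^esub> (s y \<oplus>\<^bsub>N\<^esub> act n (s q))"
proof -
  have 1: "s (q \<oslash> p) = \<ominus>\<^bsub>N\<^esub> act n (s (p \<oslash> q))" "s (x \<oslash> y) = \<ominus>\<^bsub>N\<^esub> act n (s (y \<oslash> x))"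
    "s ((q \<otimes> x) \<oslash> (p \<otimes> y)) = \<ominus>\<^bsub>N\<^esub> act n (s ((y \<otimes> p) \<oslash> (x \<otimes> q)))"
    using U s_fdiv[of "q \<otimes> x" "p \<otimes> y"] by (simp_all add: s_fdiv[of q p] s_fdiv[of x y] m_comm Units_closed)
  have 2: "n \<otimes> (a \<otimes> n) = a" if "a \<in> Units F" for a
    using that by (simp add: l_minus r_minus Units_closed)
  show ?thesis
    using U unfolding five_def 1
    by (simp add: act_simps N.M.group_simps 2 n_sq m_comm[of p x] m_comm[of p n] Units_closed)
qed

end

text \<open>Modulo \<open>psi1\<close> the formula defining the constant reduces to
  \<open>s_compl\<close>. Over a field with two elements the condition is vacuous.\<close>

locale complement_symbol = symbol + fixes c :: 'c
  assumes c_closed [simp]: "c \<in> carrier N"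
    and s_compl: "\<lbrakk>x \<in> Units F; p \<in> Units F; x \<oplus> p = \<one>\<rbrakk> \<Longrightarrow> s x \<oplus>\<^bsub>N\<^esub> act n (s p) = c"
begin

text \<open>\<open>s_inv\<close> at \<open>p\<close> followed by \<open>s_compl\<close>: up to the
  constant, the substitution \<open>x \<mapsto> 1/(1 - x)\<close> leaves the symbol
  unchanged.\<close>

lemma s_rot:
  assumes "x \<in> Units F" "p \<in> Units F" "x \<oplus> p = \<one>"
  shows "s (inv p) = s x \<ominus>\<^bsub>N\<^esub> c"
  using assms s_compl[OF assms] by (simp add: s_inv N.M.group_simps)

text \<open>Exchange \<open>x\<close> and \<open>p\<close> in \<open>s_compl\<close>, then act by
  <-1>.\<close>

lemma act_n_c:
  assumes "x \<in> Units F" "p \<in> Units F" "x \<oplus> p = \<one>"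
  shows "act n c = c"
proof -
  have "c = s p \<oplus>\<^bsub>N\<^esub> act n (s x)"
    using s_compl[of p x] assms by (simp add: a_comm Units_closed)
  then have "act n c = act n (s p) \<oplus>\<^bsub>N\<^esub> s x" using assms by (simp add: act_add act_n_n)
  then show ?thesis using s_compl[OF assms] assms by (simp add: N.M.a_comm)
qed

lemma compl_inv:
  assumes "x \<in> Units F" "p \<in> Units F" "x \<oplus> p = \<one>"
  shows "inv p \<oplus> (n \<otimes> x) \<oslash> p = \<one>"
proof -
  have "\<one> \<oplus> n \<otimes> x = x \<oplus> p \<oplus> (\<ominus> x)" using assms by (simp add: l_minus Units_closed)
  also have "\<dots> = p \<oplus> (x \<oplus> (\<ominus> x))" using assms(1,2) by (simp add: a_ac Units_closed)
  also have "\<dots> = p" using assms(1,2) by (simp add: r_neg Units_closed)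
  finally have "(\<one> \<oplus> n \<otimes> x) \<otimes> inv p = \<one>" using assms by simp
  then show ?thesis using assms by (simp add: fdiv_def l_distr Units_closed)
qed

text \<open>After rewriting with \<open>s_inv\<close>, the complement identities of the pairs
  \<open>(1/x, 1/r)\<close>, \<open>(r, 1/p)\<close> and \<open>(p, x)\<close> add up to a
  telescoping sum.\<close>

lemma c3:
  assumes U: "x \<in> Units F" "p \<in> Units F" "x \<oplus> p = \<one>"
  shows "c \<oplus>\<^bsub>N\<^esub> c \<oplus>\<^bsub>N\<^esub> c = \<zero>\<^bsub>N\<^esub>"
proof -
  have px: "p \<oplus> x = \<one>" using U by (simp add: a_comm Units_closed)
  \<comment> \<open>\<open>r\<close> is the complement of \<open>1/p\<close>, and its inverse
    \<open>-p/x\<close> is the complement of \<open>1/x\<close>.\<close>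
  define r where "r = (n \<otimes> x) \<oslash> p"
  have r: "r \<in> Units F" "inv r = (n \<otimes> p) \<oslash> x"
  proof -
    show "r \<in> Units F" using U by (simp add: r_def)
    show "inv r = (n \<otimes> p) \<oslash> x"
      using U unfolding r_def
      by (subst inv_fdiv_fdiv) (simp_all add: fdiv_eq_iff, simp add: frac_simps l_minus r_minus)
  qed
  have "s (inv x) \<oplus>\<^bsub>N\<^esub> act n (s (inv r)) = c"
    using compl_inv[OF U(2,1) px] U r(1) unfolding r(2)[symmetric] by (intro s_compl) simp_all
  then have 1: "\<ominus>\<^bsub>N\<^esub> act n (s x) \<ominus>\<^bsub>N\<^esub> s r = c"
    using U r(1) by (simp add: s_inv act_minus act_n_n N.M.minus_eq)
  have "s r \<oplus>\<^bsub>N\<^esub> act n (s (inv p)) = c"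
    using compl_inv[OF U] U r(1) unfolding r_def[symmetric]
    by (intro s_compl) (simp_all add: a_comm Units_closed)
  then have 2: "s r \<ominus>\<^bsub>N\<^esub> s p = c"
    using U r by (simp add: s_inv act_minus act_n_n N.M.minus_eq)
  have 3: "s p \<oplus>\<^bsub>N\<^esub> act n (s x) = c"
    using s_compl[OF U(2,1) px] .
  have "c \<oplus>\<^bsub>N\<^esub> c \<oplus>\<^bsub>N\<^esub> c = (\<ominus>\<^bsub>N\<^esub> act n (s x) \<ominus>\<^bsub>N\<^esub> s r) \<oplus>\<^bsub>N\<^esub> (s r \<ominus>\<^bsub>N\<^esub> s p) \<oplus>\<^bsub>N\<^esub> (s p \<oplus>\<^bsub>N\<^esub> act n (s x))"
    unfolding 1 2 3 ..
  also have "\<dots> = \<zero>\<^bsub>N\<^esub>"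
    using U r by (simp add: N.M.group_simps)
  finally show ?thesis .
qed

text \<open>\<open>-w/w'\<close> is the inverse of the complement of \<open>1/w\<close>, so this is
  \<open>s_rot\<close> at \<open>1/w\<close> followed by \<open>s_inv\<close>.\<close>

lemma s_rot2:
  assumes U: "w \<in> Units F" "w' \<in> Units F" "w \<oplus> w' = \<one>"
  shows "s ((n \<otimes> w) \<oslash> w') = \<ominus>\<^bsub>N\<^esub> act n (s w) \<ominus>\<^bsub>N\<^esub> c"
proof -
  define r where "r = (n \<otimes> w') \<oslash> w"
  have r: "r \<in> Units F" "inv r = (n \<otimes> w) \<oslash> w'"
  proof -
    show "r \<in> Units F" using U by (simp add: r_def)
    show "inv r = (n \<otimes> w) \<oslash> w'"
      using U unfolding r_def
      by (subst inv_fdiv_fdiv) (simp_all add: fdiv_eq_iff, simp add: frac_simps l_minus r_minus)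
  qed
  have "inv w \<oplus> r = \<one>"
    using compl_inv[of w' w] U by (simp add: r_def a_comm Units_closed)
  then have "s (inv r) = s (inv w) \<ominus>\<^bsub>N\<^esub> c"
    using U r(1) by (intro s_rot) simp_all
  then show ?thesis using U unfolding r(2) by (simp add: s_inv)
qed

text \<open>The first two terms both change by \<open>- c\<close>, which cancels in their
  difference. The third, fourth and fifth terms of the rotated expression have the arguments
  \<open>p/q\<close>, \<open>x/y\<close> and \<open>xq/(yp)\<close>; up to inversion these are the
  arguments of the fifth, third and fourth terms of the original, and \<open>s_inv\<close> accounts
  for signs and coefficients.\<close>

lemma five_rot:
  assumes U: "x \<in> Units F" "p \<in> Units F" "x \<oplus> p = \<one>" "y \<in> Units F" "q \<in> Units F" "y \<oplus> q = \<one>"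
  shows "five s (inv p) ((n \<otimes> x) \<oslash> p) (inv q) ((n \<otimes> y) \<oslash> q) = five s x p y q"
proof -
  have 1: "inv q \<oslash> inv p = p \<oslash> q"
    using U by (simp add: inv_fdiv frac_simps)
  have 2: "((n \<otimes> x) \<oslash> p) \<oslash> ((n \<otimes> y) \<oslash> q) = (x \<otimes> q) \<oslash> (y \<otimes> p)"
    using U by (simp add: frac_simps)
  have 3: "(inv q \<otimes> ((n \<otimes> x) \<oslash> p)) \<oslash> (inv p \<otimes> ((n \<otimes> y) \<oslash> q)) = x \<oslash> y"
    using U by (simp add: inv_fdiv frac_simps)
  have 4: "act (inv p \<otimes> ((n \<otimes> x) \<oslash> p)) m = act (n \<otimes> x) m" if "m \<in> carrier N" for m
    using act_inv_mult_cancel[of p "n \<otimes> x" m] U that by simp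
  have 5: "act ((n \<otimes> x) \<oslash> p) m = act (n \<otimes> (x \<otimes> p)) m" if "m \<in> carrier N" for m
    using U that by (simp add: act_fdiv m_assoc Units_closed)
  have 6: "n \<otimes> (a \<otimes> n) = a" "n \<otimes> (n \<otimes> a) = a" if "a \<in> Units F" for a
    using that by (simp_all add: l_minus r_minus Units_closed)
  have 7: "s (x \<oslash> y) = \<ominus>\<^bsub>N\<^esub> act n (s (y \<oslash> x))"
    "s ((x \<otimes> q) \<oslash> (y \<otimes> p)) = \<ominus>\<^bsub>N\<^esub> act n (s ((y \<otimes> p) \<oslash> (x \<otimes> q)))"
    using U by (simp_all add: s_fdiv[of x y] s_fdiv[of "x \<otimes> q"])
  have 8: "act (n \<otimes> a) (\<ominus>\<^bsub>N\<^esub> act n m) = \<ominus>\<^bsub>N\<^esub> act a m" if "a \<in> Units F" "m \<in> carrier N" for a m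
    using that 6[of a] by (simp add: act_minus act_act m_comm[of _ n] m_assoc Units_closed)
  show ?thesis
    using U unfolding five_def 1 2 3 7
    by (simp add: 4 5 8 s_rot act_inv N.M.group_simps)
qed

lemma act_n_mult_c:
  assumes "act n c = c" "a \<in> Units F"
  shows "act (n \<otimes> a) c = act a c"
  using assms act_act[of a n c] by (simp add: m_comm Units_closed)

text \<open>The five-term relations for \<open>(x, y)\<close> and for \<open>(1/x, y/x)\<close> share three of their terms up to
  the symmetries of the symbol.\<close>

lemma neg_act_symbol:
  assumes x: "x \<in> Units F" "p \<in> Units F" "x \<oplus> p = \<one>" and y: "y \<in> Units F" "q \<in> Units F" "y \<oplus> q = \<one>"
    and d: "d \<in> Units F" "x = y \<oplus> d"
    and five1: "five s x p y q = \<zero>\<^bsub>N\<^esub>"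
    and five2: "five s (inv x) ((n \<otimes> p) \<oslash> x) (y \<oslash> x) (d \<oslash> x) = \<zero>\<^bsub>N\<^esub>"
  shows "s x \<ominus>\<^bsub>N\<^esub> act (n \<otimes> x) (s x) = act p c \<ominus>\<^bsub>N\<^esub> act (x \<otimes> p) c"
proof -
  note U = x y d(1)
  have qpd: "q = p \<oplus> d"
  proof -
    have "y \<oplus> q = y \<oplus> (p \<oplus> d)" using x y d by (simp add: a_ac Units_closed)
    then show ?thesis using U by (simp add: Units_closed)
  qed
  have nc: "act n c = c" using act_n_c[OF x] .
  have e1: "(y \<oslash> x) \<oslash> inv x = y" using U by (simp add: inv_fdiv frac_simps)
  \<comment> \<open>In the second relation the last two arguments have the form
    \<open>-w/(1 - w)\<close> with \<open>w = p/q\<close> and \<open>w = yp/(xq)\<close>, the last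
    two arguments of the first relation in reverse order. \<open>s_rot2\<close> applies because
    \<open>p + d = q\<close> and \<open>yp + d = xq\<close>.\<close>
  have e2: "((n \<otimes> p) \<oslash> x) \<oslash> (d \<oslash> x) = (n \<otimes> (p \<oslash> q)) \<oslash> (d \<oslash> q)"
    using U by (simp add: frac_simps)
  have e3: "((y \<oslash> x) \<otimes> ((n \<otimes> p) \<oslash> x)) \<oslash> (inv x \<otimes> (d \<oslash> x))
      = (n \<otimes> ((y \<otimes> p) \<oslash> (x \<otimes> q))) \<oslash> (d \<oslash> (x \<otimes> q))"
    using U by (simp add: inv_fdiv frac_simps)
  have z: "s ((n \<otimes> (p \<oslash> q)) \<oslash> (d \<oslash> q)) = \<ominus>\<^bsub>N\<^esub> act n (s (p \<oslash> q)) \<ominus>\<^bsub>N\<^esub> c"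
  proof (rule s_rot2)
    show "p \<oslash> q \<oplus> d \<oslash> q = \<one>"
      using U qpd by (simp add: fdiv_def Units_closed flip: l_distr)
  qed (use U in auto)
  have w: "s ((n \<otimes> ((y \<otimes> p) \<oslash> (x \<otimes> q))) \<oslash> (d \<oslash> (x \<otimes> q)))
      = \<ominus>\<^bsub>N\<^esub> act n (s ((y \<otimes> p) \<oslash> (x \<otimes> q))) \<ominus>\<^bsub>N\<^esub> c"
  proof (rule s_rot2)
    \<comment> \<open>The factor \<open>y + p + d\<close>, which equals 1, makes the identity
      \<open>xq = yp + d\<close> homogeneous, so that it follows by expanding
      \<open>(y + d)(p + d)\<close>.\<close>
    have "x \<otimes> q = y \<otimes> p \<oplus> (y \<oplus> (p \<oplus> d)) \<otimes> d"
      using U(2,4) d(1) unfolding d(2) qpd by (simp add: l_distr r_distr a_ac m_ac Units_closed)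
    also have "y \<oplus> (p \<oplus> d) = \<one>" using y qpd by simp
    finally have "y \<otimes> p \<oplus> d = x \<otimes> q" using U by (simp add: Units_closed)
    then show "(y \<otimes> p) \<oslash> (x \<otimes> q) \<oplus> d \<oslash> (x \<otimes> q) = \<one>"
      using U by (simp add: fdiv_add Units_closed)
  qed (use U in auto)
  have a1: "act (inv x \<otimes> ((n \<otimes> p) \<oslash> x)) m = act (n \<otimes> p) m" if "m \<in> carrier N" for m
    using act_inv_mult_cancel[of x "n \<otimes> p" m] U that by simp
  have a2: "act ((n \<otimes> p) \<oslash> x) m = act (n \<otimes> (x \<otimes> p)) m" if "m \<in> carrier N" for m
    using U that by (simp add: act_fdiv m_ac Units_closed)
  have a3: "act (n \<otimes> a) (\<ominus>\<^bsub>N\<^esub> act n m \<ominus>\<^bsub>N\<^esub> c) = \<ominus>\<^bsub>N\<^esub> act a m \<ominus>\<^bsub>N\<^esub> act a c"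
    if "a \<in> Units F" "m \<in> carrier N" for a m
  proof -
    have "n \<otimes> a \<otimes> n = a" using that by (simp add: l_minus r_minus Units_closed)
    then show ?thesis
      using that act_n_mult_c[OF nc] by (simp add: act_minus act_diff act_act)
  qed
  let ?Z = "s (p \<oslash> q)" and ?W = "s ((y \<otimes> p) \<oslash> (x \<otimes> q))" and ?U = "s (y \<oslash> x)"
  have T2: "\<ominus>\<^bsub>N\<^esub> act n (s x) \<ominus>\<^bsub>N\<^esub> ?U \<oplus>\<^bsub>N\<^esub> act x (s y) \<ominus>\<^bsub>N\<^esub> (\<ominus>\<^bsub>N\<^esub> act p ?W \<ominus>\<^bsub>N\<^esub> act p c)
      \<oplus>\<^bsub>N\<^esub> (\<ominus>\<^bsub>N\<^esub> act (x \<otimes> p) ?Z \<ominus>\<^bsub>N\<^esub> act (x \<otimes> p) c) = \<zero>\<^bsub>N\<^esub>"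
    using five2 U unfolding five_def e1 e2 e3 z w by (simp add: a1 a2 a3 act_inv s_inv)
  \<comment> \<open>Acting by <x> gives the terms in \<open>y\<close>, \<open>?U\<close>,
    \<open>?W\<close> and \<open>?Z\<close> the coefficients that they have in the first relation,
    with opposite signs. In the sum of the two relations only \<open>s x\<close> and the constant
    survive.\<close>
  have "act x (\<ominus>\<^bsub>N\<^esub> act n (s x) \<ominus>\<^bsub>N\<^esub> ?U \<oplus>\<^bsub>N\<^esub> act x (s y) \<ominus>\<^bsub>N\<^esub> (\<ominus>\<^bsub>N\<^esub> act p ?W \<ominus>\<^bsub>N\<^esub> act p c)
      \<oplus>\<^bsub>N\<^esub> (\<ominus>\<^bsub>N\<^esub> act (x \<otimes> p) ?Z \<ominus>\<^bsub>N\<^esub> act (x \<otimes> p) c))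
    = \<ominus>\<^bsub>N\<^esub> act (n \<otimes> x) (s x) \<ominus>\<^bsub>N\<^esub> act x ?U \<oplus>\<^bsub>N\<^esub> s y \<ominus>\<^bsub>N\<^esub> (\<ominus>\<^bsub>N\<^esub> act (x \<otimes> p) ?W \<ominus>\<^bsub>N\<^esub> act (x \<otimes> p) c)
      \<oplus>\<^bsub>N\<^esub> (\<ominus>\<^bsub>N\<^esub> act p ?Z \<ominus>\<^bsub>N\<^esub> act p c)"
    using U by (simp add: act_simps m_comm[of x n] Units_closed)
  then have T2': "\<ominus>\<^bsub>N\<^esub> act (n \<otimes> x) (s x) \<ominus>\<^bsub>N\<^esub> act x ?U \<oplus>\<^bsub>N\<^esub> s y \<ominus>\<^bsub>N\<^esub> (\<ominus>\<^bsub>N\<^esub> act (x \<otimes> p) ?W \<ominus>\<^bsub>N\<^esub> act (x \<otimes> p) c)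
      \<oplus>\<^bsub>N\<^esub> (\<ominus>\<^bsub>N\<^esub> act p ?Z \<ominus>\<^bsub>N\<^esub> act p c) = \<zero>\<^bsub>N\<^esub>" (is "?T2 = _")
    unfolding T2 using U by simp
  have "five s x p y q \<oplus>\<^bsub>N\<^esub> ?T2
      = (s x \<ominus>\<^bsub>N\<^esub> act (n \<otimes> x) (s x)) \<ominus>\<^bsub>N\<^esub> (act p c \<ominus>\<^bsub>N\<^esub> act (x \<otimes> p) c)"
    using U unfolding five_def by (simp add: N.M.group_simps)
  then have "(s x \<ominus>\<^bsub>N\<^esub> act (n \<otimes> x) (s x)) \<ominus>\<^bsub>N\<^esub> (act p c \<ominus>\<^bsub>N\<^esub> act (x \<otimes> p) c) = \<zero>\<^bsub>N\<^esub>"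
    unfolding five1 T2' by simp
  then show ?thesis
    by (subst (asm) N.M.diff_eq_iff(1)) (use U in simp_all)
qed

end

section \<open>The refined pre-Bloch module and its quotient\<close>

lemma submodule_vimage:
  assumes "module R M" "module R N" "h \<in> mod_hom R M N" and H: "submodule H R N"
  shows "submodule {x \<in> carrier M. h x \<in> H} R M"
proof -
  interpret M: module R M by fact
  interpret N: module R N by fact
  note ab = M.abelian_group_axioms N.abelian_group_axioms
  show ?thesis
  proof (rule M.submoduleI)
    show "\<zero>\<^bsub>M\<^esub> \<in> {x \<in> carrier M. h x \<in> H}"
      using subgroup.one_closed[OF submodule.axioms(1)[OF H]] mod_hom_zero[OF assms(3) ab] by simp
  qed (use N.submoduleE(3,4,5)[OF H] in
        \<open>auto simp: mod_homD[OF assms(3)] mod_hom_minus[OF assms(3) ab]\<close>)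
qed

lemma (in abelian_group) add_minus_cancel:
  assumes "x \<in> carrier G" "y \<in> carrier G"
  shows "x \<oplus> (y \<ominus> x) = y" "(x \<oplus> y) \<ominus> x = y"
  using diff_eq_iff(1)[of y x "y \<ominus> x"] diff_eq_iff(1)[of "x \<oplus> y" x y] assms
  by (simp_all add: a_comm)

lemma (in cring) neg_fdiv_neg:
  assumes "a \<in> carrier R" "b \<in> Units R"
  shows "(\<ominus> a) \<oslash> (\<ominus> b) = a \<oslash> b"
proof -
  have "\<ominus> a = (a \<oslash> b) \<otimes> (\<ominus> b)"
    using assms by (simp add: r_minus fdiv_mult_cancel Units_closed)
  then show ?thesis using assms fdiv_mult_cancel(2)[of "a \<oslash> b" "\<ominus> b"] by simp
qed

lemma (in cring) rp_gen_closed: "rp_gen R x \<in> carrier (rp_free R)"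
  by (rule cring.free_gen_closed[OF RF_cring])

lemma (in cring) rp_free_module: "module (RF R) (rp_free R)"
  by (rule cring.free_module_module[OF RF_cring])

context field
begin

lemma minus_one_Units [simp]: "\<ominus> \<one> \<in> Units R"
  by (rule neg_Units) simp

lemma one_minus:
  assumes "x \<in> Units R" "x \<noteq> \<one>"
  shows "\<one> \<ominus> x \<in> Units R" "x \<oplus> (\<one> \<ominus> x) = \<one>"
proof -
  have x: "x \<in> carrier R" using assms by (simp add: Units_closed)
  show 1: "x \<oplus> (\<one> \<ominus> x) = \<one>" using x by (simp add: add_minus_cancel)
  then have "\<one> \<ominus> x \<noteq> \<zero>" using assms x by (metis r_zero)
  then show "\<one> \<ominus> x \<in> Units R" using x by (simp add: field_Units)
qed

lemma compl_eq:
  assumes "x \<in> carrier R" "p \<in> carrier R" "x \<oplus> p = \<one>"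
  shows "\<one> \<ominus> x = p"
proof -
  have "\<one> \<ominus> x = p \<oplus> (x \<oplus> (\<ominus> x))"
    using assms(1,2) unfolding assms(3)[symmetric] by (simp add: minus_eq a_ac)
  then show ?thesis using assms by (simp add: r_neg)
qed

lemma compl_neq_one:
  assumes "x \<in> Units R" "p \<in> Units R" "x \<oplus> p = \<one>"
  shows "x \<noteq> \<one>"
proof
  assume "x = \<one>"
  then have "p = \<zero>" using compl_eq[of x p] assms by (simp add: Units_closed minus_eq r_neg)
  then show False using assms by (simp add: field_Units)
qed

text \<open>The coefficient class of \<open>1/x - 1 = p/x\<close> is that of \<open>xp\<close>, and
  \<open>(1 - 1/x)/(1 - 1/y)\<close> equals \<open>yp/(xq)\<close>; this converts the relation of
  the presentation into the fraction form used by \<open>five\<close>.\<close>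

lemma rp_gen_hom_five_term:
  assumes N: "module (RF R) N" and h: "h \<in> mod_hom (RF R) (rp_free R) N"
    and U: "x \<in> Units R" "p \<in> Units R" "x \<oplus> p = \<one>" "y \<in> Units R" "q \<in> Units R" "y \<oplus> q = \<one>"
  shows "h (five_term R x y) = sq_module.five R N (\<lambda>a. h (rp_gen R (Some a))) x p y q"
proof -
  interpret N: module "RF R" N by fact
  interpret M: module "RF R" "rp_free R" by (rule rp_free_module)
  interpret sq_module R N by unfold_locales
  note ab = M.abelian_group_axioms N.abelian_group_axioms
  have p: "\<one> \<ominus> x = p" and q: "\<one> \<ominus> y = q"
    using compl_eq U by (auto simp: Units_closed)
  have px: "\<one> = x \<oplus> p" using U by simp
  have e1: "inv x \<ominus> \<one> = p \<oslash> x"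
  proof -
    have "\<one> \<oslash> x = (x \<oplus> p) \<oslash> x" using U by simp
    also have "\<dots> = \<one> \<oplus> p \<oslash> x" using U(1,2) by (simp add: Units_closed flip: fdiv_add)
    finally show ?thesis using U(1,2,4,5) by (simp add: inv_fdiv add_minus_cancel Units_closed)
  qed
  have e1': "inv y \<ominus> \<one> = q \<oslash> y"
  proof -
    have "\<one> \<oslash> y = (y \<oplus> q) \<oslash> y" using U by simp
    also have "\<dots> = \<one> \<oplus> q \<oslash> y" using U(4,5) by (simp add: Units_closed flip: fdiv_add)
    finally show ?thesis using U(1,2,4,5) by (simp add: inv_fdiv add_minus_cancel Units_closed)
  qed
  have e2: "\<one> \<ominus> inv x = \<ominus> (p \<oslash> x)" "\<one> \<ominus> inv y = \<ominus> (q \<oslash> y)"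
    using U by (simp_all add: Units_closed minus_simps' flip: e1 e1')
  have e3: "(\<ominus> (p \<oslash> x)) \<otimes> inv (\<ominus> (q \<oslash> y)) = (y \<otimes> p) \<oslash> (x \<otimes> q)"
    using U by (subst fdiv_def[symmetric]) (simp add: neg_fdiv_neg frac_simps)
  have e4: "y \<otimes> inv x = y \<oslash> x" "p \<otimes> inv q = p \<oslash> q"
    by (simp_all add: fdiv_def)
  have a: "act (p \<oslash> x) m = act (x \<otimes> p) m" if "m \<in> carrier N" for m
    using U that act_fdiv[of p x m] by (simp add: m_comm Units_closed)
  show ?thesis
    unfolding five_term_def Let_def p q e1 e2 e3 e4 five_def
    using U by (simp add: mod_hom_add[OF h] mod_hom_diff[OF h ab] mod_hom_smult[OF h] a
        mod_hom_closed[OF h] rp_gen_closed del: free_module_sel flip: act_def)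
qed

lemma five_term_closed:
  assumes "x \<in> Units R" "p \<in> Units R" "x \<oplus> p = \<one>" "y \<in> Units R" "q \<in> Units R" "y \<oplus> q = \<one>"
  shows "five_term R x y \<in> carrier (rp_free R)"
proof -
  interpret M: module "RF R" "rp_free R" by (rule rp_free_module)
  have p: "\<one> \<ominus> x = p" using compl_eq assms by (auto simp: Units_closed)
  have "inv x \<ominus> \<one> \<in> Units R"
  proof -
    have "inv x \<noteq> \<one>"
      using compl_neq_one[OF assms(1-3)] assms(1) by (metis Units_inv_inv inv_one)
    then have "\<ominus> (\<one> \<ominus> inv x) \<in> Units R" using one_minus(1)[of "inv x"] assms by simp
    then show ?thesis using assms by (simp add: minus_simps' Units_closed)
  qed
  then show ?thesis
    unfolding five_term_def Let_def using assms
    by (simp add: rp_gen_closed p del: free_module_sel)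
qed

lemma rp_rels_closed: "rp_rels R \<subseteq> carrier (rp_free R)"
proof -
  interpret M: module "RF R" "rp_free R" by (rule rp_free_module)
  have "five_term R x y \<in> carrier (rp_free R)"
    if "x \<in> Units R - {\<one>}" "y \<in> Units R - {\<one>}" for x y
    using five_term_closed[of x "\<one> \<ominus> x" y "\<one> \<ominus> y"] one_minus[of x] one_minus[of y] that by auto
  then show ?thesis
    by (auto simp: rp_rels_def rp_gen_closed simp del: free_module_sel)
qed

lemma rp_submod: "submod (rp_relmod R) (RF R) (rp_free R)"
  by (intro submod.intro rp_free_module module.gen_submodule_submodule[OF rp_free_module] rp_rels_closed)

lemma RP_module: "module (RF R) (RP R)"
  unfolding RP_def by (rule submod.Q_module[OF rp_submod])

lemma rp_sym_closed: "rp_sym R a \<in> carrier (RP R)"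
  unfolding RP_def rp_sym_def by (rule submod.pr_closed[OF rp_submod rp_gen_closed])

lemma rp_pr_hom: "(\<lambda>f. rp_relmod R +>\<^bsub>rp_free R\<^esub> f) \<in> mod_hom (RF R) (rp_free R) (RP R)"
  unfolding RP_def by (rule submod.pr_mod_hom[OF rp_submod])

lemma rp_pr_rel:
  assumes "f \<in> rp_rels R"
  shows "rp_relmod R +>\<^bsub>rp_free R\<^esub> f = \<zero>\<^bsub>RP R\<^esub>"
  unfolding RP_def
proof (subst submod.pr_eq_zero_iff[OF rp_submod])
  show "f \<in> carrier (rp_free R)" using assms rp_rels_closed by blast
  show "f \<in> rp_relmod R" using assms module.gen_submodule_superset[OF rp_free_module] by blast
qed

lemma psi1_closed: "a \<in> Units R \<Longrightarrow> psi1 R a \<in> carrier (RP R)"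
proof -
  interpret module "RF R" "RP R" by (rule RP_module)
  show "a \<in> Units R \<Longrightarrow> psi1 R a \<in> carrier (RP R)" by (simp add: psi1_def rp_sym_closed)
qed

lemma K1_submod: "submod (K1 R) (RF R) (RP R)"
  unfolding K1_def
  by (intro submod.intro RP_module module.gen_submodule_submodule) (auto intro: psi1_closed)

lemma RPt_module: "module (RF R) (RPt R)"
  unfolding RPt_def by (rule submod.Q_module[OF K1_submod])

definition rpt_pr where "rpt_pr X = K1 R +>\<^bsub>RP R\<^esub> X"

lemma rpt_pr_hom: "rpt_pr \<in> mod_hom (RF R) (RP R) (RPt R)"
  using submod.pr_mod_hom[OF K1_submod] unfolding RPt_def rpt_pr_def[abs_def] .

lemma rpt_sym_pr: "rpt_sym R a = rpt_pr (rp_sym R a)"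
  by (simp add: rpt_sym_def rpt_pr_def)

lemma rpt_const_pr: "rpt_const R = rpt_pr (rp_const R)"
  by (simp add: rpt_const_def rpt_pr_def)

lemma rpt_pr_psi1:
  assumes "a \<in> Units R"
  shows "rpt_pr (psi1 R a) = \<zero>\<^bsub>RPt R\<^esub>"
proof -
  have "psi1 R a \<in> K1 R"
    unfolding K1_def using assms module.gen_submodule_superset[OF RP_module, of "psi1 R ` Units R"]
    by (rule_tac subsetD) auto
  then show ?thesis
    unfolding rpt_pr_def RPt_def using assms by (simp add: submod.pr_eq_zero_iff[OF K1_submod] psi1_closed)
qed

end

text \<open>Gathers what is required of the residue field, so that its size no longer matters
  afterwards. The two conditions on \<open>c\<close> alone are separate axioms because over two
  elements there is no pair \<open>x + p = 1\<close> from which to derive them.\<close>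

locale bloch_symbol = complement_symbol +
  assumes s_one: "s \<one> = \<zero>\<^bsub>N\<^esub>"
    and act_n_const: "act (\<ominus> \<one>) c = c"
    and three_const: "c \<oplus>\<^bsub>N\<^esub> c \<oplus>\<^bsub>N\<^esub> c = \<zero>\<^bsub>N\<^esub>"
    and five_zero: "\<lbrakk>x \<in> Units F; p \<in> Units F; x \<oplus> p = \<one>; y \<in> Units F; q \<in> Units F; y \<oplus> q = \<one>\<rbrakk>
      \<Longrightarrow> five s x p y q = \<zero>\<^bsub>N\<^esub>"
    and neg_act: "\<lbrakk>x \<in> Units F; p \<in> Units F; x \<oplus> p = \<one>\<rbrakk>
      \<Longrightarrow> s x \<ominus>\<^bsub>N\<^esub> act (\<ominus> \<one> \<otimes> x) (s x) = act p c \<ominus>\<^bsub>N\<^esub> act (x \<otimes> p) c"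

section \<open>Small fields and the relations between symbols in the quotient\<close>

context field
begin

lemma order_gt_2:
  assumes "x \<in> Units R" "x \<noteq> \<one>" shows "order R \<noteq> 2"
proof
  assume o: "order R = 2"
  then have fin: "finite (carrier R)" unfolding order_def by (metis card.infinite zero_neq_numeral)
  have "{\<zero>, \<one>, x} \<subseteq> carrier R" "card {\<zero>, \<one>, x} = 3" using assms by (auto simp: field_Units)
  then show False using card_mono[OF fin] o by (metis Suc_n_not_le_n numeral_2_eq_2 numeral_3_eq_3 order_def)
qed

lemma order_3:
  assumes o: "order R = 3" and x: "x \<in> Units R" "x \<noteq> \<one>"
  shows "x = \<ominus> \<one>"
proof -
  have fin: "finite (carrier R)" using o unfolding order_def by (metis card.infinite zero_neq_numeral)
  have "{\<zero>, \<one>, x} \<subseteq> carrier R" "card {\<zero>, \<one>, x} = 3" using x by (auto simp: field_Units)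
  then have c: "carrier R = {\<zero>, \<one>, x}" using card_subset_eq[OF fin] o by (metis order_def)
  have xc: "x \<in> carrier R" "x \<noteq> \<zero>" using x by (auto simp: field_Units)
  \<comment> \<open>If -1 were 1, then \<open>x + 1\<close> would be a fourth element.\<close>
  have "\<ominus> \<one> \<noteq> \<one>"
  proof
    assume n: "\<ominus> \<one> = \<one>"
    have 1: "\<one> \<oplus> \<one> = \<zero>" using r_neg[of \<one>] n by simp
    have "x \<oplus> \<one> \<in> carrier R" using xc by simp
    then have "x \<oplus> \<one> \<in> {\<zero>, \<one>, x}" unfolding c .
    moreover have "x \<oplus> \<one> \<noteq> \<zero>" using xc x n by (metis minus_equality one_closed)
    moreover have "x \<oplus> \<one> \<noteq> \<one>" using xc by simp
    moreover have "x \<oplus> \<one> \<noteq> x" using xc by simp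
    ultimately show False by blast
  qed
  moreover have "\<ominus> \<one> \<in> carrier R - {\<zero>}" using minus_one_Units by (simp add: field_Units)
  ultimately show ?thesis using c by auto
qed

lemma order_neq_2:
  assumes "order R \<noteq> 2"
  shows "\<exists>x. x \<in> Units R - {\<one>}"
proof (rule ccontr)
  assume none: "\<not> ?thesis"
  have "carrier R = {\<zero>, \<one>}"
    using none by (auto simp: field_Units)
  then show False using assms zero_not_one by (simp add: order_def)
qed

lemma rp_const_generic:
  assumes "order R \<noteq> 2" "order R \<noteq> 3"
  obtains y where "y \<in> Units R" "y \<noteq> \<one>"
    "rp_const R = rp_sym R y \<oplus>\<^bsub>RP R\<^esub> \<langle>\<ominus> \<one>\<rangle> \<odot>\<^bsub>RP R\<^esub> rp_sym R (\<one> \<ominus> y)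
       \<oplus>\<^bsub>RP R\<^esub> pfister_elt R (\<one> \<ominus> y) \<odot>\<^bsub>RP R\<^esub> psi1 R y"
proof -
  have "(SOME x. x \<in> Units R - {\<one>}) \<in> Units R - {\<one>}"
    by (rule someI_ex[OF order_neq_2[OF assms(1)]])
  then show ?thesis
    using assms by (intro that) (auto simp only: rp_const_def Let_def if_False)
qed

lemma pfister_closed: "y \<in> Units R \<Longrightarrow> pfister_elt R y \<in> carrier (RF R)"
proof -
  interpret RF: cring "RF R" by (rule RF_cring)
  show "y \<in> Units R \<Longrightarrow> pfister_elt R y \<in> carrier (RF R)" by (simp add: pfister_elt_def)
qed

lemma rp_const_closed: "rp_const R \<in> carrier (RP R)"
proof -
  interpret RP: module "RF R" "RP R" by (rule RP_module)
  show ?thesis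
  proof (cases "order R = 2 \<or> order R = 3")
    case True
    then show ?thesis
      using mod_hom_closed[OF rp_pr_hom rp_gen_closed] by (auto simp: rp_const_def psi1_closed)
  next
    case False
    then obtain y where "y \<in> Units R" "y \<noteq> \<one>"
      "rp_const R = rp_sym R y \<oplus>\<^bsub>RP R\<^esub> \<langle>\<ominus> \<one>\<rangle> \<odot>\<^bsub>RP R\<^esub> rp_sym R (\<one> \<ominus> y)
       \<oplus>\<^bsub>RP R\<^esub> pfister_elt R (\<one> \<ominus> y) \<odot>\<^bsub>RP R\<^esub> psi1 R y"
      using rp_const_generic by metis
    then show ?thesis
      by (simp add: rp_sym_closed psi1_closed pfister_closed one_minus)
  qed
qed

text \<open>For at least four elements everything is derived from the five-term relations. Over
  three elements all complementary pairs are \<open>(-1, -1)\<close>, and over two there are none,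
  so the presentations of these fields suffice.\<close>

lemma rpt_bloch_symbol: "bloch_symbol R (RPt R) (rpt_sym R) (rpt_const R)"
proof -
  interpret FM: module "RF R" "rp_free R" by (rule rp_free_module)
  interpret RP: module "RF R" "RP R" by (rule RP_module)
  interpret N: module "RF R" "RPt R" by (rule RPt_module)
  interpret sq_module R "RPt R" by unfold_locales
  note ab = RP.abelian_group_axioms N.abelian_group_axioms
  let ?s = "rpt_sym R" and ?c = "rpt_const R" and ?n = "\<ominus> \<one>"
  have s_closed [simp]: "?s a \<in> carrier (RPt R)" for a
    unfolding rpt_sym_pr by (rule mod_hom_closed[OF rpt_pr_hom rp_sym_closed])
  have nn: "?n \<otimes> ?n = \<one>" by (simp add: l_minus r_minus)
  have psi: "?s a \<oplus>\<^bsub>RPt R\<^esub> act ?n (?s (inv a)) = \<zero>\<^bsub>RPt R\<^esub>" if "a \<in> Units R" for a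
    using rpt_pr_psi1[OF that] that
    by (simp add: psi1_def mod_hom_add[OF rpt_pr_hom] mod_hom_smult[OF rpt_pr_hom] rp_sym_closed
        act_def rpt_sym_pr)
  interpret symbol R "RPt R" ?s
  proof
    fix a assume a: "a \<in> Units R"
    have "?s (inv a) \<oplus>\<^bsub>RPt R\<^esub> act ?n (?s a) = \<zero>\<^bsub>RPt R\<^esub>" using psi[of "inv a"] a by simp
    then show "?s (inv a) = \<ominus>\<^bsub>RPt R\<^esub> act ?n (?s a)"
      using N.M.minus_equality a by simp
  qed simp
  define h where "h f = rpt_pr (rp_relmod R +>\<^bsub>rp_free R\<^esub> f)" for f
  have h: "h \<in> mod_hom (RF R) (rp_free R) (RPt R)"
    unfolding h_def[abs_def] by (rule mod_hom_comp[OF rp_pr_hom rpt_pr_hom])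
  have h_gen: "h (rp_gen R (Some a)) = ?s a" for a
    by (simp add: h_def rpt_sym_pr rp_sym_def)
  have h_rel: "h f = \<zero>\<^bsub>RPt R\<^esub>" if "f \<in> rp_rels R" for f
    using rp_pr_rel[OF that] mod_hom_zero[OF rpt_pr_hom ab] by (simp add: h_def)
  have s_one: "?s \<one> = \<zero>\<^bsub>RPt R\<^esub>"
    using h_rel[of "rp_gen R (Some \<one>)"] by (simp add: h_gen rp_rels_def)
  have five0: "five ?s x p y q = \<zero>\<^bsub>RPt R\<^esub>"
    if U: "x \<in> Units R" "p \<in> Units R" "x \<oplus> p = \<one>" "y \<in> Units R" "q \<in> Units R" "y \<oplus> q = \<one>" for x p y q
  proof (cases "order R = 3")
    case True
    \<comment> \<open>Over three elements the five-term relation is not imposed, but its first two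
      terms cancel and the other arguments are 1.\<close>
    have "x = ?n" "p = ?n" "y = ?n" "q = ?n"
      using order_3[OF True] compl_neq_one U a_comm Units_closed by metis+
    then show ?thesis
      by (simp add: five_def s_one N.M.minus_eq N.M.r_neg)
  next
    case False
    have ne: "x \<noteq> \<one>" "y \<noteq> \<one>"
      using compl_neq_one[OF U(1-3)] compl_neq_one[OF U(4-6)] .
    then have "five_term R x y \<in> {five_term R x y | x y. x \<in> Units R - {\<one>} \<and> y \<in> Units R - {\<one>}}"
      using U by blast
    then have "five_term R x y \<in> rp_rels R"
      using False order_gt_2[OF U(1) ne(1)] unfolding rp_rels_def by simp
    then show ?thesis
      using rp_gen_hom_five_term[OF N.module_axioms h U] h_rel by (simp add: h_gen)
  qed
  have const_closed: "?c \<in> carrier (RPt R)"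
    unfolding rpt_const_pr by (rule mod_hom_closed[OF rpt_pr_hom rp_const_closed])
  have compl: "?s x \<oplus>\<^bsub>RPt R\<^esub> act ?n (?s p) = ?c"
    if U: "x \<in> Units R" "p \<in> Units R" "x \<oplus> p = \<one>" for x p
  proof (cases "order R = 3")
    case True
    have "x = ?n" "p = ?n"
      using order_3[OF True] compl_neq_one U a_comm Units_closed by metis+
    \<comment> \<open>As -1 is its own inverse, the left side is the image of \<open>psi1\<close> at
      -1, and so is the constant; both are zero.\<close>
    moreover have "inv ?n = ?n" by (rule comm_inv_char) (simp_all add: nn)
    moreover have "?c = rpt_pr (psi1 R ?n)" using True by (simp add: rpt_const_pr rp_const_def)
    ultimately show ?thesis using psi[of ?n] rpt_pr_psi1[of ?n] by simp
  next
    case False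
    have o2: "order R \<noteq> 2" using order_gt_2 compl_neq_one U by blast
    obtain y where y': "y \<in> Units R" "y \<noteq> \<one>" and
      c: "rp_const R = rp_sym R y \<oplus>\<^bsub>RP R\<^esub> \<langle>?n\<rangle> \<odot>\<^bsub>RP R\<^esub> rp_sym R (\<one> \<ominus> y)
       \<oplus>\<^bsub>RP R\<^esub> pfister_elt R (\<one> \<ominus> y) \<odot>\<^bsub>RP R\<^esub> psi1 R y"
      using rp_const_generic[OF o2 False] by metis
    then have y: "y \<in> Units R" "\<one> \<ominus> y \<in> Units R" "y \<oplus> (\<one> \<ominus> y) = \<one>" using one_minus by auto
    have pf: "pfister_elt R (\<one> \<ominus> y) \<in> carrier (RF R)"
      using y by (simp add: pfister_closed)
    have "?c = ?s y \<oplus>\<^bsub>RPt R\<^esub> act ?n (?s (\<one> \<ominus> y)) \<oplus>\<^bsub>RPt R\<^esub> pfister_elt R (\<one> \<ominus> y) \<odot>\<^bsub>RPt R\<^esub> rpt_pr (psi1 R y)"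
      unfolding rpt_const_pr c using pf y
      by (simp add: mod_hom_add[OF rpt_pr_hom] mod_hom_smult[OF rpt_pr_hom]
          rp_sym_closed psi1_closed act_def rpt_sym_pr)
    then have c: "?c = ?s y \<oplus>\<^bsub>RPt R\<^esub> act ?n (?s (\<one> \<ominus> y))"
      using y pf by (simp add: rpt_pr_psi1)
    have px: "p \<oplus> x = \<one>" and qy: "(\<one> \<ominus> y) \<oplus> y = \<one>"
      using U y a_comm Units_closed by metis+
    \<comment> \<open>This is the independence of the point \<open>y\<close> chosen in
      \<open>rp_const\<close>: both five-term expressions in \<open>five_compl\<close>
      vanish.\<close>
    have "(?s x \<oplus>\<^bsub>RPt R\<^esub> act ?n (?s p)) \<ominus>\<^bsub>RPt R\<^esub> ?c = \<zero>\<^bsub>RPt R\<^esub>"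
      unfolding c using five_compl[of x p y "\<one> \<ominus> y"] U y five0[OF U y] five0[OF U(2,1) px y(2,1) qy] by simp
    then show ?thesis
      by (subst (asm) N.M.diff_eq_iff(1)) (use U const_closed in simp_all)
  qed
  interpret complement_symbol R "RPt R" ?s ?c
    by unfold_locales (use const_closed compl in auto)
  have ex: "\<exists>x p. x \<in> Units R \<and> p \<in> Units R \<and> x \<oplus> p = \<one>" if "order R \<noteq> 2"
    using order_neq_2[OF that] one_minus by blast
  show ?thesis
  proof unfold_locales
    show "act ?n ?c = ?c"
    proof (cases "order R = 2")
      case True
      have "?n = \<one>" using order_gt_2[of ?n] True by auto
      then show ?thesis by simp
    next
      case False
      then show ?thesis using ex act_n_c by blast
    qed
    show "?c \<oplus>\<^bsub>RPt R\<^esub> ?c \<oplus>\<^bsub>RPt R\<^esub> ?c = \<zero>\<^bsub>RPt R\<^esub>"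
    proof (cases "order R = 2")
      case True
      have "[(3::nat)] \<cdot>\<^bsub>rp_free R\<^esub> rp_gen R None \<in> rp_rels R" using True by (simp add: rp_rels_def)
      moreover have "[(3::nat)] \<cdot>\<^bsub>rp_free R\<^esub> g = g \<oplus>\<^bsub>rp_free R\<^esub> g \<oplus>\<^bsub>rp_free R\<^esub> g"
        if "g \<in> carrier (rp_free R)" for g
        using that by (simp add: numeral_3_eq_3 del: free_module_sel)
      moreover have "?c = h (rp_gen R None)" using True by (simp add: rpt_const_pr rp_const_def h_def)
      ultimately show ?thesis
        using h_rel[of "[(3::nat)] \<cdot>\<^bsub>rp_free R\<^esub> rp_gen R None"]
        by (simp add: mod_hom_add[OF h] rp_gen_closed del: free_module_sel)
    next
      case False
      then show ?thesis using ex c3 by blast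
    qed
    show "?s \<one> = \<zero>\<^bsub>RPt R\<^esub>" by (rule s_one)
    fix x p assume U: "x \<in> Units R" "p \<in> Units R" "x \<oplus> p = \<one>"
    show "?s x \<ominus>\<^bsub>RPt R\<^esub> act (?n \<otimes> x) (?s x) = act p ?c \<ominus>\<^bsub>RPt R\<^esub> act (x \<otimes> p) ?c"
    proof (cases "order R = 3")
      case True
      have x: "x = ?n" and p: "p = ?n"
        using order_3[OF True] compl_neq_one U a_comm Units_closed by metis+
      have c: "?c = \<zero>\<^bsub>RPt R\<^esub>" using True rpt_pr_psi1[of ?n] by (simp add: rpt_const_pr rp_const_def)
      \<comment> \<open>On the left (-1)(-1) = 1 acts trivially, so the two terms cancel; on the
        right the constant is zero.\<close>
      show ?thesis unfolding x p c by (simp add: nn N.M.minus_eq N.M.r_neg)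
    next
      case False
      \<comment> \<open>The second five-term relation, at \<open>(1/x, y/x)\<close>, requires
        \<open>y/x\<close> to be a unit other than 1. Hence \<open>y\<close> must avoid 0, 1 and
        \<open>x\<close>, which is possible beyond three elements.\<close>
      have "carrier R \<noteq> {\<zero>, \<one>, x}"
      proof
        assume "carrier R = {\<zero>, \<one>, x}"
        then have "order R = 3" using U compl_neq_one[OF U] by (auto simp: order_def field_Units)
        then show False using False by simp
      qed
      then obtain y where y: "y \<in> carrier R" "y \<noteq> \<zero>" "y \<noteq> \<one>" "y \<noteq> x"
        using U Units_closed by auto
      then have yU: "y \<in> Units R" by (simp add: field_Units)
      define d where "d = x \<ominus> y"
      have xyd: "x = y \<oplus> d" using U y by (simp add: d_def minus_eq a_lcomm r_neg Units_closed)
      have dc: "d \<in> carrier R" using U y by (simp add: d_def Units_closed)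
      have d0: "d \<noteq> \<zero>" using xyd y by auto
      have d: "d \<in> Units R" using dc d0 by (simp add: field_Units)
      have px: "p \<oplus> x = \<one>" using U a_comm Units_closed by metis
      show ?thesis
      proof (rule neg_act_symbol[OF U yU one_minus[OF yU y(3)] d xyd])
        show "five ?s x p y (\<one> \<ominus> y) = \<zero>\<^bsub>RPt R\<^esub>" by (rule five0[OF U yU one_minus[OF yU y(3)]])
        show "five ?s (inv x) (?n \<otimes> p \<oslash> x) (y \<oslash> x) (d \<oslash> x) = \<zero>\<^bsub>RPt R\<^esub>"
        proof (rule five0)
          show "inv x \<oplus> ?n \<otimes> p \<oslash> x = \<one>" by (rule compl_inv[OF U(2,1) px])
          have "y \<oslash> x \<oplus> d \<oslash> x = x \<oslash> x" using U yU d xyd by (simp add: fdiv_add Units_closed)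
          then show "y \<oslash> x \<oplus> d \<oslash> x = \<one>" using U by simp
        qed (use U yU d in simp_all)
      qed
    qed
  qed (use five0 in auto)
qed

text \<open>Over two elements the constant is itself a generator, so it has to be supplied in
  addition to the symbols.\<close>

lemma RPt_spanned:
  assumes H: "submodule H (RF R) (RPt R)" and sym: "\<And>a. a \<in> Units R \<Longrightarrow> rpt_sym R a \<in> H"
    and const: "order R = 2 \<Longrightarrow> rpt_const R \<in> H"
  shows "H = carrier (RPt R)"
proof -
  define h where "h f = rpt_pr (rp_relmod R +>\<^bsub>rp_free R\<^esub> f)" for f
  have h: "h \<in> mod_hom (RF R) (rp_free R) (RPt R)"
    unfolding h_def[abs_def] by (rule mod_hom_comp[OF rp_pr_hom rpt_pr_hom])
  have "{f \<in> carrier (rp_free R). h f \<in> H} = carrier (rp_free R)"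
  proof (rule cring.free_module_spanned[OF RF_cring submodule_vimage[OF rp_free_module RPt_module h H]])
    fix x assume "x \<in> rp_gens R"
    then have "h (rp_gen R x) \<in> H"
      using sym const by (auto simp: rp_gens_def h_def rpt_sym_pr rp_sym_def rpt_const_pr rp_const_def split: if_splits)
    then show "rp_gen R x \<in> {f \<in> carrier (rp_free R). h f \<in> H}"
      using rp_gen_closed by simp
  qed
  note all = this
  have 1: "h ` carrier (rp_free R) \<subseteq> H"
  proof (rule image_subsetI)
    fix f assume "f \<in> carrier (rp_free R)"
    then have "f \<in> {f \<in> carrier (rp_free R). h f \<in> H}" by (simp only: all)
    then show "h f \<in> H" by (simp only: mem_Collect_eq)
  qed
  have "carrier (RPt R) = rpt_pr ` carrier (RP R)"
    unfolding RPt_def rpt_pr_def by (rule submod.carrier_Q[OF K1_submod])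
  also have "carrier (RP R) = (\<lambda>f. rp_relmod R +>\<^bsub>rp_free R\<^esub> f) ` carrier (rp_free R)"
    unfolding RP_def by (rule submod.carrier_Q[OF rp_submod])
  finally have "carrier (RPt R) = h ` carrier (rp_free R)" by (simp only: h_def[abs_def] image_image)
  with 1 show ?thesis using module.submoduleE(1)[OF RPt_module H] by simp
qed

text \<open>The hypotheses cover the three presentations at once. \<open>rel3\<close> asks that
  \<open>[-1] + <-1>[-1]\<close> itself be killed, from which the doubled relation over three
  elements follows; any target satisfying the inversion identity provides this.\<close>

lemma RP_lift:
  assumes N: "module (RF R) N" and \<phi>: "\<And>x. x \<in> rp_gens R \<Longrightarrow> \<phi> x \<in> carrier N"
    and one: "\<phi> (Some \<one>) = \<zero>\<^bsub>N\<^esub>"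
    and rel2: "order R = 2 \<Longrightarrow> \<phi> None \<oplus>\<^bsub>N\<^esub> \<phi> None \<oplus>\<^bsub>N\<^esub> \<phi> None = \<zero>\<^bsub>N\<^esub>"
    and rel3: "order R = 3 \<Longrightarrow> \<phi> (Some (\<ominus> \<one>)) \<oplus>\<^bsub>N\<^esub> \<langle>\<ominus> \<one>\<rangle> \<odot>\<^bsub>N\<^esub> \<phi> (Some (\<ominus> \<one>)) = \<zero>\<^bsub>N\<^esub>"
    and five: "\<And>x p y q. \<lbrakk>x \<in> Units R; p \<in> Units R; x \<oplus> p = \<one>; y \<in> Units R; q \<in> Units R; y \<oplus> q = \<one>\<rbrakk>
      \<Longrightarrow> sq_module.five R N (\<lambda>a. \<phi> (Some a)) x p y q = \<zero>\<^bsub>N\<^esub>"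
  obtains S where "S \<in> mod_hom (RF R) (RP R) N" "\<And>a. a \<in> Units R \<Longrightarrow> S (rp_sym R a) = \<phi> (Some a)"
    "order R = 2 \<Longrightarrow> S (rp_const R) = \<phi> None"
proof -
  interpret N: module "RF R" N by fact
  interpret FM: module "RF R" "rp_free R" by (rule rp_free_module)
  interpret sq_module R N by unfold_locales
  note ab = FM.abelian_group_axioms N.abelian_group_axioms
  obtain h where h: "h \<in> mod_hom (RF R) (rp_free R) N" and h_gen: "\<And>x. x \<in> rp_gens R \<Longrightarrow> h (rp_gen R x) = \<phi> x"
    using cring.free_module_lift[OF RF_cring N, of "rp_gens R" \<phi>] \<phi> by auto
  have Some_gens: "Some a \<in> rp_gens R" if "a \<in> Units R" for a
    using that by (simp add: rp_gens_def)
  have h_Some: "h (rp_gen R (Some a)) = \<phi> (Some a)" if "a \<in> Units R" for a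
    by (rule h_gen[OF Some_gens[OF that]])
  have ker: "submodule {f \<in> carrier (rp_free R). h f = \<zero>\<^bsub>N\<^esub>} (RF R) (rp_free R)"
    by (rule mod_hom_kernel_submodule[OF rp_free_module N h])
  have "h f = \<zero>\<^bsub>N\<^esub>" if f: "f \<in> rp_rels R" for f
  proof -
    consider "f = rp_gen R (Some \<one>)" | "order R = 2" "f = [(3::nat)] \<cdot>\<^bsub>rp_free R\<^esub> rp_gen R None"
      | "order R = 3" "f = [(2::nat)] \<cdot>\<^bsub>rp_free R\<^esub> (rp_gen R (Some (\<ominus> \<one>))
           \<oplus>\<^bsub>rp_free R\<^esub> \<langle>\<ominus> \<one>\<rangle> \<odot>\<^bsub>rp_free R\<^esub> rp_gen R (Some (\<ominus> \<one>)))"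
      | x y where "f = five_term R x y" "x \<in> Units R - {\<one>}" "y \<in> Units R - {\<one>}"
      using f unfolding rp_rels_def by (auto split: if_splits simp del: free_module_sel)
    then show ?thesis
    proof cases
      case 1 then show ?thesis using h_Some[of \<one>] one by simp
    next
      case 2
      have "None \<in> rp_gens R" using 2 by (simp add: rp_gens_def)
      moreover have "[(3::nat)] \<cdot>\<^bsub>rp_free R\<^esub> g = g \<oplus>\<^bsub>rp_free R\<^esub> g \<oplus>\<^bsub>rp_free R\<^esub> g"
        if "g \<in> carrier (rp_free R)" for g
        using that by (simp add: numeral_3_eq_3 del: free_module_sel)
      ultimately show ?thesis
        using 2 rel2 h_gen[of None]
        by (simp add: mod_hom_add[OF h] rp_gen_closed del: free_module_sel)
    next
      case 3
      have "[(2::nat)] \<cdot>\<^bsub>rp_free R\<^esub> g = g \<oplus>\<^bsub>rp_free R\<^esub> g"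
        if "g \<in> carrier (rp_free R)" for g
        using that by (simp add: numeral_2_eq_2 del: free_module_sel)
      then show ?thesis
        using 3 rel3 h_Some[of "\<ominus> \<one>"]
        by (simp add: mod_hom_add[OF h] mod_hom_smult[OF h] rp_gen_closed del: free_module_sel)
    next
      case (4 x y)
      then have U: "x \<in> Units R" "\<one> \<ominus> x \<in> Units R" "x \<oplus> (\<one> \<ominus> x) = \<one>"
        "y \<in> Units R" "\<one> \<ominus> y \<in> Units R" "y \<oplus> (\<one> \<ominus> y) = \<one>"
        using one_minus by auto
      have "h f = sq_module.five R N (\<lambda>a. h (rp_gen R (Some a))) x (\<one> \<ominus> x) y (\<one> \<ominus> y)"
        using rp_gen_hom_five_term[OF N h U] 4 by simp
      also have "\<dots> = sq_module.five R N (\<lambda>a. \<phi> (Some a)) x (\<one> \<ominus> x) y (\<one> \<ominus> y)"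
        using U by (simp add: five_def h_Some)
      finally show ?thesis using five[OF U] by simp
    qed
  qed
  then have "rp_rels R \<subseteq> {f \<in> carrier (rp_free R). h f = \<zero>\<^bsub>N\<^esub>}"
    using rp_rels_closed by blast
  then have rel0: "h f = \<zero>\<^bsub>N\<^esub>" if "f \<in> rp_relmod R" for f
    using FM.gen_submodule_least[OF ker] that by blast
  obtain S where S: "S \<in> mod_hom (RF R) (RP R) N"
    "\<And>f. f \<in> carrier (rp_free R) \<Longrightarrow> S (rp_relmod R +>\<^bsub>rp_free R\<^esub> f) = h f"
    using submod.quot_lift[OF rp_submod N h rel0] unfolding RP_def by metis
  show ?thesis
  proof (rule that[OF S(1)])
    show "S (rp_sym R a) = \<phi> (Some a)" if "a \<in> Units R" for a
      using S(2)[OF rp_gen_closed] h_Some[OF that] by (simp add: rp_sym_def)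
    show "S (rp_const R) = \<phi> None" if "order R = 2"
      using S(2)[OF rp_gen_closed] h_gen[of None] that by (simp add: rp_const_def rp_gens_def)
  qed
qed

end

section \<open>Valued fields\<close>

locale valued_field = field F for F :: "('a, 'm) ring_scheme" (structure) +
  fixes v :: "'a \<Rightarrow> 'g::linordered_ab_group_add"
  assumes val: "valuation F v"
begin

abbreviation "V \<equiv> val_ring F v"
abbreviation "\<mm> \<equiv> val_ideal F v"
abbreviation "k \<equiv> res_field F v"
abbreviation "red \<equiv> reduction F v"

lemma v_mult [simp]: "\<lbrakk>a \<in> Units F; b \<in> Units F\<rbrakk> \<Longrightarrow> v (a \<otimes> b) = v a + v b"
  using val by (simp add: valuation_def)

lemma v_one [simp]: "v \<one> = 0"
  using v_mult[of \<one> \<one>] by simp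

lemma v_inv [simp]: "a \<in> Units F \<Longrightarrow> v (inv a) = - v a"
  using v_mult[of a "inv a"] by (simp add: eq_neg_iff_add_eq_0 add.commute)

lemma v_fdiv [simp]: "\<lbrakk>a \<in> Units F; b \<in> Units F\<rbrakk> \<Longrightarrow> v (a \<oslash> b) = v a - v b"
  by (simp add: fdiv_def)

lemma v_minus_one [simp]: "v (\<ominus> \<one>) = 0"
proof -
  have "(\<ominus> \<one>) \<otimes> (\<ominus> \<one>) = \<one>" by (simp add: l_minus r_minus)
  then have "v (\<ominus> \<one>) + v (\<ominus> \<one>) = 0"
    using v_mult[of "\<ominus> \<one>" "\<ominus> \<one>"] by (simp del: v_mult)
  then show ?thesis by simp
qed

lemma v_minus [simp]: "a \<in> Units F \<Longrightarrow> v (\<ominus> a) = v a"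
  using v_mult[of "\<ominus> \<one>" a] by (simp add: l_minus Units_closed)

lemma v_add: "\<lbrakk>a \<in> Units F; b \<in> Units F; a \<oplus> b \<in> Units F\<rbrakk> \<Longrightarrow> min (v a) (v b) \<le> v (a \<oplus> b)"
  using val by (simp add: valuation_def)

text \<open>Since \<open>a = (a + b) - b\<close>, the minimum of \<open>v (a + b)\<close> and
  \<open>v b\<close> is at most \<open>v a\<close>, and \<open>v b\<close> is too large to be that
  minimum.\<close>

lemma v_add_less:
  assumes "a \<in> Units F" "b \<in> Units F" "a \<oplus> b \<in> Units F" "v a < v b"
  shows "v (a \<oplus> b) = v a"
proof (rule antisym)
  show "v a \<le> v (a \<oplus> b)" using v_add[OF assms(1-3)] assms(4) by simp
  have a: "(a \<oplus> b) \<oplus> (\<ominus> b) = a" using assms by (simp add: a_assoc r_neg Units_closed)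
  have "min (v (a \<oplus> b)) (v b) \<le> v a"
    using v_add[of "a \<oplus> b" "\<ominus> b"] assms unfolding a by simp
  then show "v (a \<oplus> b) \<le> v a" using assms(4) by (auto simp: min_le_iff_disj)
qed

lemma v_add_one:
  assumes "x \<in> Units F" "p \<in> Units F" "x \<oplus> p = \<one>" "0 < v x"
  shows "v p = 0"
proof -
  have p: "p = \<one> \<oplus> (\<ominus> x)"
    using compl_eq[of x p] assms by (simp add: Units_closed minus_eq)
  show ?thesis using v_add_less[of \<one> "\<ominus> x"] assms p by simp
qed

lemma v_add_one_neg:
  assumes "x \<in> Units F" "p \<in> Units F" "x \<oplus> p = \<one>" "v x < 0"
  shows "v p = v x"
proof -
  have p: "p = (\<ominus> x) \<oplus> \<one>"
    using compl_eq[of x p] assms by (simp add: Units_closed minus_eq a_comm)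
  show ?thesis using v_add_less[of "\<ominus> x" \<one>] assms p by simp
qed

lemma carrier_V: "carrier V = insert \<zero> {a \<in> Units F. 0 \<le> v a}"
  and ops_V [simp]: "\<zero>\<^bsub>V\<^esub> = \<zero>" "\<one>\<^bsub>V\<^esub> = \<one>" "a \<oplus>\<^bsub>V\<^esub> b = a \<oplus> b" "a \<otimes>\<^bsub>V\<^esub> b = a \<otimes> b"
  by (simp_all add: val_ring_def)

lemma V_closed: "a \<in> carrier V \<Longrightarrow> a \<in> carrier F"
  by (auto simp: carrier_V Units_closed)

lemma Units_iff: "a \<in> Units F \<longleftrightarrow> a \<in> carrier F \<and> a \<noteq> \<zero>"
  by (auto simp: field_Units)

lemma V_minus: "a \<in> carrier V \<Longrightarrow> \<ominus> a \<in> carrier V"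
  by (auto simp: carrier_V)

lemma m_minus: "a \<in> \<mm> \<Longrightarrow> \<ominus> a \<in> \<mm>"
  by (auto simp: val_ideal_def)

lemma V_add: "\<lbrakk>a \<in> carrier V; b \<in> carrier V\<rbrakk> \<Longrightarrow> a \<oplus> b \<in> carrier V"
  using v_add[of a b] by (auto simp: carrier_V Units_closed Units_iff min_le_iff_disj)

lemma m_add: "\<lbrakk>a \<in> \<mm>; b \<in> \<mm>\<rbrakk> \<Longrightarrow> a \<oplus> b \<in> \<mm>"
  using v_add[of a b] by (auto simp: val_ideal_def Units_closed Units_iff min_le_iff_disj)

lemma V_mult: "\<lbrakk>a \<in> carrier V; b \<in> carrier V\<rbrakk> \<Longrightarrow> a \<otimes> b \<in> carrier V"
  by (auto simp: carrier_V Units_closed)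

lemma m_mult: "\<lbrakk>a \<in> \<mm>; b \<in> carrier V\<rbrakk> \<Longrightarrow> a \<otimes> b \<in> \<mm>"
  by (auto simp: carrier_V val_ideal_def Units_closed add_pos_nonneg)

lemma V_cring: "cring V"
proof -
  have zo: "\<zero> \<in> carrier V" "\<one> \<in> carrier V" by (simp_all add: carrier_V)
  show ?thesis
  proof (rule cringI)
    show "abelian_group V"
    proof (rule abelian_groupI)
      show "\<exists>b\<in>carrier V. b \<oplus>\<^bsub>V\<^esub> a = \<zero>\<^bsub>V\<^esub>" if "a \<in> carrier V" for a
        using that V_minus V_closed by (intro bexI[of _ "\<ominus> a"]) (simp_all add: l_neg)
    qed (use zo V_add V_closed in \<open>simp_all add: a_ac\<close>)
    show "comm_monoid V"
      by (rule comm_monoidI) (use zo V_mult V_closed in \<open>simp_all add: m_ac\<close>)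
  qed (use V_closed in \<open>simp add: l_distr\<close>)
qed

lemma m_subset: "\<mm> \<subseteq> carrier V"
  by (auto simp: carrier_V val_ideal_def)

lemma m_ideal: "ideal \<mm> V"
proof -
  interpret V: cring V by (rule V_cring)
  have minus: "\<ominus>\<^bsub>V\<^esub> a = \<ominus> a" if "a \<in> carrier V" for a
    using that V_minus V_closed by (intro V.minus_equality) (auto simp: l_neg)
  show ?thesis
  proof (rule idealI[OF V.ring_axioms])
    show "subgroup \<mm> (add_monoid V)"
    proof (rule V.add.subgroupI)
      show "\<mm> \<noteq> {}" by (simp add: val_ideal_def)
      show "\<ominus>\<^bsub>V\<^esub> a \<in> \<mm>" if "a \<in> \<mm>" for a
        using that m_minus m_subset minus by auto
    qed (use m_subset m_add in auto)
    fix a x assume a: "a \<in> \<mm>" and x: "x \<in> carrier V"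
    show "a \<otimes>\<^bsub>V\<^esub> x \<in> \<mm>" using m_mult[OF a x] by simp
    then show "x \<otimes>\<^bsub>V\<^esub> a \<in> \<mm>" using V.m_comm[OF x] a m_subset by auto
  qed
qed

lemma red_def: "red a = \<mm> +>\<^bsub>V\<^esub> a"
  by (simp add: reduction_def)

lemma k_cring: "cring k"
  unfolding res_field_def by (rule ideal.quotient_is_cring[OF m_ideal V_cring])

lemma red_hom: "red \<in> ring_hom V k"
  unfolding res_field_def reduction_def[abs_def] using ideal.rcos_ring_hom[OF m_ideal] .

lemma carrier_k: "carrier k = red ` carrier V"
  by (auto simp: res_field_def FactRing_def A_RCOSETS_def' reduction_def)

lemma red_closed: "a \<in> carrier V \<Longrightarrow> red a \<in> carrier k"
  by (simp add: carrier_k)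

lemma red_mult: "\<lbrakk>a \<in> carrier V; b \<in> carrier V\<rbrakk> \<Longrightarrow> red (a \<otimes> b) = red a \<otimes>\<^bsub>k\<^esub> red b"
  using ring_hom_mult[OF red_hom, of a b] by simp

lemma red_add: "\<lbrakk>a \<in> carrier V; b \<in> carrier V\<rbrakk> \<Longrightarrow> red (a \<oplus> b) = red a \<oplus>\<^bsub>k\<^esub> red b"
  using ring_hom_add[OF red_hom, of a b] by simp

lemma red_one: "red \<one> = \<one>\<^bsub>k\<^esub>"
  using ring_hom_one[OF red_hom] by simp

lemma red_zero_iff:
  assumes "a \<in> carrier V"
  shows "red a = \<zero>\<^bsub>k\<^esub> \<longleftrightarrow> a \<in> \<mm>"
proof -
  interpret V: cring V by (rule V_cring)
  interpret I: ideal \<mm> V by (rule m_ideal)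
  have z: "\<zero>\<^bsub>k\<^esub> = \<mm>" by (simp add: res_field_def FactRing_def)
  show ?thesis
    unfolding z red_def
    using V.a_coset_join1[OF _ assms I.a_subgroup] V.a_coset_join2[OF assms I.a_subgroup] by blast
qed

lemma unit_V: "\<lbrakk>u \<in> Units F; v u = 0\<rbrakk> \<Longrightarrow> u \<in> carrier V"
  by (simp add: carrier_V)

text \<open>An element of the valuation ring outside the ideal has value 0, so its inverse lies in
  the valuation ring too.\<close>

lemma k_field: "field k"
proof (rule cring.cring_fieldI2[OF k_cring])
  have "\<one> \<in> carrier V" by (rule unit_V) simp_all
  moreover have "\<one> \<notin> \<mm>" by (simp add: val_ideal_def)
  ultimately show "\<zero>\<^bsub>k\<^esub> \<noteq> \<one>\<^bsub>k\<^esub>" using red_zero_iff red_one by metis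
  fix X assume X: "X \<in> carrier k" "X \<noteq> \<zero>\<^bsub>k\<^esub>"
  then obtain a where a: "a \<in> carrier V" "X = red a" by (auto simp: carrier_k)
  then have "a \<notin> \<mm>" using X red_zero_iff by blast
  then have u: "a \<in> Units F" "v a = 0" using a by (auto simp: carrier_V val_ideal_def)
  then have i: "inv a \<in> carrier V" by (intro unit_V) simp_all
  have "X \<otimes>\<^bsub>k\<^esub> red (inv a) = \<one>\<^bsub>k\<^esub>"
    using red_mult[OF a(1) i] u a by (simp add: red_one)
  then show "\<exists>Y\<in>carrier k. X \<otimes>\<^bsub>k\<^esub> Y = \<one>\<^bsub>k\<^esub>" using red_closed[OF i] by blast
qed

sublocale k: field k by (rule k_field)

lemma red_unit:
  assumes "u \<in> Units F" "v u = 0"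
  shows "red u \<in> Units k"
proof -
  have "u \<notin> \<mm>" using assms by (auto simp: val_ideal_def field_Units)
  then show ?thesis
    using assms red_zero_iff[OF unit_V] red_closed[OF unit_V] by (simp add: k.field_Units)
qed

lemma Units_k_red:
  assumes "X \<in> Units k"
  obtains u where "u \<in> Units F" "v u = 0" "X = red u"
proof -
  have "X \<in> carrier k" "X \<noteq> \<zero>\<^bsub>k\<^esub>" using assms by (auto simp: k.field_Units)
  then obtain a where a: "a \<in> carrier V" "X = red a" by (auto simp: carrier_k)
  then have "a \<notin> \<mm>" using \<open>X \<noteq> _\<close> red_zero_iff by blast
  then show ?thesis using a by (intro that[of a]) (auto simp: carrier_V val_ideal_def)
qed

lemma red_inv:
  assumes "u \<in> Units F" "v u = 0"
  shows "red (inv u) = inv\<^bsub>k\<^esub> red u"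
proof -
  have "red u \<otimes>\<^bsub>k\<^esub> red (inv u) = \<one>\<^bsub>k\<^esub>"
    using red_mult[of u "inv u"] unit_V assms by (simp add: red_one)
  then show ?thesis
    using k.comm_inv_char[of "red u" "red (inv u)"] red_unit assms by (simp add: k.Units_closed)
qed

lemma red_mult_unit:
  "\<lbrakk>u \<in> Units F; v u = 0; w \<in> Units F; v w = 0\<rbrakk> \<Longrightarrow> red (u \<otimes> w) = red u \<otimes>\<^bsub>k\<^esub> red w"
  by (rule red_mult) (auto intro: unit_V)

lemma red_fdiv:
  "\<lbrakk>u \<in> Units F; v u = 0; w \<in> Units F; v w = 0\<rbrakk> \<Longrightarrow> red (u \<oslash> w) = red u \<oslash>\<^bsub>k\<^esub> red w"
  by (simp add: fdiv_def red_mult_unit red_inv)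

lemma red_minus_one: "red (\<ominus> \<one>) = \<ominus>\<^bsub>k\<^esub> \<one>\<^bsub>k\<^esub>"
proof -
  have "red (\<ominus> \<one>) \<oplus>\<^bsub>k\<^esub> red \<one> = red \<zero>"
    by (subst red_add[symmetric]) (auto intro: unit_V simp: l_neg)
  also have "red \<zero> = \<zero>\<^bsub>k\<^esub>"
    by (subst red_zero_iff) (auto simp: carrier_V val_ideal_def)
  finally show ?thesis
    using k.minus_equality[of "red (\<ominus> \<one>)" "\<one>\<^bsub>k\<^esub>"] red_unit[of "\<ominus> \<one>"]
    by (simp add: red_one k.Units_closed)
qed

lemma red_compl:
  assumes "x \<in> Units F" "p \<in> Units F" "x \<oplus> p = \<one>" "0 < v x"
  shows "red p = \<one>\<^bsub>k\<^esub>"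
proof -
  have x: "x \<in> carrier V" "x \<in> \<mm>" using assms by (auto simp: carrier_V val_ideal_def)
  have p: "p \<in> carrier V" using assms v_add_one[OF assms] by (simp add: carrier_V)
  have "\<one>\<^bsub>k\<^esub> = red x \<oplus>\<^bsub>k\<^esub> red p" using red_add[OF x(1) p] assms red_one by simp
  then show ?thesis using red_zero_iff[OF x(1)] x(2) red_closed[OF p] by simp
qed

lemma red_add_one:
  assumes "x \<in> Units F" "p \<in> Units F" "x \<oplus> p = \<one>" "v x = 0" "v p = 0"
  shows "red x \<oplus>\<^bsub>k\<^esub> red p = \<one>\<^bsub>k\<^esub>"
  using red_add[OF unit_V[OF assms(1,4)] unit_V[OF assms(2,5)]] assms(3) red_one by simp

text \<open>For a trivial valuation the cosets of the ideal are singletons. In the proof of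
  surjectivity this forces \<open>F\<close> to have two elements when the residue field has two and
  no element has a nonzero value.\<close>

lemma order_res_field_trivial:
  assumes "\<And>a. a \<in> Units F \<Longrightarrow> v a = 0"
  shows "order k = order F"
proof -
  have V: "carrier V = carrier F" using assms by (auto simp: carrier_V Units_iff)
  have m: "\<mm> = {\<zero>}" using assms by (auto simp: val_ideal_def)
  have "red a = {a}" if "a \<in> carrier F" for a
    using that by (simp add: red_def m a_r_coset_def')
  then have "carrier k = (\<lambda>a. {a}) ` carrier F" unfolding carrier_k V by (intro image_cong) auto
  then show ?thesis by (simp add: order_def card_image)
qed

section \<open>Square classes of valuation units and the induced module\<close>

lemma val_units_comm_group: "comm_group (val_units F v)"
proof -
  interpret U: comm_group "units_of F" by (rule units_comm_group)
  have "subgroup {a \<in> Units F. v a = 0} (units_of F)"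
  proof (rule U.subgroupI)
    show "{a \<in> Units F. v a = 0} \<noteq> {}" using v_one by blast
  qed (auto simp: units_of_carrier units_of_mult units_of_inv)
  then have "group (val_units F v)"
    unfolding val_units_def by (rule U.subgroup_imp_group)
  then show ?thesis
    by (rule group.group_comm_groupI) (auto simp: val_units_def units_of_mult m_comm Units_closed)
qed

lemma val_units_sel:
  "carrier (val_units F v) = {a \<in> Units F. v a = 0}" "a \<otimes>\<^bsub>val_units F v\<^esub> b = a \<otimes> b"
  by (simp_all add: val_units_def units_of_def)

lemma incl_hom: "(\<lambda>u. u) \<in> hom (val_units F v) (units_of F)"
  by (auto simp: hom_def val_units_sel units_of_carrier units_of_mult)

lemma red_units_hom: "red \<in> hom (val_units F v) (units_of k)"
  by (auto simp: hom_def val_units_sel units_of_carrier units_of_mult red_unit red_mult_unit)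

lemma scalar_extension_RPt:
  "scalar_extension (RU F v) (RU_incl F) (RF F) (restrict_scalars (RU_red F v) (RPt k))"
proof -
  interpret N: module "RF k" "RPt k" by (rule k.RPt_module)
  have red: "RU_red F v a \<in> carrier (RF k)" if "a \<in> carrier (RU F v)" for a
    using that sq_map_closed[OF val_units_comm_group k.units_comm_group red_units_hom]
    unfolding RU_red_def RU_def RF_def by (intro group_ring_map_closed)
  show ?thesis
  proof (intro scalar_extension.intro RF_cring scalar_extension_axioms.intro)
    show "RU_incl F a \<in> carrier (RF F)" if "a \<in> carrier (RU F v)" for a
      using that sq_map_closed[OF val_units_comm_group units_comm_group incl_hom]
      unfolding RU_incl_def RU_def RF_def by (intro group_ring_map_closed)
  qed (use red in \<open>auto simp: restrict_scalars_def\<close>)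
qed

definition \<iota> where "\<iota> m = ind_tensor F v (RPt k) \<one>\<^bsub>RF F\<^esub> m"

lemma Ind_module: "module (RF F) (Ind F v (RPt k))"
  unfolding Ind_def by (rule scalar_extension.E_module[OF scalar_extension_RPt])

lemma \<iota>_closed: "m \<in> carrier (RPt k) \<Longrightarrow> \<iota> m \<in> carrier (Ind F v (RPt k))"
  unfolding \<iota>_def Ind_def ind_tensor_def
  by (rule scalar_extension.tens_closed[OF scalar_extension_RPt])
    (simp_all add: restrict_scalars_def cring.cring_simprules(6)[OF RF_cring])

lemma \<iota>_add:
  assumes "m \<in> carrier (RPt k)" "m' \<in> carrier (RPt k)"
  shows "\<iota> (m \<oplus>\<^bsub>RPt k\<^esub> m') = \<iota> m \<oplus>\<^bsub>Ind F v (RPt k)\<^esub> \<iota> m'"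
  using scalar_extension.tens_add_right[OF scalar_extension_RPt, of "\<one>\<^bsub>RF F\<^esub>" m m'] assms
  by (simp add: \<iota>_def Ind_def ind_tensor_def restrict_scalars_def cring.cring_simprules(6)[OF RF_cring])

text \<open>This is balancedness: the scalar <u> comes from the square class of \<open>u\<close>
  among the valuation units, so it may cross the tensor sign, where it acts through
  reduction.\<close>

lemma \<iota>_unit:
  assumes u: "u \<in> Units F" "v u = 0" and m: "m \<in> carrier (RPt k)"
  shows "\<langle>u\<rangle> \<odot>\<^bsub>Ind F v (RPt k)\<^esub> \<iota> m = \<iota> (\<langle>red u\<rangle>\<^bsub>k\<^esub> \<odot>\<^bsub>RPt k\<^esub> m)"
proof -
  interpret T: scalar_extension "RU F v" "RU_incl F" "RF F" "restrict_scalars (RU_red F v) (RPt k)"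
    by (rule scalar_extension_RPt)
  define a where "a = frag_of (sq_class (val_units F v) u)"
  have uU: "u \<in> carrier (val_units F v)" using u by (simp add: val_units_sel)
  have a: "a \<in> carrier (RU F v)"
    using uU by (simp add: a_def RU_def comm_group.sq_group_carrier[OF val_units_comm_group])
  have ia: "RU_incl F a = \<langle>u\<rangle>"
    using sq_map_class[OF val_units_comm_group units_comm_group incl_hom uU]
    by (simp add: RU_incl_def a_def sq_elt_def)
  have ra: "RU_red F v a = \<langle>red u\<rangle>\<^bsub>k\<^esub>"
    using sq_map_class[OF val_units_comm_group k.units_comm_group red_units_hom uU]
    by (simp add: RU_red_def a_def sq_elt_def)
  have m': "m \<in> carrier (restrict_scalars (RU_red F v) (RPt k))"
    using m by (simp add: restrict_scalars_def)
  have "\<langle>u\<rangle> \<odot>\<^bsub>Ind F v (RPt k)\<^esub> \<iota> m = T.tens (\<one>\<^bsub>RF F\<^esub> \<otimes>\<^bsub>RF F\<^esub> RU_incl F a) m"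
    using T.tens_smult[OF _ T.B.one_closed m', of "\<langle>u\<rangle>"] u
    by (simp add: Ind_def \<iota>_def ind_tensor_def ia del: group_ring_sel)
  also have "\<dots> = \<iota> (\<langle>red u\<rangle>\<^bsub>k\<^esub> \<odot>\<^bsub>RPt k\<^esub> m)"
    using T.tens_balanced[OF T.B.one_closed a m']
    by (simp add: \<iota>_def ind_tensor_def ra restrict_scalars_def)
  finally show ?thesis .
qed

lemma Ind_spanned:
  assumes H: "submodule H (RF F) (Ind F v (RPt k))" and "\<And>m. m \<in> carrier (RPt k) \<Longrightarrow> \<iota> m \<in> H"
  shows "H = carrier (Ind F v (RPt k))"
  using scalar_extension.E_spanned[OF scalar_extension_RPt, of H] assms
  by (simp add: \<iota>_def Ind_def ind_tensor_def restrict_scalars_def)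

end

section \<open>The specialization map\<close>

context valued_field
begin

abbreviation "I \<equiv> Ind F v (RPt k)"

text \<open>The value before tensoring. As every prescribed image has the form
  \<open>1 \<otimes> \<sigma> a\<close>, a unit that reduces to 1 fixes all of them, whatever the
  value of \<open>a\<close>.\<close>

definition \<sigma> :: "'a \<Rightarrow> ('a set option \<Rightarrow> 'a set set \<Rightarrow>\<^sub>0 int) set set" where
  "\<sigma> a = (if v a = 0 then rpt_sym k (red a) else if 0 < v a then rpt_const k
     else \<ominus>\<^bsub>RPt k\<^esub> rpt_const k)"

abbreviation "spec a \<equiv> \<iota> (\<sigma> a)"
abbreviation "D \<equiv> \<iota> (rpt_const k)"

sublocale kN: bloch_symbol k "RPt k" "rpt_sym k" "rpt_const k"
  by (rule k.rpt_bloch_symbol)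

sublocale I: module "RF F" I by (rule Ind_module)

sublocale IF: sq_module F I by unfold_locales

lemma \<iota>_hom: "abelian_group_hom (RPt k) I \<iota>"
  by (intro abelian_group_homI group_hom.intro group_hom_axioms.intro
      kN.N.M.a_group I.M.a_group kN.N.M.abelian_group_axioms I.M.abelian_group_axioms)
    (auto simp: hom_def \<iota>_closed \<iota>_add)

lemma \<iota>_zero: "\<iota> \<zero>\<^bsub>RPt k\<^esub> = \<zero>\<^bsub>I\<^esub>"
  using abelian_group_hom.hom_zero[OF \<iota>_hom] .

lemma \<iota>_minus: "m \<in> carrier (RPt k) \<Longrightarrow> \<iota> (\<ominus>\<^bsub>RPt k\<^esub> m) = \<ominus>\<^bsub>I\<^esub> \<iota> m"
  using abelian_group_hom.hom_a_inv[OF \<iota>_hom] .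

lemma \<iota>_diff: "\<lbrakk>m \<in> carrier (RPt k); m' \<in> carrier (RPt k)\<rbrakk> \<Longrightarrow> \<iota> (m \<ominus>\<^bsub>RPt k\<^esub> m') = \<iota> m \<ominus>\<^bsub>I\<^esub> \<iota> m'"
  by (simp add: a_minus_def \<iota>_add \<iota>_minus)

lemma act_\<iota>: "\<lbrakk>u \<in> Units F; v u = 0; m \<in> carrier (RPt k)\<rbrakk> \<Longrightarrow> IF.act u (\<iota> m) = \<iota> (kN.act (red u) m)"
  by (simp add: IF.act_def kN.act_def \<iota>_unit)

lemma act_red_one:
  assumes "u \<in> Units F" "v u = 0" "red u = \<one>\<^bsub>k\<^esub>" "m \<in> carrier (RPt k)"
  shows "IF.act u (\<iota> m) = \<iota> m"
  using assms by (simp add: act_\<iota>)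

lemma \<sigma>_closed [simp]: "a \<in> Units F \<Longrightarrow> \<sigma> a \<in> carrier (RPt k)"
  by (simp add: \<sigma>_def red_unit)

lemma spec_closed [simp]: "a \<in> Units F \<Longrightarrow> spec a \<in> carrier I"
  by (simp add: \<iota>_closed)

lemma D_closed [simp]: "D \<in> carrier I"
  by (simp add: \<iota>_closed)

lemma spec_unit: "v a = 0 \<Longrightarrow> spec a = \<iota> (rpt_sym k (red a))"
  and spec_pos: "0 < v a \<Longrightarrow> spec a = D"
  and spec_neg: "v a < 0 \<Longrightarrow> spec a = \<ominus>\<^bsub>I\<^esub> D"
  by (auto simp: \<sigma>_def \<iota>_minus)

lemma act_n_D: "IF.act (\<ominus> \<one>) D = D"
  by (simp add: act_\<iota> red_minus_one kN.act_n_const)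

lemma three_D: "D \<oplus>\<^bsub>I\<^esub> D \<oplus>\<^bsub>I\<^esub> D = \<zero>\<^bsub>I\<^esub>"
  using arg_cong[OF kN.three_const, of \<iota>] by (simp add: \<iota>_add \<iota>_zero)

text \<open>The form in which \<open>3 D = 0\<close> enters the complement identity: if
  \<open>x\<close> has negative value, so does \<open>1 - x\<close>, and each contributes
  \<open>- D\<close>.\<close>

lemma neg_two_D: "(\<ominus>\<^bsub>I\<^esub> D) \<ominus>\<^bsub>I\<^esub> D = D"
  using three_D by (simp add: I.M.group_simps)

lemma spec_red_one:
  assumes "a \<in> Units F" "u \<in> Units F" "v u = 0" "red u = \<one>\<^bsub>k\<^esub>"
  shows "spec (a \<otimes> u) = spec a"
  using assms by (auto simp: \<sigma>_def red_mult_unit red_unit k.Units_closed)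

lemma spec_red_one': "\<lbrakk>u \<in> Units F; v u = 0; red u = \<one>\<^bsub>k\<^esub>\<rbrakk> \<Longrightarrow> spec u = \<zero>\<^bsub>I\<^esub>"
  by (simp add: spec_unit kN.s_one \<iota>_zero)

sublocale spec: complement_symbol F I spec D
proof unfold_locales
  fix a assume a: "a \<in> Units F"
  consider "v a = 0" | "0 < v a" | "v a < 0" by fastforce
  then show "spec (inv a) = \<ominus>\<^bsub>I\<^esub> IF.act (\<ominus> \<one>) (spec a)"
  proof cases
    case 1
    then show ?thesis
      using a by (simp add: spec_unit red_inv kN.s_inv red_unit \<iota>_minus act_\<iota> red_minus_one)
  next
    case 2
    then show ?thesis using a by (simp add: spec_pos spec_neg act_n_D)
  next
    case 3
    then show ?thesis using a by (simp add: spec_pos spec_neg IF.act_minus act_n_D)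
  qed
next
  fix x p assume U: "x \<in> Units F" "p \<in> Units F" "x \<oplus> p = \<one>"
  have px: "p \<oplus> x = \<one>" using U a_comm Units_closed by metis
  \<comment> \<open>If one of \<open>x\<close>, \<open>p\<close> has positive value, the other
    reduces to 1 and has symbol 0. If one has negative value, both do. In the last case the identity
    is inherited from the residue field.\<close>
  consider "0 < v x" | "0 < v p" | "v x < 0" | "v p < 0" | "v x = 0" "v p = 0" by fastforce
  then show "spec x \<oplus>\<^bsub>I\<^esub> IF.act (\<ominus> \<one>) (spec p) = D"
  proof cases
    case 1
    then show ?thesis
      using U spec_red_one'[OF U(2) v_add_one red_compl] by (simp add: spec_pos)
  next
    case 2
    then show ?thesis
      using U px spec_red_one'[OF U(1) v_add_one red_compl] by (simp add: spec_pos act_n_D)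
  next
    case 3
    then show ?thesis
      using U v_add_one_neg[OF U] neg_two_D by (simp add: spec_neg IF.act_minus act_n_D a_minus_def)
  next
    case 4
    then show ?thesis
      using U v_add_one_neg[OF U(2,1) px] neg_two_D by (simp add: spec_neg IF.act_minus act_n_D a_minus_def)
  next
    case 5
    have "\<iota> (rpt_sym k (red x) \<oplus>\<^bsub>RPt k\<^esub> kN.act (\<ominus>\<^bsub>k\<^esub> \<one>\<^bsub>k\<^esub>) (rpt_sym k (red p))) = D"
      using U 5 red_add_one[OF U 5] by (simp add: kN.s_compl red_unit)
    then show ?thesis
      using U 5 by (simp add: spec_unit act_\<iota> red_minus_one \<iota>_add red_unit)
  qed
qed (simp_all)

lemma five_pos:
  assumes U: "x \<in> Units F" "p \<in> Units F" "x \<oplus> p = \<one>" "y \<in> Units F" "q \<in> Units F" "y \<oplus> q = \<one>"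
    and vx: "0 < v x"
  shows "IF.five spec x p y q = \<zero>\<^bsub>I\<^esub>"
proof -
  note vp = v_add_one[OF U(1-3) vx] and rp = red_compl[OF U(1-3) vx]
  have act_p: "IF.act p (spec b) = spec b" if "b \<in> Units F" for b
    using act_red_one[OF U(2) vp rp \<sigma>_closed[OF that]] .
  have act_xp: "IF.act (x \<otimes> p) (spec b) = IF.act x (spec b)" if "b \<in> Units F" for b
    using U that act_p[OF that] by (simp add: flip: IF.act_act)
  have T: "IF.five spec x p y q = D \<ominus>\<^bsub>I\<^esub> spec y \<oplus>\<^bsub>I\<^esub> IF.act x (spec (y \<oslash> x))
     \<ominus>\<^bsub>I\<^esub> IF.act x (spec ((y \<otimes> p) \<oslash> (x \<otimes> q))) \<oplus>\<^bsub>I\<^esub> spec (p \<oslash> q)"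
    using U vx by (simp add: IF.five_def act_p act_xp spec_pos del: v_fdiv)
  \<comment> \<open>If \<open>v y > 0\<close>, then \<open>p/q\<close> reduces to 1; the arguments
    of the third and fourth terms differ by this factor, and the fifth term is zero. Otherwise both
    arguments have negative value, so both symbols are \<open>- D\<close>, and since
    \<open>p\<close> reduces to 1 the fifth term is \<open>s (1/q) = s y - D\<close>.\<close>
  show ?thesis
  proof (cases "0 < v y")
    case True
    note vq = v_add_one[OF U(4-6) True] and rq = red_compl[OF U(4-6) True]
    have r: "p \<oslash> q \<in> Units F" "v (p \<oslash> q) = 0" "red (p \<oslash> q) = \<one>\<^bsub>k\<^esub>"
      using U vp vq rp rq by (simp_all add: red_fdiv)
    have "(y \<otimes> p) \<oslash> (x \<otimes> q) = (y \<oslash> x) \<otimes> (p \<oslash> q)"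
      using U by (simp add: frac_simps)
    then have "spec ((y \<otimes> p) \<oslash> (x \<otimes> q)) = spec (y \<oslash> x)"
      using spec_red_one[OF _ r, of "y \<oslash> x"] U by simp
    then show ?thesis
      unfolding T using U True spec_red_one'[OF r] by (simp add: spec_pos I.M.group_simps)
  next
    case False
    then have vyx: "v (y \<oslash> x) < 0" using U vx by simp
    \<comment> \<open>The argument of the fourth term has value \<open>v y - v q - v x\<close>, so
      this bound makes it negative.\<close>
    have "v y \<le> v q"
    proof (cases "v y < 0")
      case True
      then show ?thesis using v_add_one_neg[OF U(4-6)] by simp
    next
      case False
      then have "v y = 0" using \<open>\<not> 0 < v y\<close> by simp
      moreover have "\<not> v q < 0"
      proof
        assume "v q < 0"
        then have "v y = v q"
          using v_add_one_neg[OF U(5,4)] U a_comm Units_closed by metis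
        then show False using \<open>v y = 0\<close> \<open>v q < 0\<close> by simp
      qed
      ultimately show ?thesis by simp
    qed
    then have vw: "v ((y \<otimes> p) \<oslash> (x \<otimes> q)) < 0"
      using U vp add_less_le_mono[OF vx] by simp
    have "p \<oslash> q = inv q \<otimes> p" using U by (simp add: fdiv_def m_comm Units_closed)
    then have "spec (p \<oslash> q) = spec (inv q)" using spec_red_one[OF _ U(2) vp rp] U by simp
    also have "\<dots> = spec y \<ominus>\<^bsub>I\<^esub> D" by (rule spec.s_rot[OF U(4-6)])
    finally have pq: "spec (p \<oslash> q) = spec y \<ominus>\<^bsub>I\<^esub> D" .
    show ?thesis
      unfolding T pq spec_neg[OF vyx] spec_neg[OF vw] using U by (simp add: I.M.group_simps)
  qed
qed

lemma five_generic:
  assumes U: "x \<in> Units F" "p \<in> Units F" "x \<oplus> p = \<one>" "y \<in> Units F" "q \<in> Units F" "y \<oplus> q = \<one>"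
    and "v x = 0" "v p = 0" "v y = 0" "v q = 0"
  shows "IF.five spec x p y q = \<zero>\<^bsub>I\<^esub>"
proof -
  have "IF.five spec x p y q
      = \<iota> (kN.five (rpt_sym k) (red x) (red p) (red y) (red q))"
    using assms unfolding IF.five_def kN.five_def
    by (simp add: spec_unit red_fdiv red_mult_unit act_\<iota> \<iota>_add \<iota>_diff red_unit)
  also have "kN.five (rpt_sym k) (red x) (red p) (red y) (red q) = \<zero>\<^bsub>RPt k\<^esub>"
    by (rule kN.five_zero) (use assms red_unit red_add_one in auto)
  finally show ?thesis by (simp add: \<iota>_zero)
qed

text \<open>Here \<open>y\<close>, \<open>y/x\<close> and \<open>yp/(xq)\<close> all have positive
  value, and \<open>p/q\<close> has the symbol of \<open>p\<close> because \<open>q\<close> reduces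
  to 1. What remains is \<open>s x - D + <x> D - <xp> D + <p> s p\<close>, where
  \<open>s x - D\<close> equals \<open>- <-1> s p\<close>.\<close>

lemma five_generic_pos:
  assumes U: "x \<in> Units F" "p \<in> Units F" "x \<oplus> p = \<one>" "y \<in> Units F" "q \<in> Units F" "y \<oplus> q = \<one>"
    and vx: "v x = 0" "v p = 0" and vy: "0 < v y"
  shows "IF.five spec x p y q = \<zero>\<^bsub>I\<^esub>"
proof -
  have px: "p \<oplus> x = \<one>" using U a_comm Units_closed by metis
  note vq = v_add_one[OF U(4-6) vy] and rq = red_compl[OF U(4-6) vy]
  have "p \<oslash> q = p \<otimes> inv q" by (simp add: fdiv_def)
  moreover have "red (inv q) = \<one>\<^bsub>k\<^esub>" using U vq rq by (simp add: red_inv)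
  ultimately have pq: "spec (p \<oslash> q) = spec p" using spec_red_one[of p "inv q"] U vq by simp
  have 1: "spec (y \<oslash> x) = D" "spec y = D" "spec ((y \<otimes> p) \<oslash> (x \<otimes> q)) = D"
    using U vx vy vq by (simp_all add: spec_pos)
  let ?n = "\<ominus> \<one>"
  \<comment> \<open>The residue relation is used with \<open>p\<close> in the place of
    \<open>x\<close>, because \<open>s p\<close> is the symbol left over.\<close>
  have "\<iota> (rpt_sym k (red p) \<ominus>\<^bsub>RPt k\<^esub> kN.act (\<ominus>\<^bsub>k\<^esub> \<one>\<^bsub>k\<^esub> \<otimes>\<^bsub>k\<^esub> red p) (rpt_sym k (red p)))
     = \<iota> (kN.act (red x) (rpt_const k) \<ominus>\<^bsub>RPt k\<^esub> kN.act (red p \<otimes>\<^bsub>k\<^esub> red x) (rpt_const k))"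
    using kN.neg_act[of "red p" "red x"] U vx px red_add_one[OF U(2,1) px] by (simp add: red_unit)
  then have 2: "spec p \<ominus>\<^bsub>I\<^esub> IF.act (?n \<otimes> p) (spec p) = IF.act x D \<ominus>\<^bsub>I\<^esub> IF.act (p \<otimes> x) D"
    using U vx by (simp add: spec_unit act_\<iota> red_mult_unit red_minus_one \<iota>_diff red_unit)
  \<comment> \<open>Acting by <-1> produces \<open><-1> s p - <p> s p\<close> on the left and does
    not change the right side, since <-1> fixes \<open>D\<close>.\<close>
  have "IF.act ?n (spec p \<ominus>\<^bsub>I\<^esub> IF.act (?n \<otimes> p) (spec p)) = IF.act ?n (spec p) \<ominus>\<^bsub>I\<^esub> IF.act p (spec p)"
    using U by (simp add: IF.act_simps)
  moreover have "IF.act ?n (IF.act a D) = IF.act a D" if "a \<in> Units F" for a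
    using that spec.act_n_mult_c[OF act_n_D that] by (simp add: IF.act_act)
  then have "IF.act ?n (IF.act x D \<ominus>\<^bsub>I\<^esub> IF.act (p \<otimes> x) D) = IF.act x D \<ominus>\<^bsub>I\<^esub> IF.act (p \<otimes> x) D"
    using U by (simp add: IF.act_diff del: IF.act_act)
  ultimately have 3: "IF.act x D \<ominus>\<^bsub>I\<^esub> IF.act (x \<otimes> p) D = IF.act ?n (spec p) \<ominus>\<^bsub>I\<^esub> IF.act p (spec p)"
    using U unfolding 2 by (simp add: m_comm Units_closed)
  have "IF.five spec x p y q = (spec x \<ominus>\<^bsub>I\<^esub> D) \<oplus>\<^bsub>I\<^esub> (IF.act x D \<ominus>\<^bsub>I\<^esub> IF.act (x \<otimes> p) D) \<oplus>\<^bsub>I\<^esub> IF.act p (spec p)"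
    unfolding IF.five_def 1 pq using U by (simp add: I.M.group_simps)
  also have "\<dots> = \<zero>\<^bsub>I\<^esub>"
    unfolding 3 using U spec.s_compl[OF U(1-3)] by (simp add: I.M.group_simps)
  finally show ?thesis .
qed

lemma rotation:
  assumes "x \<in> Units F" "p \<in> Units F" "x \<oplus> p = \<one>"
  shows "inv p \<in> Units F" "(\<ominus> \<one> \<otimes> x) \<oslash> p \<in> Units F" "inv p \<oplus> (\<ominus> \<one> \<otimes> x) \<oslash> p = \<one>"
  using assms spec.compl_inv[OF assms] by simp_all

lemma five_spec:
  assumes U: "x \<in> Units F" "p \<in> Units F" "x \<oplus> p = \<one>" "y \<in> Units F" "q \<in> Units F" "y \<oplus> q = \<one>"
  shows "IF.five spec x p y q = \<zero>\<^bsub>I\<^esub>"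
proof -
  \<comment> \<open>In this order the alternatives say that \<open>a\<close> reduces to \<infinity>,
    to 0, to 1, or to any other point.\<close>
  have cases: "v a < 0 \<and> v b < 0 \<or> 0 < v a \<and> v b = 0 \<or> v a = 0 \<and> 0 < v b \<or> v a = 0 \<and> v b = 0"
    if "a \<in> Units F" "b \<in> Units F" "a \<oplus> b = \<one>" for a b
  proof -
    have ba: "b \<oplus> a = \<one>" using that a_comm Units_closed by metis
    consider "v a < 0" | "0 < v a" | "v b < 0" | "0 < v b" | "v a = 0" "v b = 0"
      by (metis less_linear)
    then show ?thesis
    proof cases
      case 1 then show ?thesis using v_add_one_neg[OF that 1] by simp
    next
      case 2 then show ?thesis using v_add_one[OF that 2] by simp
    next
      case 3 then show ?thesis using v_add_one_neg[OF that(2,1) ba 3] by simp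
    next
      case 4 then show ?thesis using v_add_one[OF that(2,1) ba 4] by simp
    qed simp
  qed
  have 1: "IF.five spec x p y q = \<zero>\<^bsub>I\<^esub>"
    if U: "x \<in> Units F" "p \<in> Units F" "x \<oplus> p = \<one>" "y \<in> Units F" "q \<in> Units F" "y \<oplus> q = \<one>"
      and ok: "0 < v x \<or> v x = 0 \<and> v p = 0 \<and> (0 < v y \<or> v y = 0 \<and> v q = 0)" for x p y q
    using ok five_pos[OF U] five_generic_pos[OF U] five_generic[OF U] by blast
  \<comment> \<open>Here \<open>x\<close>, or \<open>y\<close> with \<open>x\<close> at an ordinary
    point, reduces to \<infinity>. One rotation moves that point to 0, since \<open>1/p\<close> or
    \<open>1/q\<close> has positive value.\<close>
  have 2: "IF.five spec x p y q = \<zero>\<^bsub>I\<^esub>"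
    if U: "x \<in> Units F" "p \<in> Units F" "x \<oplus> p = \<one>" "y \<in> Units F" "q \<in> Units F" "y \<oplus> q = \<one>"
      and ok: "v p < 0 \<or> v x = 0 \<and> v p = 0 \<and> v q < 0" for x p y q
  proof -
    have "0 < v (inv p) \<or> v (inv p) = 0 \<and> v ((\<ominus> \<one> \<otimes> x) \<oslash> p) = 0 \<and> 0 < v (inv q)"
      using ok U by auto
    then have "IF.five spec (inv p) ((\<ominus> \<one> \<otimes> x) \<oslash> p) (inv q) ((\<ominus> \<one> \<otimes> y) \<oslash> q) = \<zero>\<^bsub>I\<^esub>"
      by (intro 1[OF rotation[OF U(1-3)] rotation[OF U(4-6)]]) blast
    then show ?thesis unfolding spec.five_rot[OF U] .
  qed
  \<comment> \<open>Here \<open>x\<close>, or \<open>y\<close> with \<open>x\<close> at an ordinary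
    point, reduces to 1. One rotation moves it to \<infinity>, the situation of the preceding
    claim.\<close>
  have 3: "IF.five spec x p y q = \<zero>\<^bsub>I\<^esub>"
    if U: "x \<in> Units F" "p \<in> Units F" "x \<oplus> p = \<one>" "y \<in> Units F" "q \<in> Units F" "y \<oplus> q = \<one>"
      and ok: "0 < v p \<or> v x = 0 \<and> v p = 0 \<and> 0 < v q" for x p y q
  proof -
    have "v x = 0" "0 < v q \<Longrightarrow> v y = 0"
      using cases[OF U(1-3)] cases[OF U(4-6)] ok by auto
    then have "v ((\<ominus> \<one> \<otimes> x) \<oslash> p) < 0 \<or>
        v (inv p) = 0 \<and> v ((\<ominus> \<one> \<otimes> x) \<oslash> p) = 0 \<and> v ((\<ominus> \<one> \<otimes> y) \<oslash> q) < 0"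
      using ok U by auto
    then have "IF.five spec (inv p) ((\<ominus> \<one> \<otimes> x) \<oslash> p) (inv q) ((\<ominus> \<one> \<otimes> y) \<oslash> q) = \<zero>\<^bsub>I\<^esub>"
      by (intro 2[OF rotation[OF U(1-3)] rotation[OF U(4-6)]]) blast
    then show ?thesis unfolding spec.five_rot[OF U] .
  qed
  show ?thesis
    using 1[OF U] 2[OF U] 3[OF U] cases[OF U(1-3)] cases[OF U(4-6)] by blast
qed

text \<open>Source and target of \<open>\<iota>\<close> have different scalar rings. Each square
  class of the residue field lifts to that of a valuation unit \<open>u\<close>, and
  \<open>\<iota>_unit\<close> translates the action of <u>.\<close>

lemma \<iota>_vimage_submodule:
  assumes H: "submodule H (RF F) I"
  shows "submodule {m \<in> carrier (RPt k). \<iota> m \<in> H} (RF k) (RPt k)"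
  unfolding RF_def
proof (rule comm_group.module_group_ring_closed[OF comm_group.sq_group_comm_group[OF k.units_comm_group]])
  show "module (group_ring (sq_group (units_of k))) (RPt k)"
    using k.RPt_module by (simp add: RF_def)
  show "subgroup {m \<in> carrier (RPt k). \<iota> m \<in> H} (add_monoid (RPt k))"
  proof (rule kN.N.M.add.subgroupI)
    have "\<zero>\<^bsub>RPt k\<^esub> \<in> {m \<in> carrier (RPt k). \<iota> m \<in> H}"
      using subgroup.one_closed[OF submodule.axioms(1)[OF H]] by (simp add: \<iota>_zero)
    then show "{m \<in> carrier (RPt k). \<iota> m \<in> H} \<noteq> {}" by blast
  qed (use I.submoduleE(3,5)[OF H] in \<open>auto simp: \<iota>_minus \<iota>_add\<close>)
  fix g m assume "g \<in> carrier (sq_group (units_of k))" and m: "m \<in> {m \<in> carrier (RPt k). \<iota> m \<in> H}"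
  then obtain w where w: "w \<in> Units k" "g = sq_class (units_of k) w"
    by (auto simp: comm_group.sq_group_carrier[OF k.units_comm_group] units_of_carrier)
  obtain u where u: "u \<in> Units F" "v u = 0" "w = red u" using Units_k_red[OF w(1)] .
  have g: "frag_of g = \<langle>red u\<rangle>\<^bsub>k\<^esub>" using w u by (simp add: sq_elt_def)
  have "\<iota> (\<langle>red u\<rangle>\<^bsub>k\<^esub> \<odot>\<^bsub>RPt k\<^esub> m) \<in> H"
    using m u I.submoduleE(4)[OF H, of "\<langle>u\<rangle>" "\<iota> m"] by (simp add: \<iota>_unit)
  then show "frag_of g \<odot>\<^bsub>RPt k\<^esub> m \<in> {m \<in> carrier (RPt k). \<iota> m \<in> H}"
    unfolding g using m u red_unit by simp
qed

lemma specialization: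
  "\<exists>S \<in> mod_hom (RF F) (RP F) I. S ` carrier (RP F) = carrier I \<and>
    (\<forall>a \<in> Units F. S (rp_sym F a) = spec a)"
proof -
  \<comment> \<open>\<open>None\<close> is a generator only when \<open>F\<close> has two elements.
    The prescribed values then leave its image open, and \<open>D\<close> is a choice that makes the
    map surjective.\<close>
  define \<phi> where "\<phi> x = (case x of Some a \<Rightarrow> spec a | None \<Rightarrow> D)" for x
  have \<phi>_Some: "(\<lambda>a. \<phi> (Some a)) = (\<lambda>a. spec a)" by (simp add: \<phi>_def)
  have inv_n: "inv (\<ominus> \<one>) = \<ominus> \<one>"
    by (rule comm_inv_char) (simp_all add: l_minus r_minus)
  obtain S where S: "S \<in> mod_hom (RF F) (RP F) I"
    and S_sym: "\<And>a. a \<in> Units F \<Longrightarrow> S (rp_sym F a) = \<phi> (Some a)"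
    and S_const: "order F = 2 \<Longrightarrow> S (rp_const F) = \<phi> None"
  proof (rule RP_lift[OF Ind_module, of \<phi>])
    show "\<phi> x \<in> carrier I" if "x \<in> rp_gens F" for x
      using that by (auto simp: \<phi>_def rp_gens_def split: if_splits)
    show "\<phi> (Some \<one>) = \<zero>\<^bsub>I\<^esub>"
      using spec_red_one'[of \<one>] by (simp add: \<phi>_def red_one)
    show "\<phi> None \<oplus>\<^bsub>I\<^esub> \<phi> None \<oplus>\<^bsub>I\<^esub> \<phi> None = \<zero>\<^bsub>I\<^esub>"
      by (simp add: \<phi>_def three_D)
    \<comment> \<open>As -1 is its own inverse, the inversion identity at -1 is the relation wanted
      over three elements.\<close>
    have "spec (\<ominus> \<one>) = \<ominus>\<^bsub>I\<^esub> IF.act (\<ominus> \<one>) (spec (\<ominus> \<one>))"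
      using spec.s_inv[of "\<ominus> \<one>"] inv_n by simp
    then have "spec (\<ominus> \<one>) \<oplus>\<^bsub>I\<^esub> IF.act (\<ominus> \<one>) (spec (\<ominus> \<one>)) = \<zero>\<^bsub>I\<^esub>"
      by (subst (asm) I.M.neg_eq_iff(2)) simp_all
    then show "\<phi> (Some (\<ominus> \<one>)) \<oplus>\<^bsub>I\<^esub> \<langle>\<ominus> \<one>\<rangle> \<odot>\<^bsub>I\<^esub> \<phi> (Some (\<ominus> \<one>)) = \<zero>\<^bsub>I\<^esub>"
      by (simp add: \<phi>_def IF.act_def)
    show "IF.five (\<lambda>a. \<phi> (Some a)) x p y q = \<zero>\<^bsub>I\<^esub>"
      if "x \<in> Units F" "p \<in> Units F" "x \<oplus> p = \<one>" "y \<in> Units F" "q \<in> Units F" "y \<oplus> q = \<one>" for x p y q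
      using five_spec[OF that] by (simp add: \<phi>_Some)
  qed (rule that)
  have S_sym': "S (rp_sym F a) = spec a" if "a \<in> Units F" for a
    using S_sym[OF that] by (simp add: \<phi>_def)
  let ?H = "S ` carrier (RP F)"
  have H: "submodule ?H (RF F) I" by (rule mod_hom_image_submodule[OF RP_module Ind_module S])
  \<comment> \<open>The tensors \<open>1 \<otimes> m\<close> generate the induced module, so it is
    enough that the image contains those for generators \<open>m\<close> of
    \<open>RPt k\<close>.\<close>
  have "{m \<in> carrier (RPt k). \<iota> m \<in> ?H} = carrier (RPt k)"
  proof (rule k.RPt_spanned[OF \<iota>_vimage_submodule[OF H]])
    fix w assume w: "w \<in> Units k"
    then obtain u where u: "u \<in> Units F" "v u = 0" "w = red u" by (rule Units_k_red)
    then have "\<iota> (rpt_sym k w) = S (rp_sym F u)" by (simp add: S_sym' spec_unit)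
    then show "rpt_sym k w \<in> {m \<in> carrier (RPt k). \<iota> m \<in> ?H}"
      using w rp_sym_closed by auto
  next
    assume o: "order k = 2"
    \<comment> \<open>An element of positive value, or the inverse of one of negative value, maps to
      \<open>D\<close>. If all values are zero, \<open>F\<close> has two elements and its own
      constant maps to \<open>D\<close>.\<close>
    have "D \<in> ?H"
    proof (cases "\<exists>a \<in> Units F. v a \<noteq> 0")
      case True
      then obtain a where a: "a \<in> Units F" "v a \<noteq> 0" by blast
      then have "0 < v a \<or> 0 < v (inv a)" by auto
      then obtain b where "b \<in> Units F" "0 < v b" using a Units_inv_Units by blast
      then have "D = S (rp_sym F b)" by (simp add: S_sym' spec_pos)
      then show ?thesis using rp_sym_closed by blast
    next
      case False
      then have "order F = 2" using order_res_field_trivial o by simp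
      then have "D = S (rp_const F)" using S_const by (simp add: \<phi>_def)
      then show ?thesis using rp_const_closed by blast
    qed
    then show "rpt_const k \<in> {m \<in> carrier (RPt k). \<iota> m \<in> ?H}" by simp
  qed
  then have "?H = carrier I"
    by (intro Ind_spanned[OF H]) blast
  then show ?thesis using S S_sym' by blast
qed

end

theorem theoremA4:
  fixes F :: "('a, 'm) ring_scheme" and v :: "'a \<Rightarrow> 'g::linordered_ab_group_add"
  assumes "field F" and "valuation F v"
  defines "k \<equiv> res_field F v"
  shows "\<exists>S \<in> mod_hom (RF F) (RP F) (Ind F v (RPt k)).
    S ` carrier (RP F) = carrier (Ind F v (RPt k)) \<and>
    (\<forall>a \<in> Units F. S (rp_sym F a) =
      (if v a = 0 then ind_tensor F v (RPt k) \<one>\<^bsub>RF F\<^esub> (rpt_sym k (reduction F v a))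
       else if v a > 0 then ind_tensor F v (RPt k) \<one>\<^bsub>RF F\<^esub> (rpt_const k)
       else \<ominus>\<^bsub>Ind F v (RPt k)\<^esub> ind_tensor F v (RPt k) \<one>\<^bsub>RF F\<^esub> (rpt_const k)))"
proof -
  interpret valued_field F v
    using assms(1,2) by (intro valued_field.intro valued_field_axioms.intro)
  have "spec a = (if v a = 0 then ind_tensor F v (RPt k) \<one>\<^bsub>RF F\<^esub> (rpt_sym k (reduction F v a))
       else if v a > 0 then ind_tensor F v (RPt k) \<one>\<^bsub>RF F\<^esub> (rpt_const k)
       else \<ominus>\<^bsub>Ind F v (RPt k)\<^esub> ind_tensor F v (RPt k) \<one>\<^bsub>RF F\<^esub> (rpt_const k))" for a
    by (auto simp: spec_unit spec_pos spec_neg k_def simp flip: \<iota>_def)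
  then show ?thesis using specialization unfolding k_def by simp
qed

end
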